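(* For all integers $n\ge 0$ and $\alpha\ge 1$, $$PDN1\left(7^{2\alpha-1}n+\frac{17\cdot 7^{2\alpha-1}+1}{24}\right)\equiv 0\pmod{7^{\alpha}}$$ and $$PDN1\left(7^{2\alpha}n+\frac{23\cdot 7^{2\alpha}+1}{24}\right)\equiv 0\pmod{7^{\alpha+1}}.$$
   Context: $PDN1(N)$ is Andrews and Paule's function counting partition diamonds with $(n+1)$ copies of $n$ in which the parts at the links sum to $N$. Its generating function is $$\sum_{n\ge 0}PDN1(n)q^n=\frac{J_2^2}{J_1^5},\qquad J_k:=\prod_{m\ge1}(1-q^{km}),$$ and this identity may be taken as the definition of $PDN1(n)$. *)

theory Defs
  imports
    "HOL-Analysis.Analysis"
    "HOL-Computational_Algebra.Formal_Power_Series"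
    "HOL-Number_Theory.Cong"
begin

text \<open>
  The infinite product is taken in the \<open>fps_X\<close>-adic topology; \<open>J_has_prod\<close> shows that it
  converges for positive \<open>k\<close>. The library product is indexed from 0.
\<close>

definition J :: "nat \<Rightarrow> int fps" where
  "J k = (\<Prod>m. 1 - fps_X ^ (k * Suc m))"

text \<open>
  Since \<open>int fps\<close> has no \<open>inverse\<close> operation, the reciprocal of the integer series \<open>J 1 ^ 5\<close>
  (constant term 1) is the library's \<open>fps_right_inverse\<close> with constant term 1;
  \<open>PDN1_gf\<close> below shows that this is the quotient.
\<close>

definition PDN1 :: "nat \<Rightarrow> int" where
  "PDN1 n = fps_nth (J 2 ^ 2 * fps_right_inverse (J 1 ^ 5) 1) n"

lemma J_factor_neq_0:
  assumes "k > 0"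
  shows "1 - fps_X ^ (k * Suc m) \<noteq> (0 :: int fps)"
proof -
  have "fps_nth (1 - fps_X ^ (k * Suc m) :: int fps) 0 = 1"
    using assms by (simp add: fps_X_power_nth)
  thus ?thesis by (metis fps_zero_nth zero_neq_one)
qed

lemma J_has_prod_aux:
  assumes "k > 0"
  shows "(\<lambda>m. 1 - fps_X ^ (k * Suc m)) has_prod J k" and "fps_nth (J k) 0 = 1"
proof -
  define f :: "nat \<Rightarrow> int fps" where "f = (\<lambda>m. 1 - fps_X ^ (k * Suc m))"
  have nz: "f m \<noteq> 0" for m
    unfolding f_def by (rule J_factor_neq_0[OF assms])
  have sub: "subdegree (f m - 1) > n" if "m > n" for m n
  proof -
    have "Suc m \<le> k * Suc m" using assms by (cases k) auto
    moreover have "subdegree (f m - 1) = k * Suc m"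
      by (simp add: f_def)
    ultimately show ?thesis using that by linarith
  qed
  obtain P where P: "(\<lambda>n. \<Prod>i\<le>n. f i) \<longlonglongrightarrow> P"
    using tendsto_prod_fps[of f "\<lambda>n. n", OF nz sub] by blast
  have f0: "fps_nth (f i) 0 = 1" for i
    using assms by (simp add: f_def fps_X_power_nth)
  have prod0: "fps_nth (\<Prod>i\<le>n. f i) 0 = 1" for n
    by (induction n) (simp_all add: f0)
  have "\<forall>\<^sub>F n in sequentially. fps_nth (\<Prod>i\<le>n. f i) 0 = fps_nth P 0"
    using P unfolding tendsto_fps_iff by blast
  hence P0: "fps_nth P 0 = 1" by (simp add: prod0)
  hence "P \<noteq> 0" by auto
  with P have "f has_prod P"
    by (simp add: has_prod_def raw_has_prod_def)
  moreover have "J k = prodinf f" by (simp add: J_def f_def)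
  ultimately show "(\<lambda>m. 1 - fps_X ^ (k * Suc m)) has_prod J k" "fps_nth (J k) 0 = 1"
    using has_prod_unique[of f P] P0 by (simp_all add: f_def)
qed

lemmas J_has_prod = J_has_prod_aux(1) and J_nth_0 = J_has_prod_aux(2)

theorem PDN1_gf: "Abs_fps PDN1 * J 1 ^ 5 = J 2 ^ 2"
proof -
  have "fps_nth (J 1 ^ 5) 0 * 1 = 1"
    by (simp add: fps_power_zeroth J_nth_0)
  hence inv: "J 1 ^ 5 * fps_right_inverse (J 1 ^ 5) 1 = 1"
    by (rule fps_right_inverse)
  have "Abs_fps PDN1 = J 2 ^ 2 * fps_right_inverse (J 1 ^ 5) 1"
    by (simp add: fps_eq_iff PDN1_def)
  hence "Abs_fps PDN1 * J 1 ^ 5 = J 2 ^ 2 * (J 1 ^ 5 * fps_right_inverse (J 1 ^ 5) 1)"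
    by (simp only: mult_ac)
  thus ?thesis by (simp only: inv mult_1_right)
qed

text \<open>Both offsets are integers, so the \<open>div\<close> in the statement is exact.\<close>

lemma offset_odd_exact:
  assumes "\<alpha> \<ge> (1 :: nat)"
  shows "(24 :: nat) dvd 17 * 7 ^ (2 * \<alpha> - 1) + 1"
proof -
  obtain b where b: "\<alpha> = Suc b" using assms by (cases \<alpha>) auto
  have "(24 :: nat) dvd 17 * 7 ^ (2 * b + 1) + 1"
  proof (induction b)
    case (Suc b)
    have "17 * 7 ^ (2 * Suc b + 1) + 1 = 49 * (17 * 7 ^ (2 * b + 1) + 1) - (48 :: nat)"
      by simp
    thus ?case using Suc by (metis dvd_diff_nat dvd_mult dvd_triv_left mult_2_right numeral_Bit0)
  qed simp
  thus ?thesis by (simp add: b)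
qed

lemma offset_even_exact: "(24 :: nat) dvd 23 * 7 ^ (2 * \<alpha>) + 1"
proof (induction \<alpha>)
  case (Suc \<alpha>)
  have "23 * 7 ^ (2 * Suc \<alpha>) + 1 = 49 * (23 * 7 ^ (2 * \<alpha>) + 1) - (48 :: nat)"
    by simp
  thus ?case using Suc by (metis dvd_diff_nat dvd_mult dvd_triv_left mult_2_right numeral_Bit0)
qed simp

end

theory Submission
  imports Defs "HOL-Computational_Algebra.Computational_Algebra"
begin

text \<open>
  Put \<open>A = J\<^sub>2\<^sup>2 / J\<^sub>1\<^sup>5\<close> and let \<open>U\<close> keep the exponents divisible by 7. The sections of \<open>A\<close> in question arise
  by applying \<open>U (X\<^sup>2 \<cdot>)\<close> and \<open>U\<close> alternately. After division by \<open>A\<close>, respectively \<open>A (X\<^sup>7)\<close>, they become modular functions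
  of level 14, namely polynomials in two eta quotients \<open>t\<close> and \<open>H\<close> that satisfy a cubic equation.

  The action of \<open>U\<close> on such polynomials is computed from the 7-dissections of \<open>J\<^sub>1\<close>, \<open>J\<^sub>2\<close> and \<open>J\<^sub>1\<^sup>2 / J\<^sub>2\<close>. The three
  components of \<open>J\<^sub>1\<close> relative to the fourth lie on the Klein quartic, a consequence of Jacobi's identity for \<open>J\<^sub>1\<^sup>3\<close>. Hence
  \<open>s = J\<^sub>1 / u\<^sub>2\<close> satisfies an equation of degree 7 over the series in \<open>X\<^sup>7\<close>, and \<open>U (s\<^sup>-\<^sup>k)\<close>, as well as its products with the
  other two dissected series, obeys a linear recurrence with seven explicit initial values. The recurrence shows that \<open>U\<close>
  and \<open>U (\<phi> \<cdot>)\<close> preserve a filtration that weighs powers of 7 against the degree in \<open>t\<close> and \<open>H\<close>, and that each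
  application gains the required factor 7.
\<close>

subsection \<open>Euler products and Gaussian binomials\<close>

text \<open>The natural index of \<open>A\<close> is 24*N - 1. Divisibility by 7 forces N = 7*m - 2,
  which leaves 24*m - 7 after division; the next division forces m = 0 modulo 7, without a shift.
  Hence two alternating operators. The curve of level 14 has genus 1 and lies with degree 3 over the
  line with coordinate \<open>t\<close>, so no single function carries the argument: powers of
  \<open>t\<close> times 1, \<open>H\<close>, \<open>H^2\<close> do. No theory of modular forms
  enters. Identities between eta quotients come from the triple product, and the unknown components
  of the dissections are tied together by one equation, (J_1^2 / J_2) * J_2 = J_1^2, compared class
  by class modulo 7. The weights are tuned so that before \<open>U\<close> only t, t^2 and t*H can
  carry the least power of 7, and \<open>U\<close> maps these three to multiples of 7. One further 7
  is present from the start, in \<open>U \<phi>\<close>. Complex coefficients supply quotients and a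
  seventh root of unity; integrality returns at the end because \<open>t\<close> and
  \<open>H\<close> are integral.\<close>

definition agree :: "nat \<Rightarrow> 'a::comm_ring_1 fps \<Rightarrow> 'a fps \<Rightarrow> bool" where
  "agree n f g \<longleftrightarrow> (\<forall>i\<le>n. fps_nth f i = fps_nth g i)"

lemma agree_refl [simp]: "agree n f f"
  and agree_sym: "agree n f g \<Longrightarrow> agree n g f"
  and agree_trans: "agree n f g \<Longrightarrow> agree n g h \<Longrightarrow> agree n f h"
  and agree_mono: "agree n f g \<Longrightarrow> m \<le> n \<Longrightarrow> agree m f g"
  and agree_nth: "agree n f g \<Longrightarrow> i \<le> n \<Longrightarrow> fps_nth f i = fps_nth g i"
  by (auto simp: agree_def)

lemma agree_mult: "agree n f g \<Longrightarrow> agree n h k \<Longrightarrow> agree n (f * h) (g * k)"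
  by (auto simp: agree_def fps_mult_nth intro!: sum.cong)

lemma agree_prod: "(\<And>x. x \<in> A \<Longrightarrow> agree n (f x) (g x)) \<Longrightarrow> agree n (prod f A) (prod g A)"
  by (induction A rule: infinite_finite_induct) (auto intro: agree_mult)

lemma agree_all_imp_eq: "(\<And>n. agree n f g) \<Longrightarrow> f = g"
  by (auto simp: agree_def fps_eq_iff)

lemma agree_cancel_unit:
  assumes "agree n (E * f) E" "fps_nth E 0 = 1"
  shows "agree n f 1"
proof -
  define R where "R = fps_right_inverse E 1"
  have R: "E * R = 1" unfolding R_def by (rule fps_right_inverse) (use assms in simp)
  have "agree n (R * (E * f)) (R * E)" using assms(1) by (rule agree_mult[OF agree_refl])
  thus ?thesis using R by (simp add: mult.assoc[symmetric] mult.commute[of R E])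
qed

text \<open>Factors with m > n cannot affect coefficient n, so truncation yields the infinite
  product over the positive elements of \<open>S\<close> without a limit. \<open>J_eq_euler\<close>
  identifies it with the convergent product.\<close>

definition euler :: "nat set \<Rightarrow> 'a::comm_ring_1 fps" where
  "euler S = Abs_fps (\<lambda>n. fps_nth (\<Prod>m\<in>S \<inter> {1..n}. 1 - fps_X ^ m) n)"

lemma agree_euler_factor: "m > n \<Longrightarrow> agree n (1 - fps_X ^ m) 1"
  by (auto simp: agree_def fps_X_power_nth)

lemma agree_prod_extend:
  assumes "finite B" "A \<subseteq> B" "\<And>m. m \<in> B - A \<Longrightarrow> m > n"
  shows "agree n (\<Prod>m\<in>B. 1 - fps_X ^ m) (\<Prod>m\<in>A. 1 - fps_X ^ m)"
proof -
  have "(\<Prod>m\<in>B. 1 - fps_X ^ m) = (\<Prod>m\<in>B-A. 1 - fps_X ^ m) * (\<Prod>m\<in>A. 1 - fps_X ^ m :: 'a fps)"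
    using assms by (metis prod.subset_diff)
  moreover have "agree n (\<Prod>m\<in>B-A. 1 - fps_X ^ m) (\<Prod>m\<in>B-A. 1 :: 'a fps)"
    by (rule agree_prod) (use assms in \<open>auto intro: agree_euler_factor\<close>)
  ultimately show ?thesis
    using agree_mult[OF _ agree_refl, of n "\<Prod>m\<in>B-A. 1 - fps_X ^ m" "\<Prod>m\<in>B-A. 1"] by simp
qed

lemma agree_euler:
  assumes "finite B" "S \<inter> {1..n} \<subseteq> B" "B \<subseteq> S" "0 \<notin> B"
  shows "agree n (euler S) (\<Prod>m\<in>B. 1 - fps_X ^ m)"
  unfolding agree_def
proof (intro allI impI)
  fix i assume i: "i \<le> n"
  have pos: "m > 0" if "m \<in> B" for m using that assms(4) by (cases m) auto
  have "agree i (\<Prod>m\<in>B. 1 - fps_X ^ m) (\<Prod>m\<in>S \<inter> {1..i}. 1 - fps_X ^ m :: 'a fps)"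
  proof (rule agree_prod_extend)
    show "S \<inter> {1..i} \<subseteq> B" using assms(2) i by auto
    show "m > i" if "m \<in> B - S \<inter> {1..i}" for m
      using that pos[of m] assms(3) by auto
  qed (rule assms)
  thus "fps_nth (euler S) i = fps_nth (\<Prod>m\<in>B. 1 - fps_X ^ m :: 'a fps) i"
    by (auto simp: euler_def agree_def)
qed

lemma agree_euler_atMost: "agree n (euler S) (\<Prod>m\<in>S \<inter> {1..n}. 1 - fps_X ^ m)"
  by (rule agree_euler) auto

lemma euler_nth_0 [simp]: "fps_nth (euler S) 0 = 1"
  by (simp add: euler_def)

lemma euler_nonzero [simp]: "euler S \<noteq> 0"
  using euler_nth_0[of S] by (metis fps_zero_nth zero_neq_one)

lemma euler_Un:
  assumes "S \<inter> T = {}"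
  shows "euler (S \<union> T) = euler S * euler T"
proof (rule agree_all_imp_eq)
  fix n
  have "(\<Prod>m\<in>(S \<union> T) \<inter> {1..n}. 1 - fps_X ^ m) =
      (\<Prod>m\<in>S \<inter> {1..n}. 1 - fps_X ^ m) * (\<Prod>m\<in>T \<inter> {1..n}. 1 - fps_X ^ m :: 'a fps)"
    using assms by (subst prod.union_disjoint[symmetric]) (auto intro!: prod.cong)
  hence "agree n (euler (S \<union> T))
      ((\<Prod>m\<in>S \<inter> {1..n}. 1 - fps_X ^ m) * (\<Prod>m\<in>T \<inter> {1..n}. 1 - fps_X ^ m :: 'a fps))"
    using agree_euler_atMost[of n "S \<union> T", where 'a = 'a] by simp
  moreover have "agree n (euler S * euler T)
      ((\<Prod>m\<in>S \<inter> {1..n}. 1 - fps_X ^ m) * (\<Prod>m\<in>T \<inter> {1..n}. 1 - fps_X ^ m :: 'a fps))"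
    by (intro agree_mult agree_euler_atMost)
  ultimately show "agree n (euler (S \<union> T)) (euler S * euler T :: 'a fps)"
    using agree_sym agree_trans by blast
qed

text \<open>The Pascal recursion defines Gaussian binomials over any commutative ring, where a
  quotient of q-factorials may not exist; \<open>qbin_qfact\<close> recovers that quotient.\<close>

fun qbin :: "'a::comm_ring_1 \<Rightarrow> nat \<Rightarrow> nat \<Rightarrow> 'a" where
  "qbin q n 0 = 1"
| "qbin q 0 (Suc k) = 0"
| "qbin q (Suc n) (Suc k) = qbin q n k + q ^ Suc k * qbin q n (Suc k)"

lemma qbin_eq_0: "k > n \<Longrightarrow> qbin q n k = 0"
  by (induction q n k rule: qbin.induct) auto

lemma Suc_choose_2: "Suc k choose 2 = (k choose 2) + k"
  by (simp add: numeral_2_eq_2)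

text \<open>The homogeneous form matters: with \<open>c = q ^ n\<close> the negative powers of q of
  the triple product never appear. The induction splits off the factor i = 0 and passes from
  \<open>a\<close> to \<open>a * q\<close>.\<close>

lemma qbinomial_theorem:
  fixes a c q :: "'a::comm_ring_1"
  shows "(\<Prod>i<n. c + a * q ^ i) = (\<Sum>k\<le>n. q ^ (k choose 2) * qbin q n k * a ^ k * c ^ (n - k))"
proof (induction n arbitrary: a)
  case (Suc n)
  define T where "T k = q ^ (k choose 2) * q ^ k * qbin q n k * a ^ k" for k
  have "(\<Prod>i<Suc n. c + a * q ^ i) = (c + a) * (\<Prod>i<n. c + (a * q) * q ^ i)"
    by (subst prod.lessThan_Suc_shift) (simp add: mult_ac)
  also have "(\<Prod>i<n. c + (a * q) * q ^ i) = (\<Sum>k\<le>n. T k * c ^ (n - k))"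
    by (subst Suc.IH) (auto intro!: sum.cong simp: T_def power_mult_distrib mult_ac)
  also have "(c + a) * \<dots> = (\<Sum>k\<le>n. T k * c ^ (Suc n - k)) + (\<Sum>k\<le>n. a * T k * c ^ (n - k))"
    by (simp add: ring_distribs sum_distrib_left Suc_diff_le sum.distrib) (simp add: mult_ac)
  also have "(\<Sum>k\<le>n. T k * c ^ (Suc n - k)) = c ^ Suc n + (\<Sum>k\<le>n. T (Suc k) * c ^ (n - k))"
  proof -
    have "(\<Sum>k\<le>n. T k * c ^ (Suc n - k)) = (\<Sum>k\<le>Suc n. T k * c ^ (Suc n - k))"
      by (simp add: T_def qbin_eq_0)
    also have "\<dots> = c ^ Suc n + (\<Sum>k\<le>n. T (Suc k) * c ^ (n - k))"
      by (subst sum.atMost_Suc_shift) (simp add: T_def binomial_eq_0)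
    finally show ?thesis .
  qed
  also have "c ^ Suc n + (\<Sum>k\<le>n. T (Suc k) * c ^ (n - k)) + (\<Sum>k\<le>n. a * T k * c ^ (n - k)) =
      (\<Sum>k\<le>Suc n. q ^ (k choose 2) * qbin q (Suc n) k * a ^ k * c ^ (Suc n - k))"
  proof -
    have "q ^ (Suc k choose 2) * qbin q (Suc n) (Suc k) * a ^ Suc k * c ^ (n - k) =
        T (Suc k) * c ^ (n - k) + a * T k * c ^ (n - k)" for k
      unfolding T_def Suc_choose_2 qbin.simps power_add power_Suc by (simp only: ring_distribs mult_ac add_ac)
    thus ?thesis
      by (subst sum.atMost_Suc_shift) (simp add: sum.distrib add.assoc binomial_eq_0 del: qbin.simps(3) power_Suc)
  qed
  finally show ?case .
qed (simp add: binomial_eq_0)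

definition qfact :: "'a::comm_ring_1 \<Rightarrow> nat \<Rightarrow> 'a" where
  "qfact q n = (\<Prod>i<n. 1 - q ^ Suc i)"

lemma qbin_qfact: "k \<le> n \<Longrightarrow> qbin q n k * qfact q k * qfact q (n - k) = qfact q n"
proof (induction q n k rule: qbin.induct)
  case (3 q n k)
  have fS: "qfact q (Suc m) = qfact q m * (1 - q ^ Suc m)" for m
    by (simp add: qfact_def)
  have 1: "qbin q n k * qfact q k * qfact q (n - k) = qfact q n"
    using 3 by simp
  show ?case
  proof (cases "k = n")
    case True
    have "qbin q n n * qfact q n = qfact q n" using 1 True by (simp add: qfact_def)
    thus ?thesis using True by (simp add: qbin_eq_0 fS mult.assoc[symmetric]) (simp add: qfact_def)
  next
    case False
    hence 2: "qbin q n (Suc k) * qfact q (Suc k) * qfact q (n - Suc k) = qfact q n"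
      using 3 by simp
    have "n - k = Suc (n - Suc k)" using False 3(3) by simp
    hence f: "qfact q (n - k) = qfact q (n - Suc k) * (1 - q ^ (n - k))"
      using fS[of "n - Suc k"] by metis
    have "Suc k + (n - k) = Suc n" using 3(3) by simp
    hence e: "q ^ Suc k * q ^ (n - k) = q ^ Suc n"
      by (metis power_add)
    define A B where "A = q ^ Suc k" and "B = q ^ (n - k)"
    have "qbin q (Suc n) (Suc k) * qfact q (Suc k) * qfact q (n - k) =
       qbin q n k * (qfact q k * (1 - A)) * qfact q (n - k) +
       A * (qbin q n (Suc k) * qfact q (Suc k) * qfact q (n - k))"
      by (simp only: qbin.simps fS[of k] A_def) (simp only: ring_distribs mult_ac)
    also have "A * (qbin q n (Suc k) * qfact q (Suc k) * qfact q (n - k)) =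
       A * (qbin q n (Suc k) * qfact q (Suc k) * qfact q (n - Suc k)) * (1 - B)"
      by (simp only: f B_def mult_ac)
    also have "qbin q n k * (qfact q k * (1 - A)) * qfact q (n - k) =
       (qbin q n k * qfact q k * qfact q (n - k)) * (1 - A)"
      by (simp only: mult_ac)
    also have "(qbin q n k * qfact q k * qfact q (n - k)) * (1 - A) +
        A * (qbin q n (Suc k) * qfact q (Suc k) * qfact q (n - Suc k)) * (1 - B) = qfact q n * (1 - A * B)"
      by (simp only: 1 2) (simp add: algebra_simps)
    finally show ?thesis
      unfolding A_def B_def e by (simp only: fS[of n] diff_Suc_Suc)
  qed
qed (auto simp: qfact_def)

lemma agree_euler_qfact:
  assumes "b > 0"
  shows "agree n (euler {m. b dvd m}) (qfact (fps_X ^ b) n)"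
proof -
  have "qfact (fps_X ^ b :: 'a fps) n = (\<Prod>m\<in>(\<lambda>i. b * Suc i) ` {..<n}. 1 - fps_X ^ m)"
    unfolding qfact_def using assms
    by (subst prod.reindex) (auto simp: inj_on_def power_mult simp del: power_Suc mult_Suc_right)
  moreover have "agree n (euler {m. b dvd m}) (\<Prod>m\<in>(\<lambda>i. b * Suc i) ` {..<n}. 1 - fps_X ^ m :: 'a fps)"
  proof (rule agree_euler)
    show "{m. b dvd m} \<inter> {1..n} \<subseteq> (\<lambda>i. b * Suc i) ` {..<n}"
    proof
      fix m assume m: "m \<in> {m. b dvd m} \<inter> {1..n}"
      then obtain k where k: "m = b * k" by auto
      with m obtain l where l: "k = Suc l" by (cases k) auto
      have "k \<le> m" using k assms by simp
      thus "m \<in> (\<lambda>i. b * Suc i) ` {..<n}" using k l m by auto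
    qed
  qed (use assms in auto)
  ultimately show ?thesis by simp
qed

text \<open>The three q-factorials in the quotient formula all agree with the full Euler product up
  to order min k (n - k), so the Gaussian binomial behaves like its reciprocal there.\<close>

lemma agree_euler_qbin:
  assumes "b > 0" "k \<le> n"
  shows "agree (min k (n - k)) (euler {m. b dvd m} * qbin (fps_X ^ b) n k) 1"
proof (rule agree_cancel_unit)
  let ?E = "euler {m. b dvd m} :: 'a fps" and ?q = "fps_X ^ b :: 'a fps"
  let ?N = "min k (n - k)"
  have A: "agree ?N ?E (qfact ?q k)" "agree ?N ?E (qfact ?q (n-k))" "agree ?N ?E (qfact ?q n)"
    using assms(2) by (auto intro: agree_mono[OF agree_euler_qfact[OF assms(1)]])
  have "agree ?N (?E * (?E * qbin ?q n k)) (qfact ?q k * (qfact ?q (n-k) * qbin ?q n k))"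
    by (intro agree_mult A agree_refl)
  also have "qfact ?q k * (qfact ?q (n-k) * qbin ?q n k) = qfact ?q n"
    using qbin_qfact[OF assms(2), of ?q] by (simp add: mult_ac)
  finally show "agree ?N (?E * (?E * qbin ?q n k)) ?E"
    using A(3) agree_sym agree_trans by blast
qed (simp add: binomial_eq_0)

text \<open>Passage to the limit in a single coefficient. The bound on \<open>\<theta>\<close>
  leaves finitely many j for each N, and for j = k - n it gives N - \<theta> j <= n - |j| = min k
  (2*n - k), the range where the Gaussian binomial has reached its limit. The summand 1 allows for
  cases such as \<theta> 1 = 0.\<close>

lemma theta_limit:
  fixes \<theta> :: "int \<Rightarrow> nat" and \<omega> :: "int \<Rightarrow> 'a::comm_ring_1"
  assumes "b > 0" "\<And>j. \<bar>j\<bar> \<le> int (\<theta> j) + 1" "N < n"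
  shows "fps_nth (euler {m. b dvd m} *
      (\<Sum>k\<le>2*n. fps_const (\<omega> (int k - int n)) * fps_X ^ \<theta> (int k - int n) * qbin (fps_X ^ b) (2*n) k)) N =
    (\<Sum>j | \<theta> j = N. \<omega> j)"
proof -
  let ?E = "euler {m. b dvd m} :: 'a fps"
  have "fps_nth (?E * (fps_const (\<omega> (int k - int n)) * fps_X ^ \<theta> (int k - int n) * qbin (fps_X ^ b) (2*n) k)) N =
     (if \<theta> (int k - int n) = N then \<omega> (int k - int n) else 0)" if k: "k \<le> 2 * n" for k
  proof -
    define j where "j = int k - int n"
    have "?E * (fps_const (\<omega> j) * fps_X ^ \<theta> j * qbin (fps_X ^ b) (2*n) k) =
       fps_const (\<omega> j) * (fps_X ^ \<theta> j * (?E * qbin (fps_X ^ b) (2*n) k))"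
      by (simp add: mult_ac)
    moreover have "fps_nth (?E * qbin (fps_X ^ b) (2*n) k) (N - \<theta> j) = (if \<theta> j = N then 1 else 0)" if "\<not> N < \<theta> j"
    proof -
      have "N - \<theta> j \<le> min k (2 * n - k)"
        using assms(2)[of j] assms(3) that k by (auto simp: j_def)
      from agree_nth[OF agree_euler_qbin[OF assms(1) k] this] that show ?thesis by auto
    qed
    ultimately show ?thesis
      unfolding j_def[symmetric] by (simp only: fps_mult_left_const_nth fps_X_power_mult_nth) auto
  qed
  hence "fps_nth (?E * (\<Sum>k\<le>2*n. fps_const (\<omega> (int k - int n)) * fps_X ^ \<theta> (int k - int n) * qbin (fps_X ^ b) (2*n) k)) N
    = (\<Sum>k\<le>2*n. if \<theta> (int k - int n) = N then \<omega> (int k - int n) else 0)"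
    by (simp add: sum_distrib_left fps_sum_nth)
  also have "\<dots> = (\<Sum>k | k \<le> 2*n \<and> \<theta> (int k - int n) = N. \<omega> (int k - int n))"
    by (subst sum.inter_filter[symmetric]) (auto intro!: sum.cong)
  also have "\<dots> = (\<Sum>j | \<theta> j = N. \<omega> j)"
  proof (rule sum.reindex_bij_witness[of _ "\<lambda>j. nat (j + int n)" "\<lambda>k. int k - int n"])
    fix j assume "j \<in> {j. \<theta> j = N}"
    hence "\<bar>j\<bar> \<le> int n" using assms(2)[of j] assms(3) by auto
    thus "int (nat (j + int n)) - int n = j" "nat (j + int n) \<in> {k. k \<le> 2 * n \<and> \<theta> (int k - int n) = N}"
      using \<open>j \<in> _\<close> by auto
  qed auto
  finally show ?thesis .
qed

subsection \<open>The Jacobi triple product\<close>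

text \<open>The exponent b*j*(j-1)/2 + a*j of a theta series. The pairs (3,1), (1,0), (2,1) for
  (b,a) give pentagonal numbers, triangular numbers and squares.\<close>

definition theta_exp :: "nat \<Rightarrow> nat \<Rightarrow> int \<Rightarrow> nat" where
  "theta_exp b a j = nat ((int b * (j * (j - 1)) + 2 * int a * j) div 2)"

lemma theta_exp_bound:
  assumes "a < b"
  shows "2 * \<bar>j\<bar> \<le> int b * (j * (j - 1)) + 2 * int a * j + 2"
proof (cases "j \<ge> 1")
  case True
  hence "0 \<le> j * (j - 1)" by simp
  hence "j * (j - 1) \<le> int b * (j * (j - 1))"
    using assms mult_right_mono[of 1 "int b" "j * (j - 1)"] by simp
  moreover have "2 * j \<le> j * (j - 1) + 2"
  proof -
    have "0 \<le> (j - 1) * (j - 2)" using True by (cases "j = 1") auto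
    thus ?thesis by (simp add: algebra_simps)
  qed
  moreover have "0 \<le> 2 * int a * j" using True by simp
  ultimately show ?thesis using True by linarith
next
  case False
  define k where "k = - j"
  have k: "k \<ge> 0" using False by (simp add: k_def)
  have "int a * k \<le> (int b - 1) * k" using assms k by (intro mult_right_mono) auto
  moreover have "0 \<le> int b * (k * (k - 1))"
    using k by (cases "k = 0") auto
  ultimately show ?thesis using k False by (simp add: k_def algebra_simps)
qed

lemma theta_exp_double:
  assumes "a < b"
  shows "2 * int (theta_exp b a j) = int b * (j * (j - 1)) + 2 * int a * j"
proof -
  let ?v = "int b * (j * (j - 1)) + 2 * int a * j"
  have ev: "even ?v" by auto
  have "?v \<ge> 0"
  proof (cases "j = 0")
    case False
    hence "2 \<le> 2 * \<bar>j\<bar>" by auto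
    thus ?thesis using theta_exp_bound[OF assms, of j] by linarith
  qed simp
  thus ?thesis using ev by (simp add: theta_exp_def)
qed

lemma theta_exp_ge: "a < b \<Longrightarrow> \<bar>j\<bar> \<le> int (theta_exp b a j) + 1"
  using theta_exp_bound[of a b j] theta_exp_double[of a b j] by linarith

lemma prod_lessThan_add: "(\<Prod>i<n + m. f i) = (\<Prod>i<n. f i) * (\<Prod>i<m. f (n + i :: nat) :: 'a::comm_monoid_mult)"
  by (induction m) (simp_all add: mult.assoc)

lemma choose_2_double: "2 * int (m choose 2) = int m * (int m - 1)"
  by (induction m) (simp_all add: Suc_choose_2 binomial_eq_0 algebra_simps)

text \<open>Completing the square around k = n: the exponent of the k-th term splits into a part
  independent of k, cancelled later as a common monomial, and the theta exponent at k - n.\<close>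

lemma qbin_theta_term:
  fixes n k :: nat
  assumes "a < b" "k \<le> 2 * n"
  shows "b * (k choose 2) + a * k + b * (n * (2 * n - k)) =
    b * (n * n) + b * (n choose 2) + a * n + theta_exp b a (int k - int n)"
proof -
  have "2 * int (b * (k choose 2) + a * k + b * (n * (2 * n - k))) =
    int b * (2 * int (k choose 2)) + 2 * int a * int k + 2 * int b * (int n * (2 * int n - int k))"
    by (simp only: of_nat_add of_nat_mult of_nat_diff[OF assms(2)]) (simp add: algebra_simps)
  also have "\<dots> = 2 * int b * (int n * int n) + int b * (2 * int (n choose 2)) + 2 * int a * int n +
      2 * int (theta_exp b a (int k - int n))"
    unfolding choose_2_double theta_exp_double[OF assms(1)] by (simp add: algebra_simps)
  also have "\<dots> = 2 * int (b * (n * n) + b * (n choose 2) + a * n + theta_exp b a (int k - int n))"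
    by (simp add: algebra_simps)
  finally show ?thesis by (simp only: mult_cancel_left of_nat_eq_iff) simp
qed

definition msign :: "int \<Rightarrow> 'a::comm_ring_1" where
  "msign j = (if even j then 1 else - 1)"

lemma qbinomial_rhs:
  fixes n :: nat and g :: "nat \<Rightarrow> 'a::comm_ring_1"
  assumes "a < b"
  defines "q \<equiv> fps_X ^ b"
  shows "(\<Sum>k\<le>2*n. fps_const (g k) * (q ^ (k choose 2) * qbin q (2*n) k * (- (fps_X ^ a)) ^ k * (q ^ n) ^ (2*n - k))) =
    fps_X ^ (b * (n * n) + b * (n choose 2) + a * n) * (- 1) ^ n *
    (\<Sum>k\<le>2*n. fps_const (g k * msign (int k - int n)) * fps_X ^ theta_exp b a (int k - int n) * qbin q (2*n) k)"
  unfolding sum_distrib_left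
proof (rule sum.cong)
  fix k assume "k \<in> {..2*n}"
  hence k: "k \<le> 2 * n" by simp
  let ?M = "b * (n * n) + b * (n choose 2) + a * n" and ?t = "theta_exp b a (int k - int n)"
  have "q ^ (k choose 2) * (fps_X ^ a) ^ k * (q ^ n) ^ (2*n - k) =
      (fps_X ^ (b * (k choose 2) + a * k + b * (n * (2 * n - k))) :: 'a fps)"
    unfolding q_def by (simp add: power_add power_mult)
  also have "\<dots> = fps_X ^ ?M * fps_X ^ ?t"
    unfolding qbin_theta_term[OF assms(1) k] by (rule power_add)
  finally have E: "q ^ (k choose 2) * (fps_X ^ a) ^ k * (q ^ n) ^ (2*n - k) = fps_X ^ ?M * fps_X ^ ?t" .
  have s: "(- 1) ^ n * fps_const (msign (int k - int n)) = ((- 1) ^ k :: 'a fps)"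
    by (auto simp: msign_def minus_one_power_iff fps_const_neg[symmetric] simp del: fps_const_neg)
  have "fps_const (g k) * (q ^ (k choose 2) * qbin q (2*n) k * (- (fps_X ^ a)) ^ k * (q ^ n) ^ (2*n - k)) =
     fps_const (g k) * (- 1) ^ k * qbin q (2*n) k * (q ^ (k choose 2) * (fps_X ^ a) ^ k * (q ^ n) ^ (2*n - k))"
    by (subst power_minus) (simp only: mult_ac)
  also have "\<dots> = fps_X ^ ?M * (- 1) ^ n * (fps_const (g k * msign (int k - int n)) * fps_X ^ ?t * qbin q (2*n) k)"
    unfolding E s[symmetric] fps_const_mult[symmetric] by (simp only: mult_ac)
  finally show "fps_const (g k) * (q ^ (k choose 2) * qbin q (2*n) k * (- (fps_X ^ a)) ^ k * (q ^ n) ^ (2*n - k)) =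
    fps_X ^ ?M * (- 1) ^ n * (fps_const (g k * msign (int k - int n)) * fps_X ^ ?t * qbin q (2*n) k)" .
qed simp

lemma euler_mod_eq_prod:
  assumes "a < b" "0 < a"
  shows "agree n (euler {m. m mod b = a}) (\<Prod>i<Suc n. 1 - fps_X ^ (b * i + a))"
proof -
  have inj: "inj_on (\<lambda>i. b * i + a) {..<Suc n}" using assms by (auto simp: inj_on_def)
  have "agree n (euler {m. m mod b = a}) (\<Prod>m\<in>(\<lambda>i. b * i + a) ` {..<Suc n}. 1 - fps_X ^ m)"
  proof (rule agree_euler)
    show "{m. m mod b = a} \<inter> {1..n} \<subseteq> (\<lambda>i. b * i + a) ` {..<Suc n}"
    proof
      fix m assume m: "m \<in> {m. m mod b = a} \<inter> {1..n}"
      hence "m = b * (m div b) + a" by (metis (mono_tags) IntD1 mem_Collect_eq mult_div_mod_eq)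
      moreover have "m div b < Suc n" using m le_less_trans[OF div_le_dividend[of m b], of "Suc n"] by simp
      ultimately show "m \<in> (\<lambda>i. b * i + a) ` {..<Suc n}" by blast
    qed
    show "(\<lambda>i. b * i + a) ` {..<Suc n} \<subseteq> {m. m mod b = a}" using assms by auto
  qed (use assms in auto)
  thus ?thesis by (simp add: prod.reindex[OF inj] del: prod.lessThan_Suc)
qed

text \<open>The q-binomial theorem for the product of q^n - z*q^i over i < 2*n, where q = X^b and z
  = X^a. The lower half yields the factors with residue b - a after removal of -z*q^i, the upper
  half those with residue a after removal of q^n; both sides then share a monomial that an integral
  domain can cancel.\<close>

lemma finite_triple_product:
  fixes n :: nat
  assumes "0 < a" "a < b"
  shows "(\<Prod>i<n. 1 - fps_X ^ (b * i + (b - a))) * (\<Prod>i<n. 1 - fps_X ^ (b * i + a)) =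
    (\<Sum>k\<le>2*n. fps_const (msign (int k - int n)) * fps_X ^ theta_exp b a (int k - int n) *
       qbin (fps_X ^ b) (2*n) k :: 'a::idom fps)" (is "?L = ?R")
proof -
  define q :: "'a fps" where "q = fps_X ^ b"
  define z :: "'a fps" where "z = fps_X ^ a"
  let ?M = "b * (n * n) + b * (n choose 2) + a * n"
  have zq: "(\<Prod>i<n. - z * q ^ i) = (- 1) ^ n * fps_X ^ (b * (n choose 2) + a * n)"
  proof (induction n)
    case (Suc n)
    have "(\<Prod>i<Suc n. - z * q ^ i) = (- 1) ^ n * fps_X ^ (b * (n choose 2) + a * n) * (- z * q ^ n)"
      using Suc by simp
    also have "\<dots> = (- 1) ^ Suc n * (fps_X ^ (b * (n choose 2) + a * n) * (z * q ^ n))"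
      by simp
    also have "fps_X ^ (b * (n choose 2) + a * n) * (z * q ^ n) = fps_X ^ (b * (Suc n choose 2) + a * Suc n)"
    proof -
      have "fps_X ^ (b * (n choose 2) + a * n) * (z * q ^ n) = fps_X ^ (b * (n choose 2) + a * n + (a + b * n))"
        by (simp only: z_def q_def power_add power_mult)
      also have "b * (n choose 2) + a * n + (a + b * n) = b * (Suc n choose 2) + a * Suc n"
        by (simp add: Suc_choose_2 algebra_simps)
      finally show ?thesis .
    qed
    finally show ?case .
  qed (simp add: binomial_eq_0)
  have f: "q ^ n + - z * q ^ (n - Suc i) = - z * q ^ (n - Suc i) * (1 - fps_X ^ (b * i + (b - a)))"
    if i: "i < n" for i
  proof -
    obtain m where m: "n = Suc i + m" using less_imp_Suc_add[OF i] by auto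
    have "q ^ (n - Suc i) * (z * fps_X ^ (b * i + (b - a))) = fps_X ^ (b * (n - Suc i) + (a + (b * i + (b - a))))"
      by (simp only: q_def z_def power_add power_mult)
    also have "b * (n - Suc i) + (a + (b * i + (b - a))) = b * n"
      unfolding m using assms by (simp add: algebra_simps)
    finally have "q ^ (n - Suc i) * (z * fps_X ^ (b * i + (b - a))) = q ^ n"
      by (simp only: q_def power_mult)
    thus ?thesis by (simp add: algebra_simps)
  qed
  have "(\<Prod>i<2*n. q ^ n + - z * q ^ i) = (\<Prod>i<n. q ^ n + - z * q ^ i) * (\<Prod>i<n. q ^ n + - z * q ^ (n + i))"
    using prod_lessThan_add[of "\<lambda>i. q ^ n + - z * q ^ i" n n] by (simp add: mult_2)
  also have "(\<Prod>i<n. q ^ n + - z * q ^ i) = (\<Prod>i<n. q ^ n + - z * q ^ (n - Suc i))"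
    by (rule prod.nat_diff_reindex[symmetric])
  also have "\<dots> = (\<Prod>i<n. - z * q ^ (n - Suc i) * (1 - fps_X ^ (b * i + (b - a))))"
    by (rule prod.cong[OF refl], rule f) simp
  also have "\<dots> = (\<Prod>i<n. - z * q ^ (n - Suc i)) * (\<Prod>i<n. 1 - fps_X ^ (b * i + (b - a)))"
    by (rule prod.distrib)
  also have "(\<Prod>i<n. - z * q ^ (n - Suc i)) = (\<Prod>i<n. - z * q ^ i)"
    by (rule prod.nat_diff_reindex)
  also have "(\<Prod>i<n. q ^ n + - z * q ^ (n + i)) = (\<Prod>i<n. q ^ n * (1 - fps_X ^ (b * i + a)))"
  proof (rule prod.cong[OF refl])
    fix i
    have "z * q ^ (n + i) = q ^ n * fps_X ^ (b * i + a)"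
      by (simp only: q_def z_def power_add power_mult mult_ac)
    thus "q ^ n + - z * q ^ (n + i) = q ^ n * (1 - fps_X ^ (b * i + a))"
      by (simp add: right_diff_distrib)
  qed
  also have "\<dots> = (q ^ n) ^ n * (\<Prod>i<n. 1 - fps_X ^ (b * i + a))"
    by (simp add: prod.distrib)
  also have "(\<Prod>i<n. - z * q ^ i) * (\<Prod>i<n. 1 - fps_X ^ (b * i + (b - a))) * ((q ^ n) ^ n * (\<Prod>i<n. 1 - fps_X ^ (b * i + a))) =
      fps_X ^ ?M * (- 1) ^ n * ?L"
    unfolding zq by (simp only: q_def power_add power_mult mult_ac)
  finally have "(\<Prod>i<2*n. q ^ n + - z * q ^ i) = fps_X ^ ?M * (- 1) ^ n * ?L" .
  moreover have "(\<Prod>i<2*n. q ^ n + - z * q ^ i) = fps_X ^ ?M * (- 1) ^ n * ?R"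
    using qbinomial_theorem[of "q ^ n" "- z" q "2 * n"] qbinomial_rhs[OF assms(2), where g = "\<lambda>_. 1 :: 'a" and n = n]
    by (simp add: q_def z_def)
  ultimately have "fps_X ^ ?M * (- 1) ^ n * ?L = fps_X ^ ?M * (- 1) ^ n * ?R"
    by simp
  thus ?thesis by simp
qed

theorem jacobi_triple_product:
  assumes "0 < a" "a < b"
  shows "fps_nth (euler {m. b dvd m} * (euler {m. m mod b = a} * euler {m. m mod b = b - a}) :: 'a::idom fps) N =
    (\<Sum>j | theta_exp b a j = N. msign j)"
proof -
  let ?n = "Suc N"
  let ?P = "(\<Prod>i<?n. 1 - fps_X ^ (b * i + (b - a))) * (\<Prod>i<?n. 1 - fps_X ^ (b * i + a)) :: 'a fps"
  have "agree N (euler {m. b dvd m} * (euler {m. m mod b = a} * euler {m. m mod b = b - a}))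
      (euler {m. b dvd m} * ((\<Prod>i<?n. 1 - fps_X ^ (b * i + a)) * (\<Prod>i<?n. 1 - fps_X ^ (b * i + (b - a))) :: 'a fps))"
    by (intro agree_mult agree_refl euler_mod_eq_prod) (use assms in auto)
  hence "fps_nth (euler {m. b dvd m} * (euler {m. m mod b = a} * euler {m. m mod b = b - a}) :: 'a fps) N =
      fps_nth (euler {m. b dvd m} * ?P) N"
    using agree_nth[of N _ _ N] by (simp add: mult_ac del: prod.lessThan_Suc)
  also have "\<dots> = (\<Sum>j | theta_exp b a j = N. msign j)"
    unfolding finite_triple_product[OF assms]
    by (rule theta_limit) (use assms theta_exp_ge in auto)
  finally show ?thesis .
qed

lemma pderiv_sum': "pderiv (\<Sum>k\<in>A. f k) = (\<Sum>k\<in>A. pderiv (f k))"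
  by (induction A rule: infinite_finite_induct) (simp_all add: pderiv_add)

text \<open>The finite triple product, read as a polynomial in z, is differentiated at its root z =
  1. The factor with i = n is the one that vanishes, the others form two q-factorials, and the sum
  acquires the weight k, or k - n because the unweighted sum is zero. Pairing j with 1 - j turns the
  right-hand side into the familiar sum with odd coefficients.\<close>

theorem jacobi_cube:
  "fps_nth (euler UNIV ^ 3 :: 'a::idom fps) N = - (\<Sum>j | theta_exp 1 0 j = N. of_int j * msign j)"
proof -
  define n where "n = Suc (Suc N)"
  define q :: "'a fps" where "q = fps_X"
  let ?q = "[:q:]" and ?a = "[:0, -1:] :: 'a fps poly"
  let ?p = "\<Prod>i<2*n. ?q ^ n + ?a * ?q ^ i"
  let ?c = "\<lambda>k. q ^ (k choose 2) * qbin q (2*n) k * (-1) ^ k * (q ^ n) ^ (2*n - k)"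
  let ?M = "n * n + (n choose 2)"
  have qb: "qbin ?q m k = [:qbin q m k:]" for m k
    by (induction q m k rule: qbin.induct) (simp_all add: poly_const_pow one_pCons)
  have pow: "?a ^ k = monom ((-1) ^ k) k" for k
    by (induction k) (simp_all add: monom_Suc one_pCons monom_0 smult_monom)
  have "?p = (\<Sum>k\<le>2*n. ?q ^ (k choose 2) * qbin ?q (2*n) k * ?a ^ k * (?q ^ n) ^ (2*n - k))"
    by (rule qbinomial_theorem)
  also have "\<dots> = (\<Sum>k\<le>2*n. monom (?c k) k)"
    by (rule sum.cong) (simp_all add: qb pow poly_const_pow smult_monom mult_ac)
  finally have p: "?p = (\<Sum>k\<le>2*n. monom (?c k) k)" .
  let ?r = "?q ^ n + ?a * ?q ^ n"
  let ?S = "{..<2*n} - {n}"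
  let ?Q = "\<Prod>i\<in>?S. ?q ^ n + ?a * ?q ^ i"
  have "n \<in> {..<2*n}" by (simp add: n_def)
  hence pr: "?p = ?r * ?Q" by (subst prod.remove[of _ n]) auto
  have r1: "poly ?r 1 = 0" and r2: "poly (pderiv ?r) 1 = - (q ^ n)"
    by (simp_all add: poly_const_pow pderiv_add pderiv_mult pderiv_pCons)
  have v0: "(\<Sum>k\<le>2*n. ?c k) = 0"
  proof -
    have "poly ?p 1 = 0" unfolding pr by (simp only: poly_mult r1 mult_zero_left)
    thus ?thesis unfolding p by (simp add: poly_sum poly_monom)
  qed
  have v1: "(\<Sum>k\<le>2*n. of_nat k * ?c k) = - (q ^ n) * poly ?Q 1"
  proof -
    have "poly (pderiv ?p) 1 = - (q ^ n) * poly ?Q 1"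
      unfolding pr pderiv_mult poly_add poly_mult r1 r2 by simp
    moreover have "pderiv ?p = (\<Sum>k\<le>2*n. monom (of_nat k * ?c k) (k - 1))"
      unfolding p by (simp add: pderiv_sum' pderiv_monom)
    ultimately show ?thesis by (simp add: poly_sum poly_monom)
  qed
  have Q: "poly ?Q 1 = fps_X ^ (n * (n - 1) + (n choose 2)) * (- 1) ^ n * (qfact q n * qfact q (n - 1))"
  proof -
    have S: "?S = {..<n} \<union> {n<..<2*n}" by auto
    have "poly ?Q 1 = (\<Prod>i\<in>?S. q ^ n - q ^ i)"
      by (simp add: poly_prod poly_const_pow)
    also have "\<dots> = (\<Prod>i<n. q ^ n - q ^ i) * (\<Prod>i\<in>{n<..<2*n}. q ^ n - q ^ i)"
      unfolding S by (rule prod.union_disjoint) auto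
    also have "(\<Prod>i<n. q ^ n - q ^ i) = (\<Prod>i<n. q ^ n - q ^ (n - Suc i))"
      by (rule prod.nat_diff_reindex[symmetric])
    also have "\<dots> = (\<Prod>i<n. - (q ^ (n - Suc i)) * (1 - q ^ Suc i))"
    proof (rule prod.cong[OF refl])
      fix i assume "i \<in> {..<n}"
      hence "n - Suc i + Suc i = n" by simp
      hence "q ^ (n - Suc i) * q ^ Suc i = q ^ n" by (metis power_add)
      thus "q ^ n - q ^ (n - Suc i) = - (q ^ (n - Suc i)) * (1 - q ^ Suc i)" by (simp add: algebra_simps)
    qed
    also have "\<dots> = (\<Prod>i<n. - (q ^ i)) * qfact q n"
      unfolding prod.distrib qfact_def prod.nat_diff_reindex[of "\<lambda>i. - (q ^ i)"] ..
    also have "(\<Prod>i<n. - (q ^ i)) = (- 1) ^ n * q ^ (n choose 2)"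
    proof (induction n)
      case (Suc n)
      thus ?case by (simp add: Suc_choose_2 power_add)
    qed (simp add: binomial_eq_0)
    also have "(\<Prod>i\<in>{n<..<2*n}. q ^ n - q ^ i) = (\<Prod>i<n-1. q ^ n * (1 - q ^ Suc i))"
    proof (rule prod.reindex_bij_witness[of _ "\<lambda>i. n + Suc i" "\<lambda>i. i - Suc n"])
      fix i assume "i \<in> {n<..<2*n}"
      hence "n + Suc (i - Suc n) = i" by auto
      hence "q ^ n * q ^ Suc (i - Suc n) = q ^ i" by (metis power_add)
      thus "q ^ n * (1 - q ^ Suc (i - Suc n)) = q ^ n - q ^ i" by (simp only: right_diff_distrib mult_1_right)
    qed auto
    also have "\<dots> = q ^ (n * (n - 1)) * qfact q (n - 1)"
      unfolding prod.distrib qfact_def by (simp add: power_mult)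
    finally show ?thesis by (simp add: q_def power_add mult_ac)
  qed
  have "n + (n * (n - 1) + (n choose 2)) = ?M" by (simp add: n_def)
  hence xm: "q ^ n * fps_X ^ (n * (n - 1) + (n choose 2)) = fps_X ^ ?M"
    by (simp only: q_def power_add[symmetric])
  have "(\<Sum>k\<le>2*n. fps_const (of_int (int k - int n)) * ?c k) = (\<Sum>k\<le>2*n. of_nat k * ?c k) - of_nat n * (\<Sum>k\<le>2*n. ?c k)"
  proof -
    have "fps_const (of_int (int k - int n)) = (of_nat k - of_nat n :: 'a fps)" for k
      by (simp add: fps_of_nat[symmetric])
    thus ?thesis by (simp only: sum_distrib_left sum_subtractf[symmetric] left_diff_distrib)
  qed
  also have "\<dots> = - (fps_X ^ ?M * (- 1) ^ n * (qfact q n * qfact q (n - 1)))"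
    unfolding v0 v1 Q xm[symmetric] by (simp only: mult_zero_right mult_zero_left diff_0_right mult_minus_left mult_minus_right mult_ac)
  finally have "(\<Sum>k\<le>2*n. fps_const (of_int (int k - int n)) * ?c k) =
      - (fps_X ^ ?M * (- 1) ^ n * (qfact q n * qfact q (n - 1)))" .
  moreover have "(\<Sum>k\<le>2*n. fps_const (of_int (int k - int n)) * ?c k) = fps_X ^ ?M * (- 1) ^ n *
     (\<Sum>k\<le>2*n. fps_const (of_int (int k - int n) * msign (int k - int n)) * fps_X ^ theta_exp 1 0 (int k - int n) * qbin (fps_X ^ 1) (2*n) k)"
    using qbinomial_rhs[where a = 0 and b = 1 and g = "\<lambda>k. of_int (int k - int n) :: 'a" and n = n] by (simp add: q_def)
  ultimately have "fps_X ^ ?M * (- 1) ^ n *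
     (\<Sum>k\<le>2*n. fps_const (of_int (int k - int n) * msign (int k - int n)) * fps_X ^ theta_exp 1 0 (int k - int n) * qbin (fps_X ^ 1) (2*n) k)
     = fps_X ^ ?M * (- 1) ^ n * (- (qfact q n * qfact q (n - 1)))" by (simp only: mult_minus_right)
  hence fin: "(\<Sum>k\<le>2*n. fps_const (of_int (int k - int n) * msign (int k - int n)) * fps_X ^ theta_exp 1 0 (int k - int n) * qbin (fps_X ^ 1) (2*n) k)
     = - (qfact q n * qfact q (n - 1))" by (subst (asm) mult_left_cancel) simp_all
  have E: "{m::nat. 1 dvd m} = UNIV" by auto
  have A: "agree N (euler UNIV) (qfact q n)" "agree N (euler UNIV) (qfact q (n - 1))"
    using agree_mono[OF agree_euler_qfact[of 1 n, where 'a = 'a], of N]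
      agree_mono[OF agree_euler_qfact[of 1 "n - 1", where 'a = 'a], of N]
    by (simp_all add: E q_def n_def)
  have "agree N (euler UNIV * (euler UNIV * euler UNIV)) (euler UNIV * (qfact q n * qfact q (n - 1)))"
    by (intro agree_mult agree_refl A)
  hence "fps_nth (euler UNIV ^ 3 :: 'a fps) N = fps_nth (euler UNIV * (qfact q n * qfact q (n - 1))) N"
    using agree_nth[of N _ _ N] by (simp add: power3_eq_cube mult.assoc)
  also have "\<dots> = - fps_nth (euler {m. 1 dvd m} * (\<Sum>k\<le>2*n. fps_const (of_int (int k - int n) * msign (int k - int n)) * fps_X ^ theta_exp 1 0 (int k - int n) * qbin (fps_X ^ 1) (2*n) k)) N"
    unfolding fin E by simp
  also have "\<dots> = - (\<Sum>j | theta_exp 1 0 j = N. of_int j * msign j)"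
    by (subst theta_limit[where \<omega> = "\<lambda>j. of_int j * msign j"]) (use theta_exp_ge[of 0 1] in \<open>auto simp: n_def\<close>)
  finally show ?thesis .
qed

subsection \<open>The Klein quartic\<close>

text \<open>To be applied to the components of J_1 in the classes 0, 1, 5 divided by the one in
  class 2. The shift U -> V -> W -> U preserves the relations, and every formula below comes in such
  triples.\<close>

locale klein =
  fixes U V W :: "'a::field_char_0"
  assumes UVW: "U * V * W = 1"
    and kU: "U^2 + U * V^2 + W = 0" and kV: "V^2 + V * W^2 + U = 0" and kW: "W^2 + W * U^2 + V = 0"
begin

text \<open>By UVW = 1 these three are the inverses of U, V, W. In the application 1, bV, bU, W, bW,
  U, V have exponents in the classes 0, 1, 2, 3, 4, 5, 6 modulo 7, and zU, zV, zW have class 0;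
  \<open>comb\<close> is therefore the decomposition by classes.\<close>

definition "bU = V * W"
definition "bV = U * W"
definition "bW = U * V"
definition "zU = U^3 * V"
definition "zV = V^3 * W"
definition "zW = W^3 * U"

lemma basis_mult:
  shows
    "bU*U = 1"
    "bV*V = 1"
    "bW*W = 1"
    "U*U = zU*W"
    "V*V = zV*U"
    "W*W = zW*V"
    "bU*bV = W"
    "bU*bW = V"
    "bV*bW = U"
    "bU*bU = (-1-zV)*bW"
    "bV*bV = (-1-zW)*bU"
    "bW*bW = (-1-zU)*bV"
    "bU*V = zV*bV"
    "bV*W = zW*bW"
    "bW*U = zU*bU"
    "bV*U = (-1-zW)*V"
    "bW*V = (-1-zU)*W"
    "bU*W = (-1-zV)*U"
  unfolding bU_def bV_def bW_def zU_def zV_def zW_def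
  using UVW kU kV kW by algebra+

lemma basis_fold: "U*V = bW" "V*W = bU" "U*W = bV"
  by (simp_all add: bU_def bV_def bW_def)

text \<open>Equivalently zV = - 1 - 1/zU and cyclically: the shift acts on these functions as a
  Moebius map of order three.\<close>

lemma z_mult: "zU * zV = - 1 - zU" "zV * zW = - 1 - zV" "zW * zU = - 1 - zW"
  unfolding zU_def zV_def zW_def using UVW kU kV kW by algebra+

definition comb :: "'a \<Rightarrow> 'a \<Rightarrow> 'a \<Rightarrow> 'a \<Rightarrow> 'a \<Rightarrow> 'a \<Rightarrow> 'a \<Rightarrow> 'a" where
  "comb A0 AU AV AW BU BV BW = A0 + AU*bU + AV*bV + AW*bW + BU*U + BV*V + BW*W"

text \<open>The multiplication table of an algebra graded by the integers modulo 7. Expanding once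
  here lets powers of \<open>s\<close> be computed on seven coefficients in zU, zV, zW, reduced by
  \<open>z_mult\<close>, instead of on polynomials in U, V, W.\<close>

lemma comb_mult:
  "comb A0 AU AV AW BU BV BW * comb A0' AU' AV' AW' BU' BV' BW' = comb
    (A0*A0' + (AU*BU' + BU*AU') + (AV*BV' + BV*AV') + (AW*BW' + BW*AW'))
    ((A0*AU' + AU*A0') + (-1-zW)*AV*AV' + zU*(AW*BU' + BU*AW') + (BV*BW' + BW*BV'))
    ((A0*AV' + AV*A0') + zV*(AU*BV' + BV*AU') + (-1-zU)*AW*AW' + (BU*BW' + BW*BU'))
    ((A0*AW' + AW*A0') + (-1-zV)*AU*AU' + zW*(AV*BW' + BW*AV') + (BU*BV' + BV*BU'))
    ((A0*BU' + BU*A0') + (-1-zV)*(AU*BW' + BW*AU') + (AV*AW' + AW*AV') + zV*BV*BV')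
    ((A0*BV' + BV*A0') + (AU*AW' + AW*AU') + (-1-zW)*(AV*BU' + BU*AV') + zW*BW*BW')
    ((A0*BW' + BW*A0') + (AU*AV' + AV*AU') + (-1-zU)*(AW*BV' + BV*AW') + zU*BU*BU')"
proof -
  have "comb A0 AU AV AW BU BV BW * comb A0' AU' AV' AW' BU' BV' BW' =
     A0*A0' +
     (A0*AU' + AU*A0')*bU +
     (A0*AV' + AV*A0')*bV +
     (A0*AW' + AW*A0')*bW +
     (A0*BU' + BU*A0')*U +
     (A0*BV' + BV*A0')*V +
     (A0*BW' + BW*A0')*W +
     AU*AU'*(bU*bU) +
     (AU*AV' + AV*AU')*(bU*bV) +
     (AU*AW' + AW*AU')*(bU*bW) +
     (AU*BU' + BU*AU')*(bU*U) +
     (AU*BV' + BV*AU')*(bU*V) +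
     (AU*BW' + BW*AU')*(bU*W) +
     AV*AV'*(bV*bV) +
     (AV*AW' + AW*AV')*(bV*bW) +
     (AV*BU' + BU*AV')*(bV*U) +
     (AV*BV' + BV*AV')*(bV*V) +
     (AV*BW' + BW*AV')*(bV*W) +
     AW*AW'*(bW*bW) +
     (AW*BU' + BU*AW')*(bW*U) +
     (AW*BV' + BV*AW')*(bW*V) +
     (AW*BW' + BW*AW')*(bW*W) +
     BU*BU'*(U*U) +
     (BU*BV' + BV*BU')*(U*V) +
     (BU*BW' + BW*BU')*(U*W) +
     BV*BV'*(V*V) +
     (BV*BW' + BW*BV')*(V*W) +
     BW*BW'*(W*W)"
    unfolding comb_def by algebra
  also have "\<dots> = comb
    (A0*A0' + (AU*BU' + BU*AU') + (AV*BV' + BV*AV') + (AW*BW' + BW*AW'))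
    ((A0*AU' + AU*A0') + (-1-zW)*AV*AV' + zU*(AW*BU' + BU*AW') + (BV*BW' + BW*BV'))
    ((A0*AV' + AV*A0') + zV*(AU*BV' + BV*AU') + (-1-zU)*AW*AW' + (BU*BW' + BW*BU'))
    ((A0*AW' + AW*A0') + (-1-zV)*AU*AU' + zW*(AV*BW' + BW*AV') + (BU*BV' + BV*BU'))
    ((A0*BU' + BU*A0') + (-1-zV)*(AU*BW' + BW*AU') + (AV*AW' + AW*AV') + zV*BV*BV')
    ((A0*BV' + BV*A0') + (AU*AW' + AW*AU') + (-1-zW)*(AV*BU' + BU*AV') + zW*BW*BW')
    ((A0*BW' + BW*A0') + (AU*AV' + AV*AU') + (-1-zU)*(AW*BV' + BV*AW') + zU*BU*BU')"
    unfolding basis_mult basis_fold comb_def by algebra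
  finally show ?thesis .
qed

lemma comb_eqI:
  assumes "A0 = A0'" "AU = AU'" "AV = AV'" "AW = AW'" "BU = BU'" "BV = BV'" "BW = BW'"
  shows "comb A0 AU AV AW BU BV BW = comb A0' AU' AV' AW' BU' BV' BW'"
  using assms by simp

text \<open>\<open>s\<close> becomes J_1 divided by its class-2 component. The constant -8 in
  \<open>tau\<close> is what makes \<open>tau\<close> a pure eta quotient, namely 1/t at X^7
  (\<open>tau_eq\<close> and \<open>tau_t\<close>).\<close>

definition "s = 1 + U + V + W"
definition "tau = - 8 - zU - zV - zW"

lemma s_comb: "s = comb 1 0 0 0 1 1 1"
  by (simp add: s_def comb_def)

lemma s2_comb: "s ^ 2 = comb (1) (2) (2) (2) (2 + zV) (2 + zW) (2 + zU)"
proof -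
  have "s ^ 2 = s * s" by (simp add: eval_nat_numeral)
  also have "\<dots> = comb (1) (2) (2) (2) (2 + zV) (2 + zW) (2 + zU)"
    unfolding s_comb comb_mult by (rule comb_eqI; use z_mult in \<open>(simp; fail) | algebra\<close>)
  finally show ?thesis .
qed

lemma s3_comb: "s ^ 3 = comb (7) (6 + 3*zU + zW) (6 + zU + 3*zV) (6 + zV + 3*zW) (0) (0) (0)"
proof -
  have "s ^ 3 = s * s ^ 2" by (simp add: eval_nat_numeral)
  also have "\<dots> = comb (7) (6 + 3*zU + zW) (6 + zU + 3*zV) (6 + zV + 3*zW) (0) (0) (0)"
    unfolding s2_comb unfolding s_comb comb_mult by (rule comb_eqI; use z_mult in \<open>(simp; fail) | algebra\<close>)
  finally show ?thesis .
qed

lemma s4_comb: "s ^ 4 = comb (25 + 4*zU + 4*zV + 4*zW) (2 + 8*zU - 2*zW) (2 - 2*zU + 8*zV) (2 - 2*zV + 8*zW) (5 - 5*zV - zW) (5 - zU - 5*zW) (5 - 5*zU - zV)"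
proof -
  have "s ^ 4 = s * s ^ 3" by (simp add: eval_nat_numeral)
  also have "\<dots> = comb (25 + 4*zU + 4*zV + 4*zW) (2 + 8*zU - 2*zW) (2 - 2*zU + 8*zV) (2 - 2*zV + 8*zW) (5 - 5*zV - zW) (5 - zU - 5*zW) (5 - 5*zU - zV)"
    unfolding s3_comb unfolding s_comb comb_mult by (rule comb_eqI; use z_mult in \<open>(simp; fail) | algebra\<close>)
  finally show ?thesis .
qed

lemma s5_comb: "s ^ 5 = comb (31 + 10*zU + 10*zV + 10*zW) (6 + 6*zU - zV - 15*zW) (6 - 15*zU + 6*zV - zW) (6 - zU - 15*zV + 6*zW) (40 + 5*zU + 5*zV + 5*zW) (40 + 5*zU + 5*zV + 5*zW) (40 + 5*zU + 5*zV + 5*zW)"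
proof -
  have "s ^ 5 = s * s ^ 4" by (simp add: eval_nat_numeral)
  also have "\<dots> = comb (31 + 10*zU + 10*zV + 10*zW) (6 + 6*zU - zV - 15*zW) (6 - 15*zU + 6*zV - zW) (6 - zU - 15*zV + 6*zW) (40 + 5*zU + 5*zV + 5*zW) (40 + 5*zU + 5*zV + 5*zW) (40 + 5*zU + 5*zV + 5*zW)"
    unfolding s4_comb unfolding s_comb comb_mult by (rule comb_eqI; use z_mult in \<open>(simp; fail) | algebra\<close>)
  finally show ?thesis .
qed

lemma s6_comb: "s ^ 6 = comb (49) (95 + 37*zU + 9*zV - 11*zW - zU^2) (95 - 11*zU + 37*zV + 9*zW - zV^2) (95 + 9*zU - 11*zV + 37*zW - zW^2) (46 + 10*zU + 30*zV + 30*zW + 6*zV^2) (46 + 30*zU + 10*zV + 30*zW + 6*zW^2) (46 + 30*zU + 30*zV + 10*zW + 6*zU^2)"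
proof -
  have "s ^ 6 = s * s ^ 5" by (simp add: eval_nat_numeral)
  also have "\<dots> = comb (49) (95 + 37*zU + 9*zV - 11*zW - zU^2) (95 - 11*zU + 37*zV + 9*zW - zV^2) (95 + 9*zU - 11*zV + 37*zW - zW^2) (46 + 10*zU + 30*zV + 30*zW + 6*zV^2) (46 + 30*zU + 10*zV + 30*zW + 6*zW^2) (46 + 30*zU + 30*zV + 10*zW + 6*zU^2)"
    unfolding s5_comb unfolding s_comb comb_mult by (rule comb_eqI; use z_mult in \<open>(simp; fail) | algebra\<close>)
  finally show ?thesis .
qed

lemma s7_comb: "s ^ 7 = comb
    (7*(49) - 21*(31 + 10*zU + 10*zV + 10*zW) + 49*(25 + 4*zU + 4*zV + 4*zW) - (7*tau + 147)*(7) + (35*tau + 343)*(1) - (49*tau + 343)*(1) - tau^2*(1))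
    (7*(95 + 37*zU + 9*zV - 11*zW - zU^2) - 21*(6 + 6*zU - zV - 15*zW) + 49*(2 + 8*zU - 2*zW) - (7*tau + 147)*(6 + 3*zU + zW) + (35*tau + 343)*(2) - (49*tau + 343)*(0) - tau^2*(0))
    (7*(95 - 11*zU + 37*zV + 9*zW - zV^2) - 21*(6 - 15*zU + 6*zV - zW) + 49*(2 - 2*zU + 8*zV) - (7*tau + 147)*(6 + zU + 3*zV) + (35*tau + 343)*(2) - (49*tau + 343)*(0) - tau^2*(0))
    (7*(95 + 9*zU - 11*zV + 37*zW - zW^2) - 21*(6 - zU - 15*zV + 6*zW) + 49*(2 - 2*zV + 8*zW) - (7*tau + 147)*(6 + zV + 3*zW) + (35*tau + 343)*(2) - (49*tau + 343)*(0) - tau^2*(0))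
    (7*(46 + 10*zU + 30*zV + 30*zW + 6*zV^2) - 21*(40 + 5*zU + 5*zV + 5*zW) + 49*(5 - 5*zV - zW) - (7*tau + 147)*(0) + (35*tau + 343)*(2 + zV) - (49*tau + 343)*(1) - tau^2*(0))
    (7*(46 + 30*zU + 10*zV + 30*zW + 6*zW^2) - 21*(40 + 5*zU + 5*zV + 5*zW) + 49*(5 - zU - 5*zW) - (7*tau + 147)*(0) + (35*tau + 343)*(2 + zW) - (49*tau + 343)*(1) - tau^2*(0))
    (7*(46 + 30*zU + 30*zV + 10*zW + 6*zU^2) - 21*(40 + 5*zU + 5*zV + 5*zW) + 49*(5 - 5*zU - zV) - (7*tau + 147)*(0) + (35*tau + 343)*(2 + zU) - (49*tau + 343)*(1) - tau^2*(0))"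
proof -
  have "s ^ 7 = s * s ^ 6" by (simp add: eval_nat_numeral)
  also have "\<dots> = comb
    (7*(49) - 21*(31 + 10*zU + 10*zV + 10*zW) + 49*(25 + 4*zU + 4*zV + 4*zW) - (7*tau + 147)*(7) + (35*tau + 343)*(1) - (49*tau + 343)*(1) - tau^2*(1))
    (7*(95 + 37*zU + 9*zV - 11*zW - zU^2) - 21*(6 + 6*zU - zV - 15*zW) + 49*(2 + 8*zU - 2*zW) - (7*tau + 147)*(6 + 3*zU + zW) + (35*tau + 343)*(2) - (49*tau + 343)*(0) - tau^2*(0))
    (7*(95 - 11*zU + 37*zV + 9*zW - zV^2) - 21*(6 - 15*zU + 6*zV - zW) + 49*(2 - 2*zU + 8*zV) - (7*tau + 147)*(6 + zU + 3*zV) + (35*tau + 343)*(2) - (49*tau + 343)*(0) - tau^2*(0))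
    (7*(95 + 9*zU - 11*zV + 37*zW - zW^2) - 21*(6 - zU - 15*zV + 6*zW) + 49*(2 - 2*zV + 8*zW) - (7*tau + 147)*(6 + zV + 3*zW) + (35*tau + 343)*(2) - (49*tau + 343)*(0) - tau^2*(0))
    (7*(46 + 10*zU + 30*zV + 30*zW + 6*zV^2) - 21*(40 + 5*zU + 5*zV + 5*zW) + 49*(5 - 5*zV - zW) - (7*tau + 147)*(0) + (35*tau + 343)*(2 + zV) - (49*tau + 343)*(1) - tau^2*(0))
    (7*(46 + 30*zU + 10*zV + 30*zW + 6*zW^2) - 21*(40 + 5*zU + 5*zV + 5*zW) + 49*(5 - zU - 5*zW) - (7*tau + 147)*(0) + (35*tau + 343)*(2 + zW) - (49*tau + 343)*(1) - tau^2*(0))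
    (7*(46 + 30*zU + 30*zV + 10*zW + 6*zU^2) - 21*(40 + 5*zU + 5*zV + 5*zW) + 49*(5 - 5*zU - zV) - (7*tau + 147)*(0) + (35*tau + 343)*(2 + zU) - (49*tau + 343)*(1) - tau^2*(0))"
    unfolding s6_comb unfolding s_comb comb_mult tau_def by (rule comb_eqI; use z_mult in \<open>(simp; fail) | algebra\<close>)
  finally show ?thesis .
qed

text \<open>The coefficients of s^7 were already written as this combination, so only linear algebra
  remains. All coefficients other than the first and the last are multiples of 7: modulo 7 the
  equation reads s^7 = - tau^2, and the 7-adic argument rests on that.\<close>

theorem s_equation:
  "s^7 - 7 * s^6 + 21 * s^5 - 49 * s^4 + (7*tau + 147) * s^3 - (35*tau + 343) * s^2 + (49*tau + 343) * s + tau^2 = 0"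
  unfolding s7_comb s6_comb s5_comb s4_comb s3_comb s2_comb unfolding s_comb comb_def by algebra

end

text \<open>The e are the components of J_1^2 / J_2 and the g those of J_2, normalised to class 0.
  \<open>hA\<close> and \<open>hB\<close> are coefficients of the identity r * sg = - s^2 in the
  basis of \<open>comb\<close>; \<open>ggg\<close> is UVW = 1 at X^2 divided by UVW = 1. The
  conditions \<open>nz\<close> exclude the spurious branches that elimination produces.\<close>

locale klein_curve = klein +
  fixes eU eV eW gU gV gW :: 'a
  assumes hA: "eU + zU*eW*gU = -2" "eV + zV*eU*gV = -2" "eW + zW*eV*gW = -2"
    and hB: "gU + (-1-zV)*eU*gW = - 2 - zV" "gV + (-1-zW)*eV*gU = - 2 - zW" "gW + (-1-zU)*eW*gV = - 2 - zU"
    and ggg: "gU*gV*gW = 1"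
    and nz: "eU \<noteq> 0" "eV \<noteq> 0" "eW \<noteq> 0" "2 + eU \<noteq> 0" "2 + eW \<noteq> 0" "eV \<noteq> eU" "eV \<noteq> eW"
      "4*(2+eU) + 4*eW*(1+eU) + eW^2*eU \<noteq> 0"
begin

lemma zzz: "zU*zV*zW = 1"
  using z_mult by algebra

lemma e_norm: "(2+eU)*(2+eV)*(2+eW) = - (eU*eV*eW)"
proof -
  have "2+eU = - (zU*eW*gU)" "2+eV = - (zV*eU*gV)" "2+eW = - (zW*eV*gW)"
    using hA by algebra+
  hence "(2+eU)*(2+eV)*(2+eW) = - (eU*eV*eW) * (zU*zV*zW) * (gU*gV*gW)" by algebra
  thus ?thesis by (simp add: zzz ggg)
qed

text \<open>Elimination of the g: two equations from \<open>hA\<close> inserted into one from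
  \<open>hB\<close> leave a relation between the e that is linear in a single z.\<close>

lemma z_linear:
  "zU*eW*(2+eV+2*eU) + eU*(2*eV+eU*eV+eW) = 0"
  "zV*eU*(2+eW+2*eV) + eV*(2*eW+eV*eW+eU) = 0"
  "zW*eV*(2+eU+2*eW) + eW*(2*eU+eW*eU+eV) = 0"
proof -
  have i: "zU*(-1-zV) = 1" "zV*(-1-zW) = 1" "zW*(-1-zU) = 1" using z_mult by algebra+
  have a: "zU*eW*gU = - (2+eU)" "zV*eU*gV = - (2+eV)" "zW*eV*gW = - (2+eW)" using hA by algebra+
  have "(zV*eU*gV)*(zU*eW) + (zV*(-1-zW))*(eV*eU)*(zU*eW*gU) = (gV + (-1-zW)*eV*gU)*(zV*eU*(zU*eW))" by algebra
  also have "\<dots> = - 2*(zU*zV)*eU*eW - (zU*zV*zW)*eU*eW" unfolding hB by algebra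
  finally show "zU*eW*(2+eV+2*eU) + eU*(2*eV+eU*eV+eW) = 0"
    unfolding a i zzz unfolding z_mult by algebra
  have "(zW*eV*gW)*(zV*eU) + (zW*(-1-zU))*(eW*eV)*(zV*eU*gV) = (gW + (-1-zU)*eW*gV)*(zW*eV*(zV*eU))" by algebra
  also have "\<dots> = - 2*(zV*zW)*eV*eU - (zU*zV*zW)*eV*eU" unfolding hB by algebra
  finally show "zV*eU*(2+eW+2*eV) + eV*(2*eW+eV*eW+eU) = 0"
    unfolding a i zzz unfolding z_mult by algebra
  have "(zU*eW*gU)*(zW*eV) + (zU*(-1-zV))*(eU*eW)*(zW*eV*gW) = (gU + (-1-zV)*eU*gW)*(zU*eW*(zW*eV))" by algebra
  also have "\<dots> = - 2*(zW*zU)*eW*eV - (zU*zV*zW)*eW*eV" unfolding hB by algebra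
  finally show "zW*eV*(2+eU+2*eW) + eW*(2*eU+eW*eU+eV) = 0"
    unfolding a i zzz unfolding z_mult by algebra
qed

text \<open>Two relations of \<open>z_linear\<close>, both rewritten as linear in zW, must have
  determinant zero. Solving \<open>e_norm\<close> for eV and substituting factors that determinant
  into the cubic \<open>?C\<close> and factors excluded by \<open>nz\<close>. By
  \<open>e_norm\<close> again, \<open>?C\<close> equals (2+x+y+x*y) * (2+x+y+w).\<close>

lemma e_sum: "eU + eV + eW = - 2"
proof -
  define x y w z where "x = eW" and "y = eU" and "w = eV" and "z = zW"
  note d = x_def[symmetric] y_def[symmetric] w_def[symmetric] z_def[symmetric]
  let ?C = "(x+y)*(2+x+y)+x*y*(1+x+y)"
  have 1: "z*(w*(2+y+2*x)) + x*(2*y+x*y+w) = 0" using z_linear(3)[unfolded d] by algebra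
  have "zW*(zU*eW*(2+eV+2*eU) + eU*(2*eV+eU*eV+eW)) = 0" using z_linear(1) by simp
  hence "(zW*zU)*(eW*(2+eV+2*eU)) + zW*(eU*(2*eV+eU*eV+eW)) = 0" by algebra
  hence "(-1-zW)*(eW*(2+eV+2*eU)) + zW*(eU*(2*eV+eU*eV+eW)) = 0" unfolding z_mult .
  hence 2: "z*(y*(2*w+y*w+x) - x*(2+w+2*y)) - x*(2+w+2*y) = 0"
    unfolding d by algebra
  have 3: "w*(2+x+y+x*y) = - ((2+x)*(2+y))" using e_norm[unfolded d] by algebra
  have det: "w*(2+y+2*x)*(- x*(2+w+2*y)) - (y*(2*w+y*w+x) - x*(2+w+2*y))*(x*(2*y+x*y+w)) = 0"
    using 1 2 by algebra
  \<comment> \<open>\<open>D\<close> is the denominator when \<open>e_norm\<close> is solved for w;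
    multiplication by \<open>D^2\<close> clears it, because the determinant is quadratic in w apart
    from its removable factors.\<close>
  define D where "D = 2+x+y+x*y"
  have 4: "w*D = - ((2+x)*(2+y))" using 3 by (simp add: D_def)
  have "D^2 * (w*(2+y+2*x)*(2+w+2*y) - ((2*x+x*y) + (x-2*y-y^2)*w)*((2*y+x*y)+w)) =
     (w*D)*(2+y+2*x)*((2+2*y)*D + w*D) - ((2*x+x*y)*D + (x-2*y-y^2)*(w*D))*((2*y+x*y)*D+w*D)"
    by algebra
  also have "\<dots> = - y*(2+y)*(4*(2+y) + 4*x*(1+y) + x^2*y)*?C"
    unfolding 4 unfolding D_def by algebra
  finally have "x*y*(2+y)*(4*(2+y) + 4*x*(1+y) + x^2*y)*?C =
     - x*(D^2 * (w*(2+y+2*x)*(2+w+2*y) - ((2*x+x*y) + (x-2*y-y^2)*w)*((2*y+x*y)+w)))" by algebra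
  also have "\<dots> = D^2 * (w*(2+y+2*x)*(- x*(2+w+2*y)) - (y*(2*w+y*w+x) - x*(2+w+2*y))*(x*(2*y+x*y+w)))"
    by algebra
  finally have "x*y*(2+y)*(4*(2+y) + 4*x*(1+y) + x^2*y)*?C = 0" unfolding det by simp
  hence C: "?C = 0" using nz by (simp add: d)
  have "(2+x+y+x*y)*(2+x+y+w) = 0" using 3 C by algebra
  moreover have "2+x+y+x*y \<noteq> 0"
  proof
    assume "2+x+y+x*y = 0"
    hence "(2+x)*(2+y) = 0" using 3 by simp
    thus False using nz by (simp add: d)
  qed
  ultimately have "2+x+y+w = 0" by simp
  thus ?thesis unfolding x_def y_def w_def by algebra
qed

lemma e_pairs: "eU*eV + eV*eW + eW*eU = - (eU*eV*eW)"
  using e_norm e_sum by algebra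

lemma z_eq: "zU*eW = - eV*(1+eU)" "zV*eU = - eW*(1+eV)" "zW*eV = - eU*(1+eW)"
proof -
  have "(eV - eU)*(zV*eU + eW*(1+eV)) = 0"
    using z_linear(2) e_sum e_pairs by algebra
  thus 1: "zV*eU = - eW*(1+eV)" using nz by (simp add: add_eq_0_iff)
  have "(eW - eV)*(zW*eV + eU*(1+eW)) = 0"
    using z_linear(3) e_sum e_pairs by algebra
  thus 2: "zW*eV = - eU*(1+eW)" using nz by (simp add: add_eq_0_iff)
  \<comment> \<open>Treating zU like the other two would require division by eU - eW, which is not
    known to be nonzero; the product zU*zV*zW = 1 determines it instead.\<close>
  have "(zV*eU)*(zW*eV)*(zU*eW + eV*(1+eU)) = 0"
  proof -
    have "(zV*eU)*(zW*eV)*(zU*eW) = eU*eV*eW" using zzz by algebra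
    moreover have "(1+eU)*(1+eV)*(1+eW) = - 1" using e_sum e_pairs by algebra
    ultimately show ?thesis unfolding distrib_left 1 2 by algebra
  qed
  moreover have "zV \<noteq> 0" "zW \<noteq> 0" using zzz by auto
  ultimately show "zU*eW = - eV*(1+eU)" using nz by (simp add: add_eq_0_iff)
qed

lemma g_eq: "gU = eW*eV - eU - 2 - zV" "gV = eU*eW - eV - 2 - zW" "gW = eV*eU - eW - 2 - zU"
proof -
  have i: "zU*(-1-zV) = 1" "zV*(-1-zW) = 1" "zW*(-1-zU) = 1" using z_mult by algebra+
  have "zU*eW*gU - zU*eW*(eW*eV - eU - 2 - zV) = 0"
  proof -
    have "zU*eW*(eW*eV - eU - 2 - zV) = (zU*eW)*(eW*eV - eU - 2) - (zU*zV)*eW" by algebra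
    also have "\<dots> = (zU*eW)*(eW*eV - eU - 1) + eW" unfolding z_mult by algebra
    finally show ?thesis using hA(1) e_sum e_pairs unfolding z_eq by algebra
  qed
  hence "eW*zU*gU = eW*zU*(eW*eV - eU - 2 - zV)" by algebra
  thus "gU = eW*eV - eU - 2 - zV" using nz zzz by auto
  have "zV*eU*gV - zV*eU*(eU*eW - eV - 2 - zW) = 0"
  proof -
    have "zV*eU*(eU*eW - eV - 2 - zW) = (zV*eU)*(eU*eW - eV - 2) - (zV*zW)*eU" by algebra
    also have "\<dots> = (zV*eU)*(eU*eW - eV - 1) + eU" unfolding z_mult by algebra
    finally show ?thesis using hA(2) e_sum e_pairs unfolding z_eq by algebra
  qed
  hence "eU*zV*gV = eU*zV*(eU*eW - eV - 2 - zW)" by algebra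
  thus "gV = eU*eW - eV - 2 - zW" using nz zzz by auto
  have "zW*eV*gW - zW*eV*(eV*eU - eW - 2 - zU) = 0"
  proof -
    have "zW*eV*(eV*eU - eW - 2 - zU) = (zW*eV)*(eV*eU - eW - 2) - (zW*zU)*eV" by algebra
    also have "\<dots> = (zW*eV)*(eV*eU - eW - 1) + eV" unfolding z_mult by algebra
    finally show ?thesis using hA(3) e_sum e_pairs unfolding z_eq by algebra
  qed
  hence "eV*zW*gW = eV*zW*(eV*eU - eW - 2 - zU)" by algebra
  thus "gW = eV*eU - eW - 2 - zU" using nz zzz by auto
qed

end

subsection \<open>A model of the modular curve of level 14\<close>

text \<open>A plane cubic: \<open>C\<close> is the relation e_2 = - e_3 between the elementary
  symmetric functions of x, y, w, with w eliminated by e_1 = -2. The inverse \<open>i\<close> of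
  \<open>eps\<close> turns every function into a polynomial, so identities become ideal membership.
  The shift x -> y -> w -> x fixes \<open>eps\<close> and \<open>tau\<close>.\<close>

locale curve14 =
  fixes x y w i zU zV zW eps tau :: "'a::field_char_0"
  assumes w: "w = - 2 - x - y" and C: "(x+y)*(2+x+y)+x*y*(1+x+y) = 0"
    and eps: "eps = x*y*w" and i: "eps*i = 1"
    and zU: "zU = - x*y^2*(1+x)*i" and zV: "zV = - y*w^2*(1+y)*i" and zW: "zW = - w*x^2*(1+w)*i"
    and tau: "tau = - 8 - zU - zV - zW"
begin

text \<open>The equation between the two shift-invariant functions. With eps = H/t and tau = 1/t,
  read at X^7, it becomes the cubic for \<open>H\<close> over \<open>t\<close>.\<close>

lemma cubic: "eps*tau^2 - (2*eps^2 - 9*eps)*tau + (eps - 1)^2*(eps - 8) = 0"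
  unfolding tau zU zV zW using C i unfolding eps w by algebra

lemma g_products:
  "(w*y - x - 2 - zV)*(y*x - w - 2 - zU) = zU - 1 - x - 2*y - x*y"
  "(x*w - y - 2 - zW)*(w*y - x - 2 - zV) = zV - 1 - y - 2*w - y*w"
  "(y*x - w - 2 - zU)*(x*w - y - 2 - zW) = zW - 1 - w - 2*x - w*x"
  unfolding zU zV zW using C i unfolding eps w by algebra+

lemma zg_products:
  "zW*(y*x - w - 2 - zU)^2 = 1 + 2*x + 2*y + 2*x*y + x^2 - zU + zW"
  "zU*(w*y - x - 2 - zV)^2 = 1 + 2*y + 2*w + 2*y*w + y^2 - zV + zU"
  "zV*(x*w - y - 2 - zW)^2 = 1 + 2*w + 2*x + 2*w*x + w^2 - zW + zV"
  unfolding zU zV zW using C i unfolding eps w by algebra+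

text \<open>\<open>tau2\<close> is \<open>tau\<close> after X -> X^2, with products of the g already
  replaced by their values. The relation rewrites the eta quotient eps*tau2^2/tau, in which level 2
  is visible, as 8*tau + 56 - 7*eps, which is linear in \<open>eps\<close> and
  \<open>tau\<close>.\<close>

lemma tau2_relation:
  assumes "tau2 = - 8 - (1 + 2*x + 2*y + 2*x*y + x^2 - zU + zW)*(zU - 1 - x - 2*y - x*y)
    - (1 + 2*y + 2*w + 2*y*w + y^2 - zV + zU)*(zV - 1 - y - 2*w - y*w)
    - (1 + 2*w + 2*x + 2*w*x + w^2 - zW + zV)*(zW - 1 - w - 2*x - w*x)"
  shows "eps*tau2^2 = 8*tau^2 + 56*tau - 7*eps*tau"
  unfolding assms tau zU zV zW using C i unfolding eps w by algebra

text \<open>The left-hand sides of this lemma and its companions are class-0 coefficients of r, r^2,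
  sg or sg^2 times a power of s. Since bU*U = bV*V = bW*W = 1, each coefficient at bU of one factor
  meets the coefficient at U of the other. The sums are invariant under the cyclic shift, which is
  why \<open>eps\<close> and \<open>tau\<close> alone should express them.\<close>

lemma window_r_2: "(1) + x*(2 + zV) + y*(2 + zW) + w*(2 + zU) = eps - 1"
  unfolding tau zU zV zW using C i unfolding eps w by algebra

lemma window_r_4: "(25 + 4*zU + 4*zV + 4*zW) + x*(5 - 5*zV - zW) + y*(5 - zU - 5*zW) + w*(5 - 5*zU - zV) = - eps*tau + eps^2 - 6*tau - 9*eps - 41"
  unfolding tau zU zV zW using C i unfolding eps w by algebra

lemma window_r_5: "(31 + 10*zU + 10*zV + 10*zW) + x*(40 + 5*zU + 5*zV + 5*zW) + y*(40 + 5*zU + 5*zV + 5*zW) + w*(40 + 5*zU + 5*zV + 5*zW) = - 49"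
  unfolding w by algebra

lemma window_r_6: "(49) + x*(46 + 10*zU + 30*zV + 30*zW + 6*zV^2) + y*(46 + 30*zU + 10*zV + 30*zW + 6*zW^2) + w*(46 + 30*zU + 30*zV + 10*zW + 6*zU^2) = 8*eps*tau - 14*eps^2 + 48*tau + 28*eps + 329"
  unfolding tau zU zV zW using C i unfolding eps w by algebra

lemma window_r2_1: "(1) + (2*x + (-1-zW)*y^2)*(1) + (2*y + (-1-zU)*w^2)*(1) + (2*w + (-1-zV)*x^2)*(1) = -7"
  unfolding tau zU zV zW using C i unfolding eps w by algebra

lemma window_r2_2: "(1) + (2*x + (-1-zW)*y^2)*(2 + zV) + (2*y + (-1-zU)*w^2)*(2 + zW) + (2*w + (-1-zV)*x^2)*(2 + zU) + (2*w*y)*(2) + (2*x*w)*(2) + (2*y*x)*(2) = -7"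
  unfolding tau zU zV zW using C i unfolding eps w by algebra

lemma window_r2_3: "(7) + (2*w*y)*(6 + 3*zU + zW) + (2*x*w)*(6 + zU + 3*zV) + (2*y*x)*(6 + zV + 3*zW) = - 4*eps*tau + 4*eps^2 - 36*eps - 17"
  unfolding tau zU zV zW using C i unfolding eps w by algebra

lemma window_r2_4: "(25 + 4*zU + 4*zV + 4*zW) + (2*x + (-1-zW)*y^2)*(5 - 5*zV - zW) + (2*y + (-1-zU)*w^2)*(5 - zU - 5*zW) + (2*w + (-1-zV)*x^2)*(5 - 5*zU - zV) + (2*w*y)*(2 + 8*zU - 2*zW) + (2*x*w)*(2 - 2*zU + 8*zV) + (2*y*x)*(2 - 2*zV + 8*zW) = - 20*eps*tau + 21*eps^2 - 8*tau - 140*eps - 175"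
  unfolding tau zU zV zW using C i unfolding eps w by algebra

lemma window_r2_5: "(31 + 10*zU + 10*zV + 10*zW) + (2*x + (-1-zW)*y^2)*(40 + 5*zU + 5*zV + 5*zW) + (2*y + (-1-zU)*w^2)*(40 + 5*zU + 5*zV + 5*zW) + (2*w + (-1-zV)*x^2)*(40 + 5*zU + 5*zV + 5*zW) + (2*w*y)*(6 + 6*zU - zV - 15*zW) + (2*x*w)*(6 - 15*zU + 6*zV - zW) + (2*y*x)*(6 - zU - 15*zV + 6*zW) = - 44*eps*tau + 42*eps^2 + 30*tau - 280*eps - 105"
  unfolding tau zU zV zW using C i unfolding eps w by algebra

lemma window_r2_6: "(49) + (2*x + (-1-zW)*y^2)*(46 + 10*zU + 30*zV + 30*zW + 6*zV^2) + (2*y + (-1-zU)*w^2)*(46 + 30*zU + 10*zV + 30*zW + 6*zW^2) + (2*w + (-1-zV)*x^2)*(46 + 30*zU + 30*zV + 10*zW + 6*zU^2) + (2*w*y)*(95 + 37*zU + 9*zV - 11*zW - zU^2) + (2*x*w)*(95 - 11*zU + 37*zV + 9*zW - zV^2) + (2*y*x)*(95 + 9*zU - 11*zV + 37*zW - zW^2) = - 2*eps*tau^2 + 2*eps^2*tau - 130*eps*tau + 98*eps^2 + 128*tau - 882*eps + 441"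
  unfolding tau zU zV zW using C i unfolding eps w by algebra

lemma window_s_2: "(1) + (w*y - x - 2 - zV)*(2) + (x*w - y - 2 - zW)*(2) + (y*x - w - 2 - zU)*(2) = 2*tau - 2*eps + 9"
  unfolding tau zU zV zW using C i unfolding eps w by algebra

lemma window_s_3: "(7) + (w*y - x - 2 - zV)*(6 + 3*zU + zW) + (x*w - y - 2 - zW)*(6 + zU + 3*zV) + (y*x - w - 2 - zU)*(6 + zV + 3*zW) = 8*tau - 7*eps + 49"
  unfolding tau zU zV zW using C i unfolding eps w by algebra

lemma window_s_4: "(25 + 4*zU + 4*zV + 4*zW) + (w*y - x - 2 - zV)*(2 + 8*zU - 2*zW) + (x*w - y - 2 - zW)*(2 - 2*zU + 8*zV) + (y*x - w - 2 - zU)*(2 - 2*zV + 8*zW) = 8*tau - 14*eps + 63"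
  unfolding tau zU zV zW using C i unfolding eps w by algebra

lemma window_s_5: "(31 + 10*zU + 10*zV + 10*zW) + (w*y - x - 2 - zV)*(6 + 6*zU - zV - 15*zW) + (x*w - y - 2 - zW)*(6 - 15*zU + 6*zV - zW) + (y*x - w - 2 - zU)*(6 - zU - 15*zV + 6*zW) = tau^2 - eps*tau + 29*tau - 49*eps + 98"
  unfolding tau zU zV zW using C i unfolding eps w by algebra

lemma window_s_6: "(49) + (w*y - x - 2 - zV)*(95 + 37*zU + 9*zV - 11*zW - zU^2) + (x*w - y - 2 - zW)*(95 - 11*zU + 37*zV + 9*zW - zV^2) + (y*x - w - 2 - zU)*(95 + 9*zU - 11*zV + 37*zW - zW^2) = - 8*tau^2 + 8*eps*tau + 48*tau - 98*eps + 441"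
  unfolding tau zU zV zW using C i unfolding eps w by algebra

lemma window_s2_1: "(1) + (2*(zW - 1 - w - 2*x - w*x))*(1) + (2*(zU - 1 - x - 2*y - x*y))*(1) + (2*(zV - 1 - y - 2*w - y*w))*(1) = - 2*tau + 2*eps - 9"
  unfolding tau zU zV zW using C i unfolding eps w by algebra

lemma window_s2_2: "(1) + (2*(zW - 1 - w - 2*x - w*x))*(2 + zV) + (2*(zU - 1 - x - 2*y - x*y))*(2 + zW) + (2*(zV - 1 - y - 2*w - y*w))*(2 + zU) + (- 2*w - w^2 - 3 - zW - zV)*(2) + (- 2*x - x^2 - 3 - zU - zW)*(2) + (- 2*y - y^2 - 3 - zV - zU)*(2) = -7"
  unfolding tau zU zV zW using C i unfolding eps w by algebra

lemma window_s2_3: "(7) + (- 2*w - w^2 - 3 - zW - zV)*(6 + 3*zU + zW) + (- 2*x - x^2 - 3 - zU - zW)*(6 + zU + 3*zV) + (- 2*y - y^2 - 3 - zV - zU)*(6 + zV + 3*zW) = - (tau^2) + 2*eps*tau - eps^2 + 3*tau + 2*eps + 48"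
  unfolding tau zU zV zW using C i unfolding eps w by algebra

lemma window_s2_4: "(25 + 4*zU + 4*zV + 4*zW) + (2*(zW - 1 - w - 2*x - w*x))*(5 - 5*zV - zW) + (2*(zU - 1 - x - 2*y - x*y))*(5 - zU - 5*zW) + (2*(zV - 1 - y - 2*w - y*w))*(5 - 5*zU - zV) + (- 2*w - w^2 - 3 - zW - zV)*(2 + 8*zU - 2*zW) + (- 2*x - x^2 - 3 - zU - zW)*(2 - 2*zU + 8*zV) + (- 2*y - y^2 - 3 - zV - zU)*(2 - 2*zV + 8*zW) = 49"
  unfolding tau zU zV zW using C i unfolding eps w by algebra

lemma window_s2_5: "(31 + 10*zU + 10*zV + 10*zW) + (2*(zW - 1 - w - 2*x - w*x))*(40 + 5*zU + 5*zV + 5*zW) + (2*(zU - 1 - x - 2*y - x*y))*(40 + 5*zU + 5*zV + 5*zW) + (2*(zV - 1 - y - 2*w - y*w))*(40 + 5*zU + 5*zV + 5*zW) + (- 2*w - w^2 - 3 - zW - zV)*(6 + 6*zU - zV - 15*zW) + (- 2*x - x^2 - 3 - zU - zW)*(6 - 15*zU + 6*zV - zW) + (- 2*y - y^2 - 3 - zV - zU)*(6 - zU - 15*zV + 6*zW) = 26*tau^2 - 40*eps*tau + 14*eps^2 + 250*tau - 224*eps + 553"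
  unfolding tau zU zV zW using C i unfolding eps w by algebra

lemma window_s2_6: "(49) + (2*(zW - 1 - w - 2*x - w*x))*(46 + 10*zU + 30*zV + 30*zW + 6*zV^2) + (2*(zU - 1 - x - 2*y - x*y))*(46 + 30*zU + 10*zV + 30*zW + 6*zW^2) + (2*(zV - 1 - y - 2*w - y*w))*(46 + 30*zU + 30*zV + 10*zW + 6*zU^2) + (- 2*w - w^2 - 3 - zW - zV)*(95 + 37*zU + 9*zV - 11*zW - zU^2) + (- 2*x - x^2 - 3 - zU - zW)*(95 - 11*zU + 37*zV + 9*zW - zV^2) + (- 2*y - y^2 - 3 - zV - zU)*(95 + 9*zU - 11*zV + 37*zW - zW^2) = 64*tau^2 - 112*eps*tau + 49*eps^2 + 896*tau - 784*eps + 2793"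
  unfolding tau zU zV zW using C i unfolding eps w by algebra

end

subsection \<open>Constant terms of products of the dissected series\<close>

text \<open>\<open>Z\<close> models the series with exponents divisible by 7 and \<open>P\<close>
  the extraction of the class-0 part. The axiom \<open>P_comb\<close> encodes that the other six
  basis elements lie in nonzero classes.\<close>

locale dissection = klein_curve +
  fixes Z :: "'a set" and P :: "'a \<Rightarrow> 'a"
  assumes Z_1 [simp]: "1 \<in> Z"
    and Z_diff [simp]: "a \<in> Z \<Longrightarrow> b \<in> Z \<Longrightarrow> a - b \<in> Z"
    and Z_mult [simp]: "a \<in> Z \<Longrightarrow> b \<in> Z \<Longrightarrow> a * b \<in> Z"
    and Z_gens [simp]: "eU \<in> Z" "eV \<in> Z" "eW \<in> Z" "gU \<in> Z" "gV \<in> Z" "gW \<in> Z" "zU \<in> Z" "zV \<in> Z" "zW \<in> Z"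
    and P_comb: "\<lbrakk>A0 \<in> Z; AU \<in> Z; AV \<in> Z; AW \<in> Z; BU \<in> Z; BV \<in> Z; BW \<in> Z\<rbrakk> \<Longrightarrow>
      P (comb A0 AU AV AW BU BV BW) = A0"
begin

lemma Z_0 [simp]: "0 \<in> Z" using Z_diff[OF Z_1 Z_1] by simp
lemma Z_uminus [simp]: "a \<in> Z \<Longrightarrow> - a \<in> Z" using Z_diff[OF Z_0] by simp
lemma Z_add [simp]: "a \<in> Z \<Longrightarrow> b \<in> Z \<Longrightarrow> a + b \<in> Z" using Z_diff[of a "- b"] by simp
lemma Z_power [simp]: "a \<in> Z \<Longrightarrow> a ^ n \<in> Z" by (induction n) auto
lemma Z_of_nat [simp]: "of_nat n \<in> Z" by (induction n) auto
lemma Z_numeral [simp]: "numeral n \<in> Z" using Z_of_nat[of "numeral n"] by simp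

lemma P_comb_mult:
  assumes "A0 \<in> Z" "AU \<in> Z" "AV \<in> Z" "AW \<in> Z" "BU \<in> Z" "BV \<in> Z" "BW \<in> Z"
    and "A0' \<in> Z" "AU' \<in> Z" "AV' \<in> Z" "AW' \<in> Z" "BU' \<in> Z" "BV' \<in> Z" "BW' \<in> Z"
  shows "P (comb A0 AU AV AW BU BV BW * comb A0' AU' AV' AW' BU' BV' BW') =
    A0*A0' + (AU*BU' + BU*AU') + (AV*BV' + BV*AV') + (AW*BW' + BW*AW')"
  unfolding comb_mult by (rule P_comb) (use assms in simp_all)

definition "eps = eU * eV * eW"

lemma eps_nonzero: "eps \<noteq> 0"
  using nz by (simp add: eps_def)

sublocale curve14 eU eV eW "inverse eps" zU zV zW eps tau
proof
  show i: "eps * inverse eps = 1" using eps_nonzero by simp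
  show "eW = - 2 - eU - eV" using e_sum by algebra
  show "(eU + eV)*(2 + eU + eV) + eU*eV*(1 + eU + eV) = 0"
    using e_sum e_pairs by algebra
  have "zU * eps = - eU*eV^2*(1+eU)" unfolding eps_def using z_eq(1) by algebra
  thus "zU = - eU*eV^2*(1+eU)*inverse eps" using eps_nonzero by (simp add: field_simps)
  have "zV * eps = - eV*eW^2*(1+eV)" unfolding eps_def using z_eq(2) by algebra
  thus "zV = - eV*eW^2*(1+eV)*inverse eps" using eps_nonzero by (simp add: field_simps)
  have "zW * eps = - eW*eU^2*(1+eW)" unfolding eps_def using z_eq(3) by algebra
  thus "zW = - eW*eU^2*(1+eW)*inverse eps" using eps_nonzero by (simp add: field_simps)
qed (simp_all add: eps_def tau_def)

definition "r = comb 1 eU eV eW 0 0 0"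
definition "sg = comb 1 0 0 0 gU gV gW"

lemma r2_comb: "r^2 = comb 1 (2*eU + (-1-zW)*eV^2) (2*eV + (-1-zU)*eW^2) (2*eW + (-1-zV)*eU^2)
    (2*eW*eV) (2*eU*eW) (2*eV*eU)"
  unfolding r_def power2_eq_square comb_mult by (rule comb_eqI) (simp_all add: algebra_simps)

text \<open>Squaring produces products of two g and terms of the form z*g^2;
  \<open>g_products\<close> and \<open>zg_products\<close> reduce both to expressions linear in the
  z.\<close>

lemma sg2_comb: "sg^2 = comb 1 (2*(zW - 1 - eW - 2*eU - eW*eU)) (2*(zU - 1 - eU - 2*eV - eU*eV)) (2*(zV - 1 - eV - 2*eW - eV*eW))
    (- 2*eW - eW^2 - 3 - zW - zV) (- 2*eU - eU^2 - 3 - zU - zW) (- 2*eV - eV^2 - 3 - zV - zU)"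
proof -
  have a: "gU*gW = zU - 1 - eU - 2*eV - eU*eV" "gV*gU = zV - 1 - eV - 2*eW - eV*eW" "gW*gV = zW - 1 - eW - 2*eU - eW*eU"
    unfolding g_eq by (rule g_products)+
  have b: "zW*gW^2 = 1 + 2*eU + 2*eV + 2*eU*eV + eU^2 - zU + zW"
    "zU*gU^2 = 1 + 2*eV + 2*eW + 2*eV*eW + eV^2 - zV + zU"
    "zV*gV^2 = 1 + 2*eW + 2*eU + 2*eW*eU + eW^2 - zW + zV"
    unfolding g_eq by (rule zg_products)+
  show ?thesis
    unfolding sg_def power2_eq_square[of "comb _ _ _ _ _ _ _"] comb_mult
  proof (rule comb_eqI)
    show "1*0 + 0*1 + (-1-zW)*0*0 + zU*(0*gU + gU*0) + (gV*gW + gW*gV) = 2*(zW - 1 - eW - 2*eU - eW*eU)"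
      using a by algebra
    show "1*0 + 0*1 + zV*(0*gV + gV*0) + (-1-zU)*0*0 + (gU*gW + gW*gU) = 2*(zU - 1 - eU - 2*eV - eU*eV)"
      using a by algebra
    show "1*0 + 0*1 + (-1-zV)*0*0 + zW*(0*gW + gW*0) + (gU*gV + gV*gU) = 2*(zV - 1 - eV - 2*eW - eV*eW)"
      using a by algebra
    show "1*gU + gU*1 + (-1-zV)*(0*gW + gW*0) + (0*0 + 0*0) + zV*gV*gV = - 2*eW - eW^2 - 3 - zW - zV"
      using b(3) g_eq(1) e_sum by algebra
    show "1*gV + gV*1 + (0*0 + 0*0) + (-1-zW)*(0*gU + gU*0) + zW*gW*gW = - 2*eU - eU^2 - 3 - zU - zW"
      using b(1) g_eq(2) e_sum by algebra
    show "1*gW + gW*1 + (0*0 + 0*0) + (-1-zU)*(0*gV + gV*0) + zU*gU*gU = - 2*eV - eV^2 - 3 - zV - zU"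
      using b(2) g_eq(3) e_sum by algebra
  qed simp
qed

lemma P_s: "P 1 = 1" "P s = 1" "P (s^2) = 1" "P (s^3) = 7" "P (s^4) = - 4*tau - 7" "P (s^5) = - 10*tau - 49" "P (s^6) = 49"
proof -
  have 1: "1 = comb 1 0 0 0 0 0 0" by (simp add: comb_def)
  show "P 1 = 1" by (subst 1, subst P_comb) simp_all
  show "P s = 1" unfolding s_comb by (subst P_comb) simp_all
  show "P (s^2) = 1" unfolding s2_comb by (subst P_comb) simp_all
  show "P (s^3) = 7" unfolding s3_comb by (subst P_comb) simp_all
  show "P (s^4) = - 4*tau - 7" unfolding s4_comb by (subst P_comb) (simp_all add: tau_def)
  show "P (s^5) = - 10*tau - 49" unfolding s5_comb by (subst P_comb) (simp_all add: tau_def)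
  show "P (s^6) = 49" unfolding s6_comb by (subst P_comb) simp_all
qed

lemma P_r:
    "P (r) = 1"
    "P (r * s) = -1"
    "P (r * s^2) = eps - 1"
    "P (r * s^3) = 7"
    "P (r * s^4) = - eps*tau + eps^2 - 6*tau - 9*eps - 41"
    "P (r * s^5) = -49"
    "P (r * s^6) = 8*eps*tau - 14*eps^2 + 48*tau + 28*eps + 329"
proof -
  show "P (r) = 1" unfolding r_def by (subst P_comb) simp_all
  show "P (r * s) = -1"
    unfolding r_def unfolding s_comb by (subst P_comb_mult) (simp_all, use e_sum in algebra)
  show "P (r * s^2) = eps - 1"
    unfolding s2_comb unfolding r_def by (subst P_comb_mult, simp_all only: Z_gens Z_0 Z_1 Z_numeral Z_add Z_diff Z_mult Z_power Z_uminus)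
      (rule trans[OF _ window_r_2], algebra)
  show "P (r * s^3) = 7"
    unfolding s3_comb unfolding r_def by (subst P_comb_mult) simp_all
  show "P (r * s^4) = - eps*tau + eps^2 - 6*tau - 9*eps - 41"
    unfolding s4_comb unfolding r_def by (subst P_comb_mult, simp_all only: Z_gens Z_0 Z_1 Z_numeral Z_add Z_diff Z_mult Z_power Z_uminus)
      (rule trans[OF _ window_r_4], algebra)
  show "P (r * s^5) = -49"
    unfolding s5_comb unfolding r_def by (subst P_comb_mult, simp_all only: Z_gens Z_0 Z_1 Z_numeral Z_add Z_diff Z_mult Z_power Z_uminus)
      (rule trans[OF _ window_r_5], algebra)
  show "P (r * s^6) = 8*eps*tau - 14*eps^2 + 48*tau + 28*eps + 329"
    unfolding s6_comb unfolding r_def by (subst P_comb_mult, simp_all only: Z_gens Z_0 Z_1 Z_numeral Z_add Z_diff Z_mult Z_power Z_uminus)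
      (rule trans[OF _ window_r_6], algebra)
qed

lemma P_r2:
    "P (r^2) = 1"
    "P (r^2 * s) = -7"
    "P (r^2 * s^2) = -7"
    "P (r^2 * s^3) = - 4*eps*tau + 4*eps^2 - 36*eps - 17"
    "P (r^2 * s^4) = - 20*eps*tau + 21*eps^2 - 8*tau - 140*eps - 175"
    "P (r^2 * s^5) = - 44*eps*tau + 42*eps^2 + 30*tau - 280*eps - 105"
    "P (r^2 * s^6) = - 2*eps*tau^2 + 2*eps^2*tau - 130*eps*tau + 98*eps^2 + 128*tau - 882*eps + 441"
proof -
  show "P (r^2) = 1" unfolding r2_comb by (subst P_comb) simp_all
  show "P (r^2 * s) = -7"
    unfolding r2_comb unfolding s_comb by (subst P_comb_mult, simp_all only: Z_gens Z_0 Z_1 Z_numeral Z_add Z_diff Z_mult Z_power Z_uminus)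
      (rule trans[OF _ window_r2_1], algebra)
  show "P (r^2 * s^2) = -7"
    unfolding s2_comb unfolding r2_comb by (subst P_comb_mult, simp_all only: Z_gens Z_0 Z_1 Z_numeral Z_add Z_diff Z_mult Z_power Z_uminus)
      (rule trans[OF _ window_r2_2], algebra)
  show "P (r^2 * s^3) = - 4*eps*tau + 4*eps^2 - 36*eps - 17"
    unfolding s3_comb unfolding r2_comb by (subst P_comb_mult, simp_all only: Z_gens Z_0 Z_1 Z_numeral Z_add Z_diff Z_mult Z_power Z_uminus)
      (rule trans[OF _ window_r2_3], algebra)
  show "P (r^2 * s^4) = - 20*eps*tau + 21*eps^2 - 8*tau - 140*eps - 175"
    unfolding s4_comb unfolding r2_comb by (subst P_comb_mult, simp_all only: Z_gens Z_0 Z_1 Z_numeral Z_add Z_diff Z_mult Z_power Z_uminus)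
      (rule trans[OF _ window_r2_4], algebra)
  show "P (r^2 * s^5) = - 44*eps*tau + 42*eps^2 + 30*tau - 280*eps - 105"
    unfolding s5_comb unfolding r2_comb by (subst P_comb_mult, simp_all only: Z_gens Z_0 Z_1 Z_numeral Z_add Z_diff Z_mult Z_power Z_uminus)
      (rule trans[OF _ window_r2_5], algebra)
  show "P (r^2 * s^6) = - 2*eps*tau^2 + 2*eps^2*tau - 130*eps*tau + 98*eps^2 + 128*tau - 882*eps + 441"
    unfolding s6_comb unfolding r2_comb by (subst P_comb_mult, simp_all only: Z_gens Z_0 Z_1 Z_numeral Z_add Z_diff Z_mult Z_power Z_uminus)
      (rule trans[OF _ window_r2_6], algebra)
qed

lemma P_sg:
    "P (sg) = 1"
    "P (sg * s) = 1"
    "P (sg * s^2) = 2*tau - 2*eps + 9"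
    "P (sg * s^3) = 8*tau - 7*eps + 49"
    "P (sg * s^4) = 8*tau - 14*eps + 63"
    "P (sg * s^5) = tau^2 - eps*tau + 29*tau - 49*eps + 98"
    "P (sg * s^6) = - 8*tau^2 + 8*eps*tau + 48*tau - 98*eps + 441"
proof -
  show "P (sg) = 1" unfolding sg_def by (subst P_comb) simp_all
  show "P (sg * s) = 1"
    unfolding sg_def unfolding s_comb by (subst P_comb_mult) simp_all
  show "P (sg * s^2) = 2*tau - 2*eps + 9"
    unfolding s2_comb unfolding sg_def by (subst P_comb_mult, simp_all only: Z_gens Z_0 Z_1 Z_numeral Z_add Z_diff Z_mult Z_power Z_uminus)
      (unfold g_eq, rule trans[OF _ window_s_2], algebra)
  show "P (sg * s^3) = 8*tau - 7*eps + 49"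
    unfolding s3_comb unfolding sg_def by (subst P_comb_mult, simp_all only: Z_gens Z_0 Z_1 Z_numeral Z_add Z_diff Z_mult Z_power Z_uminus)
      (unfold g_eq, rule trans[OF _ window_s_3], algebra)
  show "P (sg * s^4) = 8*tau - 14*eps + 63"
    unfolding s4_comb unfolding sg_def by (subst P_comb_mult, simp_all only: Z_gens Z_0 Z_1 Z_numeral Z_add Z_diff Z_mult Z_power Z_uminus)
      (unfold g_eq, rule trans[OF _ window_s_4], algebra)
  show "P (sg * s^5) = tau^2 - eps*tau + 29*tau - 49*eps + 98"
    unfolding s5_comb unfolding sg_def by (subst P_comb_mult, simp_all only: Z_gens Z_0 Z_1 Z_numeral Z_add Z_diff Z_mult Z_power Z_uminus)
      (unfold g_eq, rule trans[OF _ window_s_5], algebra)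
  show "P (sg * s^6) = - 8*tau^2 + 8*eps*tau + 48*tau - 98*eps + 441"
    unfolding s6_comb unfolding sg_def by (subst P_comb_mult, simp_all only: Z_gens Z_0 Z_1 Z_numeral Z_add Z_diff Z_mult Z_power Z_uminus)
      (unfold g_eq, rule trans[OF _ window_s_6], algebra)
qed

lemma P_sg2:
    "P (sg^2) = 1"
    "P (sg^2 * s) = - 2*tau + 2*eps - 9"
    "P (sg^2 * s^2) = -7"
    "P (sg^2 * s^3) = - (tau^2) + 2*eps*tau - eps^2 + 3*tau + 2*eps + 48"
    "P (sg^2 * s^4) = 49"
    "P (sg^2 * s^5) = 26*tau^2 - 40*eps*tau + 14*eps^2 + 250*tau - 224*eps + 553"
    "P (sg^2 * s^6) = 64*tau^2 - 112*eps*tau + 49*eps^2 + 896*tau - 784*eps + 2793"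
proof -
  show "P (sg^2) = 1" unfolding sg2_comb by (subst P_comb) simp_all
  show "P (sg^2 * s) = - 2*tau + 2*eps - 9"
    unfolding sg2_comb unfolding s_comb by (subst P_comb_mult, simp_all only: Z_gens Z_0 Z_1 Z_numeral Z_add Z_diff Z_mult Z_power Z_uminus)
      (rule trans[OF _ window_s2_1], algebra)
  show "P (sg^2 * s^2) = -7"
    unfolding s2_comb unfolding sg2_comb by (subst P_comb_mult, simp_all only: Z_gens Z_0 Z_1 Z_numeral Z_add Z_diff Z_mult Z_power Z_uminus)
      (rule trans[OF _ window_s2_2], algebra)
  show "P (sg^2 * s^3) = - (tau^2) + 2*eps*tau - eps^2 + 3*tau + 2*eps + 48"
    unfolding s3_comb unfolding sg2_comb by (subst P_comb_mult, simp_all only: Z_gens Z_0 Z_1 Z_numeral Z_add Z_diff Z_mult Z_power Z_uminus)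
      (rule trans[OF _ window_s2_3], algebra)
  show "P (sg^2 * s^4) = 49"
    unfolding s4_comb unfolding sg2_comb by (subst P_comb_mult, simp_all only: Z_gens Z_0 Z_1 Z_numeral Z_add Z_diff Z_mult Z_power Z_uminus)
      (rule trans[OF _ window_s2_4], algebra)
  show "P (sg^2 * s^5) = 26*tau^2 - 40*eps*tau + 14*eps^2 + 250*tau - 224*eps + 553"
    unfolding s5_comb unfolding sg2_comb by (subst P_comb_mult, simp_all only: Z_gens Z_0 Z_1 Z_numeral Z_add Z_diff Z_mult Z_power Z_uminus)
      (rule trans[OF _ window_s2_5], algebra)
  show "P (sg^2 * s^6) = 64*tau^2 - 112*eps*tau + 49*eps^2 + 896*tau - 784*eps + 2793"
    unfolding s6_comb unfolding sg2_comb by (subst P_comb_mult, simp_all only: Z_gens Z_0 Z_1 Z_numeral Z_add Z_diff Z_mult Z_power Z_uminus)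
      (rule trans[OF _ window_s2_6], algebra)
qed

lemma P_tau2:
  assumes "tau2 = - 8 - gW^3*gU*zW - gU^3*gV*zU - gV^3*gW*zV"
  shows "eps*tau2^2 = 8*tau^2 + 56*tau - 7*eps*tau"
proof (rule tau2_relation)
  have "tau2 = - 8 - (zW*gW^2)*(gU*gW) - (zU*gU^2)*(gV*gU) - (zV*gV^2)*(gW*gV)"
    unfolding assms by algebra
  thus "tau2 = - 8 - (1 + 2*eU + 2*eV + 2*eU*eV + eU^2 - zU + zW)*(zU - 1 - eU - 2*eV - eU*eV)
    - (1 + 2*eV + 2*eW + 2*eV*eW + eV^2 - zV + zU)*(zV - 1 - eV - 2*eW - eV*eW)
    - (1 + 2*eW + 2*eU + 2*eW*eU + eW^2 - zW + zV)*(zW - 1 - eW - 2*eU - eW*eU)"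
    unfolding g_eq g_products zg_products .
qed

end

subsection \<open>The 7-adic filtration\<close>

locale filtration =
  fixes t H :: "'a::field_char_0"
  assumes t_nonzero: "t \<noteq> 0"
    and H_cubic: "H^3 = 2*H^2 - H - 9*t*H + 10*t*H^2 - 17*t^2*H + 8*t^3"
begin

text \<open>\<open>t\<close> and \<open>H\<close> have weight 7 and a factor 7 has weight -4, so
  \<open>w\<close> bounds the weight; \<open>c\<close> is the least power of 7 and \<open>d\<close>
  bounds 7 times the exponent of \<open>t\<close> from below. Seven steps of the recurrence bring
  t^2, that is 2 per step, and weight 7 keeps this integral. The value 4 is the least for which all
  coefficients of the recurrence fit: 21*t^2, 147*t^2 and 343*t^2 in front of f (k + 2), f (k + 4)
  and f (k + 6) attain equality.\<close>

definition gens :: "nat \<Rightarrow> int \<Rightarrow> int \<Rightarrow> nat set \<Rightarrow> 'a set" where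
  "gens c w d B = {7 ^ e * (t powi i * H ^ j) | e i j. j \<in> B \<and> c \<le> e \<and> 7 * (i + int j) - w \<le> 4 * int e \<and> d \<le> 7 * i}"

definition Fil :: "nat \<Rightarrow> int \<Rightarrow> int \<Rightarrow> 'a set" where
  "Fil c w d = group_closure (gens c w d UNIV)"

lemma closure_of_int_mult:
  "f \<in> group_closure S \<Longrightarrow> of_int n * f \<in> group_closure S" for f :: 'a
proof (cases n rule: int_cases2)
  case (nonneg m)
  thus "f \<in> group_closure S \<Longrightarrow> ?thesis" by (simp add: group_closure_scalar_mult_left)
next
  case (nonpos m)
  thus "f \<in> group_closure S \<Longrightarrow> ?thesis" by (simp add: group_closure_scalar_mult_left)
qed

lemma closure_mono:
  fixes f :: 'a
  assumes "f \<in> group_closure S" "S \<subseteq> group_closure T"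
  shows "f \<in> group_closure T"
  using assms(1) by (induction rule: group_closure.induct) (use assms(2) in \<open>auto intro: group_closure.diff\<close>)

lemma Fil_0 [simp]: "0 \<in> Fil c w d"
  and Fil_add: "f \<in> Fil c w d \<Longrightarrow> g \<in> Fil c w d \<Longrightarrow> f + g \<in> Fil c w d"
  and Fil_diff: "f \<in> Fil c w d \<Longrightarrow> g \<in> Fil c w d \<Longrightarrow> f - g \<in> Fil c w d"
  and Fil_minus: "f \<in> Fil c w d \<Longrightarrow> - f \<in> Fil c w d"
  by (auto simp: Fil_def intro: group_closure_add group_closure.diff)

lemma Fil_gen:
  assumes "c \<le> e" "7 * (i + int j) - w \<le> 4 * int e" "d \<le> 7 * i"
  shows "of_int n * 7 ^ e * (t powi i * H ^ j) \<in> Fil c w d"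
proof -
  have "7 ^ e * (t powi i * H ^ j) \<in> gens c w d UNIV"
    unfolding gens_def using assms by blast
  hence "7 ^ e * (t powi i * H ^ j) \<in> Fil c w d"
    unfolding Fil_def by (auto intro: group_closure.base)
  thus ?thesis unfolding Fil_def mult.assoc by (rule closure_of_int_mult)
qed

lemma Fil_mono:
  assumes "f \<in> Fil c w d" "c' \<le> c" "w \<le> w'" "d' \<le> d"
  shows "f \<in> Fil c' w' d'"
proof -
  have "gens c w d UNIV \<subseteq> gens c' w' d' UNIV"
  proof
    fix f assume "f \<in> gens c w d UNIV"
    then obtain e i j where "f = 7 ^ e * (t powi i * H ^ j)" "c \<le> e" "7 * (i + int j) - w \<le> 4 * int e" "d \<le> 7 * i"
      unfolding gens_def by blast
    thus "f \<in> gens c' w' d' UNIV"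
      unfolding gens_def using assms(2-4) by (intro CollectI exI[of _ e] exI[of _ i] exI[of _ j]) auto
  qed
  thus ?thesis using assms(1) unfolding Fil_def
    by (elim closure_mono) (auto intro: group_closure.base)
qed

lemma closure_mult:
  fixes f g :: 'a
  assumes "f \<in> group_closure S" "g \<in> group_closure T" "\<And>a b. a \<in> S \<Longrightarrow> b \<in> T \<Longrightarrow> a * b \<in> group_closure R"
  shows "f * g \<in> group_closure R"
  using assms(1)
proof (induction rule: group_closure.induct)
  case (base a)
  show ?case
  proof (cases "a = 0")
    case False
    hence a: "a \<in> S" using base by simp
    show ?thesis using assms(2)
    proof (induction rule: group_closure.induct)
      case (base b)
      thus ?case using assms(3)[OF a] by auto
    next
      case (diff b b')
      thus ?case by (simp add: right_diff_distrib group_closure.diff)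
    qed
  qed simp
next
  case (diff a a')
  thus ?case by (simp add: left_diff_distrib group_closure.diff)
qed

lemma Fil_mult:
  assumes "f \<in> Fil c w d" "g \<in> Fil c' w' d'"
  shows "f * g \<in> Fil (c + c') (w + w') (d + d')"
  unfolding Fil_def
proof (rule closure_mult)
  show "f \<in> group_closure (gens c w d UNIV)" "g \<in> group_closure (gens c' w' d' UNIV)"
    using assms by (simp_all add: Fil_def)
  fix a b assume "a \<in> gens c w d UNIV" "b \<in> gens c' w' d' UNIV"
  then obtain e i j e' i' j' where
    a: "a = 7 ^ e * (t powi i * H ^ j)" "c \<le> e" "7 * (i + int j) - w \<le> 4 * int e" "d \<le> 7 * i" and
    b: "b = 7 ^ e' * (t powi i' * H ^ j')" "c' \<le> e'" "7 * (i' + int j') - w' \<le> 4 * int e'" "d' \<le> 7 * i'"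
    unfolding gens_def by blast
  have "a * b = of_int 1 * 7 ^ (e + e') * (t powi (i + i') * H ^ (j + j'))"
    unfolding a b using t_nonzero by (simp add: power_add power_int_add)
  also have "\<dots> \<in> Fil (c + c') (w + w') (d + d')"
    by (rule Fil_gen) (use a b in auto)
  finally show "a * b \<in> group_closure (gens (c + c') (w + w') (d + d') UNIV)" by (simp add: Fil_def)
qed

lemma Fil_mult':
  assumes "f \<in> Fil c w d" "g \<in> Fil c' w' d'" "c'' \<le> c + c'" "w + w' \<le> w''" "d'' \<le> d + d'"
  shows "f * g \<in> Fil c'' w'' d''"
  using Fil_mono[OF Fil_mult[OF assms(1,2)]] assms(3-5) by blast

lemma Fil_7_power_mult:
  assumes "f \<in> Fil c w d"
  shows "7 ^ e * f \<in> Fil (e + c) (w - 4 * int e) d"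
proof -
  have "of_int 1 * 7 ^ e * (t powi 0 * H ^ 0) \<in> Fil e (- 4 * int e) 0" by (rule Fil_gen) auto
  from Fil_mult[OF this assms] show ?thesis by (simp add: algebra_simps)
qed

text \<open>The cubic lowers the degree in \<open>H\<close> without raising the total degree or lowering the power of \<open>t\<close>.\<close>

lemma gens_reduce: "gens c w d UNIV \<subseteq> group_closure (gens c w d {..2})"
proof -
  have "c \<le> e \<Longrightarrow> 7 * (i + int j) - w \<le> 4 * int e \<Longrightarrow> d \<le> 7 * i \<Longrightarrow>
      7 ^ e * (t powi i * H ^ j) \<in> group_closure (gens c w d {..2})" for e i j
  proof (induction j arbitrary: i rule: less_induct)
    case (less j)
    let ?S = "group_closure (gens c w d {..2})"
    show ?case
    proof (cases "j \<le> 2")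
      case True
      hence "7 ^ e * (t powi i * H ^ j) \<in> gens c w d {..2}"
        unfolding gens_def using less.prems by blast
      thus ?thesis by (auto intro: group_closure.base)
    next
      case False
      define m where "m = j - 3"
      have j: "j = m + 3" using False by (simp add: m_def)
      have IH: "of_int n * (7 ^ e * (t powi (i + int a) * H ^ (m + b))) \<in> ?S" if "b \<le> 2" "a + b \<le> 3" for n a b
        by (rule closure_of_int_mult, rule less.IH) (use that less.prems j in auto)
      have "7 ^ e * (t powi i * H ^ j) =
         of_int 2 * (7 ^ e * (t powi (i + int 0) * H ^ (m + 2))) - of_int 1 * (7 ^ e * (t powi (i + int 0) * H ^ (m + 1)))
         - of_int 9 * (7 ^ e * (t powi (i + int 1) * H ^ (m + 1))) + of_int 10 * (7 ^ e * (t powi (i + int 1) * H ^ (m + 2)))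
         - of_int 17 * (7 ^ e * (t powi (i + int 2) * H ^ (m + 1))) + of_int 8 * (7 ^ e * (t powi (i + int 3) * H ^ (m + 0)))"
        unfolding j power_add[of H m 3] H_cubic using t_nonzero
        by (simp add: power_int_add power_add power2_eq_square power3_eq_cube algebra_simps)
      also have "\<dots> \<in> ?S"
        by (intro group_closure_add group_closure.diff IH) simp_all
      finally show ?thesis .
    qed
  qed
  thus ?thesis unfolding gens_def[of c w d UNIV] by blast
qed

lemma Fil_induct [consumes 1, case_names gen diff]:
  assumes "f \<in> Fil c w d"
    and "\<And>e i j. j \<le> 2 \<Longrightarrow> c \<le> e \<Longrightarrow> 7 * (i + int j) - w \<le> 4 * int e \<Longrightarrow> d \<le> 7 * i \<Longrightarrow> Q (7 ^ e * (t powi i * H ^ j))"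
    and "\<And>f g. Q f \<Longrightarrow> Q g \<Longrightarrow> Q (f - g)"
  shows "Q f"
proof -
  \<comment> \<open>The property of 0 is derived as a difference of a generator with itself, so some
    generator must be exhibited: with t^|d| any sufficiently large power of 7 will do.\<close>
  define e where "e = c + nat (7 * \<bar>d\<bar> - w)"
  have "7 * \<bar>d\<bar> - w \<le> 4 * int e"
    unfolding e_def by (cases "7 * \<bar>d\<bar> - w \<ge> 0") simp_all
  hence "Q (7 ^ e * (t powi \<bar>d\<bar> * H ^ 0))" by (intro assms(2)) (auto simp: e_def)
  from assms(3)[OF this this] have 0: "Q 0" by simp
  have "f \<in> group_closure (gens c w d {..2})"
    using assms(1) gens_reduce closure_mono unfolding Fil_def by blast
  thus ?thesis
  proof (induction rule: group_closure.induct)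
    case (base f)
    thus ?case using 0 assms(2) by (auto simp: gens_def)
  qed (use assms(3) in auto)
qed

definition "eps = H / t"
definition "tau = inverse t"

text \<open>\<open>eps\<close> has weight 0 and \<open>tau\<close> weight -7, while both lower the
  exponent of \<open>t\<close> by one.\<close>

lemma Fil_eps_tau:
  assumes "c \<le> e" "- 7 * int b - w \<le> 4 * int e" "d \<le> - 7 * int (a + b)"
  shows "of_int n * 7 ^ e * (eps ^ a * tau ^ b) \<in> Fil c w d"
proof -
  have "eps ^ a * tau ^ b = t powi (- int (a + b)) * H ^ a"
    using t_nonzero by (simp add: eps_def tau_def power_int_minus power_int_add power_divide power_inverse field_simps
        power_add power_int_diff)
  moreover have "of_int n * 7 ^ e * (t powi (- int (a + b)) * H ^ a) \<in> Fil c w d"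
    by (rule Fil_gen) (use assms in auto)
  ultimately show ?thesis by simp
qed

text \<open>This is \<open>s_equation\<close> divided by tau^2, where 1/tau is \<open>t\<close> at
  X^7, multiplied by a power of 1/s and pushed through \<open>U\<close>, which is linear over series
  in X^7.\<close>

definition recurrent :: "(int \<Rightarrow> 'a) \<Rightarrow> bool" where
  "recurrent f \<longleftrightarrow> (\<forall>k. f (k + 7) = - (t^2) * f k + 7*t^2 * f (k + 1) - 21*t^2 * f (k + 2) + 49*t^2 * f (k + 3)
     - (7*t + 147*t^2) * f (k + 4) + (35*t + 343*t^2) * f (k + 5) - (49*t + 343*t^2) * f (k + 6))"

text \<open>Modulo 7 the recurrence is \<open>f (k + 7) = - t\<^sup>2 f k\<close>, so divisibility by 7 propagates in residue classes.\<close>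

lemma Fil_recurrent:
  assumes "recurrent f"
    and init: "\<And>k. - 6 \<le> k \<Longrightarrow> k \<le> 0 \<Longrightarrow> f k \<in> Fil (c k) (w + 2 * k) (d + 2 * k)"
    and c: "\<And>k. c (k + 7) = c k" "\<And>k. c k \<le> 1"
  shows "- 6 \<le> k \<Longrightarrow> f k \<in> Fil (c k) (w + 2 * k) (d + 2 * k)"
proof (induction "nat (k + 6)" arbitrary: k rule: less_induct)
  case less
  show ?case
  proof (cases "k \<le> 0")
    case False
    define m where "m = k - 7"
    have k: "k = m + 7" and m: "m \<ge> - 6" using False by (auto simp: m_def)
    have IH: "f (m + l) \<in> Fil (c (m + l)) (w + 2 * (m + l)) (d + 2 * (m + l))" if "0 \<le> l" "l < 7" for l
      by (rule less.hyps) (use that m k in auto)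
    have IH0: "f (m + l) \<in> Fil 0 (w + 2 * (m + l)) (d + 2 * (m + l))" if "0 \<le> l" "l < 7" for l
      using Fil_mono[OF IH[OF that]] by simp
    let ?F = "Fil (c m) (w + 2 * (m + 7)) (d + 2 * (m + 7))"
    have M0: "- (t^2) \<in> Fil 0 14 14"
      using Fil_gen[of 0 0 2 0 14 14 "-1"] by simp
    have M1: "7*t^2 \<in> Fil 1 12 12"
      using Fil_gen[of 1 1 2 0 12 12 1] by simp
    have M2: "21*t^2 \<in> Fil 1 10 10"
      using Fil_gen[of 1 1 2 0 10 10 3] by simp
    have M3: "49*t^2 \<in> Fil 1 8 8"
      using Fil_gen[of 1 2 2 0 8 8 1] by simp
    have M4: "7*t + 147*t^2 \<in> Fil 1 6 6"
      using Fil_add[OF Fil_gen[of 1 1 1 0 6 6 1] Fil_gen[of 1 2 2 0 6 6 3]] by simp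
    have M5: "35*t + 343*t^2 \<in> Fil 1 4 4"
      using Fil_add[OF Fil_gen[of 1 1 1 0 4 4 5] Fil_gen[of 1 3 2 0 4 4 1]] by simp
    have M6: "49*t + 343*t^2 \<in> Fil 1 2 2"
      using Fil_add[OF Fil_gen[of 1 2 1 0 2 2 1] Fil_gen[of 1 3 2 0 2 2 1]] by simp
    have eq: "f (m + 7) = - (t^2) * f (m + 0) + 7*t^2 * f (m + 1) - 21*t^2 * f (m + 2) + 49*t^2 * f (m + 3)
     - (7*t + 147*t^2) * f (m + 4) + (35*t + 343*t^2) * f (m + 5) - (49*t + 343*t^2) * f (m + 6)"
      using assms(1) by (simp add: recurrent_def)
    have m0: "- (t^2) * f (m + 0) \<in> ?F"
      by (rule Fil_mult'[OF M0 IH]) auto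
    have m1: "7*t^2 * f (m + 1) \<in> ?F" "21*t^2 * f (m + 2) \<in> ?F" "49*t^2 * f (m + 3) \<in> ?F"
      "(7*t + 147*t^2) * f (m + 4) \<in> ?F" "(35*t + 343*t^2) * f (m + 5) \<in> ?F" "(49*t + 343*t^2) * f (m + 6) \<in> ?F"
      by (rule Fil_mult'[OF M1 IH0] Fil_mult'[OF M2 IH0] Fil_mult'[OF M3 IH0]
          Fil_mult'[OF M4 IH0] Fil_mult'[OF M5 IH0] Fil_mult'[OF M6 IH0]; use c(2)[of m] in simp)+
    show ?thesis unfolding k c(1) eq by (intro Fil_add Fil_diff) (use m0 m1 in simp_all)
  qed (use less init in auto)
qed

end

text \<open>The five sequences are k -> \<open>U\<close> (g * s^(-k)) for g = 1, r, r^2, sg, sg^2.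
  For k from -6 to 0 the power of s is nonnegative and the value is one of the constant terms
  computed above. \<open>U1\<close> is \<open>U\<close>, and \<open>U2\<close> is \<open>U\<close>
  after multiplication by \<open>\<phi>\<close>.\<close>

locale seven_adic = filtration +
  fixes f1 fr fr2 fs fs2 :: "int \<Rightarrow> 'a" and U1 U2 :: "'a \<Rightarrow> 'a"
  assumes rec: "recurrent f1" "recurrent fr" "recurrent fr2" "recurrent fs" "recurrent fs2"
    and init_f1: "f1 (0) = 1" "f1 (-1) = 1" "f1 (-2) = 1" "f1 (-3) = 7" "f1 (-4) = -4*tau-7" "f1 (-5) = -10*tau-49" "f1 (-6) = 49"
    and init_fr: "fr (0) = 1" "fr (-1) = -1" "fr (-2) = eps - 1" "fr (-3) = 7" "fr (-4) = - eps*tau + eps^2 - 6*tau - 9*eps - 41" "fr (-5) = -49" "fr (-6) = 8*eps*tau - 14*eps^2 + 48*tau + 28*eps + 329"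
    and init_fr2: "fr2 (0) = 1" "fr2 (-1) = -7" "fr2 (-2) = -7" "fr2 (-3) = - 4*eps*tau + 4*eps^2 - 36*eps - 17" "fr2 (-4) = - 20*eps*tau + 21*eps^2 - 8*tau - 140*eps - 175" "fr2 (-5) = - 44*eps*tau + 42*eps^2 + 30*tau - 280*eps - 105" "fr2 (-6) = - 2*eps*tau^2 + 2*eps^2*tau - 130*eps*tau + 98*eps^2 + 128*tau - 882*eps + 441"
    and init_fs: "fs (0) = 1" "fs (-1) = 1" "fs (-2) = 2*tau - 2*eps + 9" "fs (-3) = 8*tau - 7*eps + 49" "fs (-4) = 8*tau - 14*eps + 63" "fs (-5) = tau^2 - eps*tau + 29*tau - 49*eps + 98" "fs (-6) = - 8*tau^2 + 8*eps*tau + 48*tau - 98*eps + 441"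
    and init_fs2: "fs2 (0) = 1" "fs2 (-1) = - 2*tau + 2*eps - 9" "fs2 (-2) = -7" "fs2 (-3) = - (tau^2) + 2*eps*tau - eps^2 + 3*tau + 2*eps + 48" "fs2 (-4) = 49" "fs2 (-5) = 26*tau^2 - 40*eps*tau + 14*eps^2 + 250*tau - 224*eps + 553" "fs2 (-6) = 64*tau^2 - 112*eps*tau + 49*eps^2 + 896*tau - 784*eps + 2793"
    and U1_diff: "U1 (f - g) = U1 f - U1 g" and U2_diff: "U2 (f - g) = U2 f - U2 g"
    and U1_gen: "U1 (t powi i) = t powi (- i) * f1 (4*i)"
      "U1 (t powi i * H) = - ((8*tau + 56 - 7*eps) * (t powi (- i) * fr (4*i + 5)))"
      "U1 (t powi i * H^2) = (8*tau + 56 - 7*eps)^2 * (t powi (- i) * fr2 (4*i + 10))"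
    and U2_gen: "U2 (t powi i) = - (t powi (- i) * fs2 (4*i + 5))"
      "U2 (t powi i * H) = - ((8*tau + 56 - 7*eps) * (t powi (- i) * fs (4*i + 8)))"
      "U2 (t powi i * H^2) = - ((8*tau + 56 - 7*eps)^2 * (t powi (- i) * f1 (4*i + 11)))"
begin

text \<open>The classes 4 and 1 modulo 7 are those of k = -3 and k = -6, where the initial values
  are 7 and 49. Here and in the next four lemmas the two offsets are the sharpest that the listed
  expansions allow: the value 1 attains the weight at k = -2 and the exponent bound at k =
  0.\<close>

lemma Fil_f1: "- 6 \<le> k \<Longrightarrow> f1 k \<in> Fil (if k mod 7 = 1 \<or> k mod 7 = 4 then 1 else 0) (4 + 2*k) (0 + 2*k)"
proof (rule Fil_recurrent[where c = "\<lambda>k. (if k mod 7 = 1 \<or> k mod 7 = 4 then 1 else 0)"])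
  fix k :: int
  assume "- 6 \<le> k" "k \<le> 0"
  hence "k \<in> {- 6, - 5, - 4, - 3, - 2, - 1, 0}" by auto
  moreover have "f1 (0) \<in> Fil 0 (4) (0)"
  proof -
    have "f1 (0) = of_int (1) * 7 ^ 0 * (eps ^ 0 * tau ^ 0)" by (simp add: init_f1)
    also have "\<dots> \<in> Fil 0 (4) (0)" by (intro Fil_add Fil_eps_tau) simp_all
    finally show ?thesis .
  qed
  moreover have "f1 (-1) \<in> Fil 0 (2) (-2)"
  proof -
    have "f1 (-1) = of_int (1) * 7 ^ 0 * (eps ^ 0 * tau ^ 0)" by (simp add: init_f1)
    also have "\<dots> \<in> Fil 0 (2) (-2)" by (intro Fil_add Fil_eps_tau) simp_all
    finally show ?thesis .
  qed
  moreover have "f1 (-2) \<in> Fil 0 (0) (-4)"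
  proof -
    have "f1 (-2) = of_int (1) * 7 ^ 0 * (eps ^ 0 * tau ^ 0)" by (simp add: init_f1)
    also have "\<dots> \<in> Fil 0 (0) (-4)" by (intro Fil_add Fil_eps_tau) simp_all
    finally show ?thesis .
  qed
  moreover have "f1 (-3) \<in> Fil 1 (-2) (-6)"
  proof -
    have "f1 (-3) = of_int (1) * 7 ^ 1 * (eps ^ 0 * tau ^ 0)" by (simp add: init_f1)
    also have "\<dots> \<in> Fil 1 (-2) (-6)" by (intro Fil_add Fil_eps_tau) simp_all
    finally show ?thesis .
  qed
  moreover have "f1 (-4) \<in> Fil 0 (-4) (-8)"
  proof -
    have "f1 (-4) = of_int (-4) * 7 ^ 0 * (eps ^ 0 * tau ^ 1) + of_int (-1) * 7 ^ 1 * (eps ^ 0 * tau ^ 0)" by (simp add: init_f1)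
    also have "\<dots> \<in> Fil 0 (-4) (-8)" by (intro Fil_add Fil_eps_tau) simp_all
    finally show ?thesis .
  qed
  moreover have "f1 (-5) \<in> Fil 0 (-6) (-10)"
  proof -
    have "f1 (-5) = of_int (-10) * 7 ^ 0 * (eps ^ 0 * tau ^ 1) + of_int (-1) * 7 ^ 2 * (eps ^ 0 * tau ^ 0)" by (simp add: init_f1)
    also have "\<dots> \<in> Fil 0 (-6) (-10)" by (intro Fil_add Fil_eps_tau) simp_all
    finally show ?thesis .
  qed
  moreover have "f1 (-6) \<in> Fil 1 (-8) (-12)"
  proof -
    have "f1 (-6) = of_int (1) * 7 ^ 2 * (eps ^ 0 * tau ^ 0)" by (simp add: init_f1)
    also have "\<dots> \<in> Fil 1 (-8) (-12)" by (intro Fil_add Fil_eps_tau) simp_all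
    finally show ?thesis .
  qed
  ultimately show "f1 k \<in> Fil (if k mod 7 = 1 \<or> k mod 7 = 4 then 1 else 0) (4 + 2*k) (0 + 2*k)" by auto
qed (use rec in auto)

text \<open>Class 2 is that of k = -5 with value -49; \<open>U1\<close> reads \<open>fr\<close> at
  4*i + 5, which falls into this class for i = 1. At k = -4 the constant -41 attains the weight and
  eps^2 the exponent bound.\<close>

lemma Fil_fr: "- 6 \<le> k \<Longrightarrow> fr k \<in> Fil (if k mod 7 = 2 then 1 else 0) (8 + 2*k) (-6 + 2*k)"
proof (rule Fil_recurrent[where c = "\<lambda>k. (if k mod 7 = 2 then 1 else 0)"])
  fix k :: int
  assume "- 6 \<le> k" "k \<le> 0"
  hence "k \<in> {- 6, - 5, - 4, - 3, - 2, - 1, 0}" by auto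
  moreover have "fr (0) \<in> Fil 0 (8) (-6)"
  proof -
    have "fr (0) = of_int (1) * 7 ^ 0 * (eps ^ 0 * tau ^ 0)" by (simp add: init_fr)
    also have "\<dots> \<in> Fil 0 (8) (-6)" by (intro Fil_add Fil_eps_tau) simp_all
    finally show ?thesis .
  qed
  moreover have "fr (-1) \<in> Fil 0 (6) (-8)"
  proof -
    have "fr (-1) = of_int (-1) * 7 ^ 0 * (eps ^ 0 * tau ^ 0)" by (simp add: init_fr)
    also have "\<dots> \<in> Fil 0 (6) (-8)" by (intro Fil_add Fil_eps_tau) simp_all
    finally show ?thesis .
  qed
  moreover have "fr (-2) \<in> Fil 0 (4) (-10)"
  proof -
    have "fr (-2) = of_int (1) * 7 ^ 0 * (eps ^ 1 * tau ^ 0) + of_int (-1) * 7 ^ 0 * (eps ^ 0 * tau ^ 0)" by (simp add: init_fr)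
    also have "\<dots> \<in> Fil 0 (4) (-10)" by (intro Fil_add Fil_eps_tau) simp_all
    finally show ?thesis .
  qed
  moreover have "fr (-3) \<in> Fil 0 (2) (-12)"
  proof -
    have "fr (-3) = of_int (1) * 7 ^ 1 * (eps ^ 0 * tau ^ 0)" by (simp add: init_fr)
    also have "\<dots> \<in> Fil 0 (2) (-12)" by (intro Fil_add Fil_eps_tau) simp_all
    finally show ?thesis .
  qed
  moreover have "fr (-4) \<in> Fil 0 (0) (-14)"
  proof -
    have "fr (-4) = of_int (-1) * 7 ^ 0 * (eps ^ 1 * tau ^ 1) + of_int (1) * 7 ^ 0 * (eps ^ 2 * tau ^ 0) + of_int (-6) * 7 ^ 0 * (eps ^ 0 * tau ^ 1) + of_int (-9) * 7 ^ 0 * (eps ^ 1 * tau ^ 0) + of_int (-41) * 7 ^ 0 * (eps ^ 0 * tau ^ 0)" by (simp add: init_fr)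
    also have "\<dots> \<in> Fil 0 (0) (-14)" by (intro Fil_add Fil_eps_tau) simp_all
    finally show ?thesis .
  qed
  moreover have "fr (-5) \<in> Fil 1 (-2) (-16)"
  proof -
    have "fr (-5) = of_int (-1) * 7 ^ 2 * (eps ^ 0 * tau ^ 0)" by (simp add: init_fr)
    also have "\<dots> \<in> Fil 1 (-2) (-16)" by (intro Fil_add Fil_eps_tau) simp_all
    finally show ?thesis .
  qed
  moreover have "fr (-6) \<in> Fil 0 (-4) (-18)"
  proof -
    have "fr (-6) = of_int (8) * 7 ^ 0 * (eps ^ 1 * tau ^ 1) + of_int (-2) * 7 ^ 1 * (eps ^ 2 * tau ^ 0) + of_int (48) * 7 ^ 0 * (eps ^ 0 * tau ^ 1) + of_int (4) * 7 ^ 1 * (eps ^ 1 * tau ^ 0) + of_int (47) * 7 ^ 1 * (eps ^ 0 * tau ^ 0)" by (simp add: init_fr)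
    also have "\<dots> \<in> Fil 0 (-4) (-18)" by (intro Fil_add Fil_eps_tau) simp_all
    finally show ?thesis .
  qed
  ultimately show "fr k \<in> Fil (if k mod 7 = 2 then 1 else 0) (8 + 2*k) (-6 + 2*k)" by auto
qed (use rec in auto)

text \<open>The weight is attained by -17 at k = -3, the exponent bound by the cubic terms at k =
  -6.\<close>

lemma Fil_fr2: "- 6 \<le> k \<Longrightarrow> fr2 k \<in> Fil 0 (6 + 2*k) (-9 + 2*k)"
proof (rule Fil_recurrent[where c = "\<lambda>k. 0"])
  fix k :: int
  assume "- 6 \<le> k" "k \<le> 0"
  hence "k \<in> {- 6, - 5, - 4, - 3, - 2, - 1, 0}" by auto
  moreover have "fr2 (0) \<in> Fil 0 (6) (-9)"
  proof -
    have "fr2 (0) = of_int (1) * 7 ^ 0 * (eps ^ 0 * tau ^ 0)" by (simp add: init_fr2)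
    also have "\<dots> \<in> Fil 0 (6) (-9)" by (intro Fil_add Fil_eps_tau) simp_all
    finally show ?thesis .
  qed
  moreover have "fr2 (-1) \<in> Fil 0 (4) (-11)"
  proof -
    have "fr2 (-1) = of_int (-1) * 7 ^ 1 * (eps ^ 0 * tau ^ 0)" by (simp add: init_fr2)
    also have "\<dots> \<in> Fil 0 (4) (-11)" by (intro Fil_add Fil_eps_tau) simp_all
    finally show ?thesis .
  qed
  moreover have "fr2 (-2) \<in> Fil 0 (2) (-13)"
  proof -
    have "fr2 (-2) = of_int (-1) * 7 ^ 1 * (eps ^ 0 * tau ^ 0)" by (simp add: init_fr2)
    also have "\<dots> \<in> Fil 0 (2) (-13)" by (intro Fil_add Fil_eps_tau) simp_all
    finally show ?thesis .
  qed
  moreover have "fr2 (-3) \<in> Fil 0 (0) (-15)"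
  proof -
    have "fr2 (-3) = of_int (-4) * 7 ^ 0 * (eps ^ 1 * tau ^ 1) + of_int (4) * 7 ^ 0 * (eps ^ 2 * tau ^ 0) + of_int (-36) * 7 ^ 0 * (eps ^ 1 * tau ^ 0) + of_int (-17) * 7 ^ 0 * (eps ^ 0 * tau ^ 0)" by (simp add: init_fr2)
    also have "\<dots> \<in> Fil 0 (0) (-15)" by (intro Fil_add Fil_eps_tau) simp_all
    finally show ?thesis .
  qed
  moreover have "fr2 (-4) \<in> Fil 0 (-2) (-17)"
  proof -
    have "fr2 (-4) = of_int (-20) * 7 ^ 0 * (eps ^ 1 * tau ^ 1) + of_int (3) * 7 ^ 1 * (eps ^ 2 * tau ^ 0) + of_int (-8) * 7 ^ 0 * (eps ^ 0 * tau ^ 1) + of_int (-20) * 7 ^ 1 * (eps ^ 1 * tau ^ 0) + of_int (-25) * 7 ^ 1 * (eps ^ 0 * tau ^ 0)" by (simp add: init_fr2)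
    also have "\<dots> \<in> Fil 0 (-2) (-17)" by (intro Fil_add Fil_eps_tau) simp_all
    finally show ?thesis .
  qed
  moreover have "fr2 (-5) \<in> Fil 0 (-4) (-19)"
  proof -
    have "fr2 (-5) = of_int (-44) * 7 ^ 0 * (eps ^ 1 * tau ^ 1) + of_int (6) * 7 ^ 1 * (eps ^ 2 * tau ^ 0) + of_int (30) * 7 ^ 0 * (eps ^ 0 * tau ^ 1) + of_int (-40) * 7 ^ 1 * (eps ^ 1 * tau ^ 0) + of_int (-15) * 7 ^ 1 * (eps ^ 0 * tau ^ 0)" by (simp add: init_fr2)
    also have "\<dots> \<in> Fil 0 (-4) (-19)" by (intro Fil_add Fil_eps_tau) simp_all
    finally show ?thesis .
  qed
  moreover have "fr2 (-6) \<in> Fil 0 (-6) (-21)"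
  proof -
    have "fr2 (-6) = of_int (-2) * 7 ^ 0 * (eps ^ 1 * tau ^ 2) + of_int (2) * 7 ^ 0 * (eps ^ 2 * tau ^ 1) + of_int (-130) * 7 ^ 0 * (eps ^ 1 * tau ^ 1) + of_int (2) * 7 ^ 2 * (eps ^ 2 * tau ^ 0) + of_int (128) * 7 ^ 0 * (eps ^ 0 * tau ^ 1) + of_int (-18) * 7 ^ 2 * (eps ^ 1 * tau ^ 0) + of_int (9) * 7 ^ 2 * (eps ^ 0 * tau ^ 0)" by (simp add: init_fr2)
    also have "\<dots> \<in> Fil 0 (-6) (-21)" by (intro Fil_add Fil_eps_tau) simp_all
    finally show ?thesis .
  qed
  ultimately show "fr2 k \<in> Fil 0 (6 + 2*k) (-9 + 2*k)" by auto
qed (use rec in auto)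

text \<open>The weight is attained by 48*tau at k = -6, the exponent bound by the quadratic terms at
  k = -5.\<close>

lemma Fil_fs: "- 6 \<le> k \<Longrightarrow> fs k \<in> Fil 0 (5 + 2*k) (-4 + 2*k)"
proof (rule Fil_recurrent[where c = "\<lambda>k. 0"])
  fix k :: int
  assume "- 6 \<le> k" "k \<le> 0"
  hence "k \<in> {- 6, - 5, - 4, - 3, - 2, - 1, 0}" by auto
  moreover have "fs (0) \<in> Fil 0 (5) (-4)"
  proof -
    have "fs (0) = of_int (1) * 7 ^ 0 * (eps ^ 0 * tau ^ 0)" by (simp add: init_fs)
    also have "\<dots> \<in> Fil 0 (5) (-4)" by (intro Fil_add Fil_eps_tau) simp_all
    finally show ?thesis .
  qed
  moreover have "fs (-1) \<in> Fil 0 (3) (-6)"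
  proof -
    have "fs (-1) = of_int (1) * 7 ^ 0 * (eps ^ 0 * tau ^ 0)" by (simp add: init_fs)
    also have "\<dots> \<in> Fil 0 (3) (-6)" by (intro Fil_add Fil_eps_tau) simp_all
    finally show ?thesis .
  qed
  moreover have "fs (-2) \<in> Fil 0 (1) (-8)"
  proof -
    have "fs (-2) = of_int (2) * 7 ^ 0 * (eps ^ 0 * tau ^ 1) + of_int (-2) * 7 ^ 0 * (eps ^ 1 * tau ^ 0) + of_int (9) * 7 ^ 0 * (eps ^ 0 * tau ^ 0)" by (simp add: init_fs)
    also have "\<dots> \<in> Fil 0 (1) (-8)" by (intro Fil_add Fil_eps_tau) simp_all
    finally show ?thesis .
  qed
  moreover have "fs (-3) \<in> Fil 0 (-1) (-10)"
  proof -
    have "fs (-3) = of_int (8) * 7 ^ 0 * (eps ^ 0 * tau ^ 1) + of_int (-1) * 7 ^ 1 * (eps ^ 1 * tau ^ 0) + of_int (1) * 7 ^ 2 * (eps ^ 0 * tau ^ 0)" by (simp add: init_fs)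
    also have "\<dots> \<in> Fil 0 (-1) (-10)" by (intro Fil_add Fil_eps_tau) simp_all
    finally show ?thesis .
  qed
  moreover have "fs (-4) \<in> Fil 0 (-3) (-12)"
  proof -
    have "fs (-4) = of_int (8) * 7 ^ 0 * (eps ^ 0 * tau ^ 1) + of_int (-2) * 7 ^ 1 * (eps ^ 1 * tau ^ 0) + of_int (9) * 7 ^ 1 * (eps ^ 0 * tau ^ 0)" by (simp add: init_fs)
    also have "\<dots> \<in> Fil 0 (-3) (-12)" by (intro Fil_add Fil_eps_tau) simp_all
    finally show ?thesis .
  qed
  moreover have "fs (-5) \<in> Fil 0 (-5) (-14)"
  proof -
    have "fs (-5) = of_int (1) * 7 ^ 0 * (eps ^ 0 * tau ^ 2) + of_int (-1) * 7 ^ 0 * (eps ^ 1 * tau ^ 1) + of_int (29) * 7 ^ 0 * (eps ^ 0 * tau ^ 1) + of_int (-1) * 7 ^ 2 * (eps ^ 1 * tau ^ 0) + of_int (2) * 7 ^ 2 * (eps ^ 0 * tau ^ 0)" by (simp add: init_fs)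
    also have "\<dots> \<in> Fil 0 (-5) (-14)" by (intro Fil_add Fil_eps_tau) simp_all
    finally show ?thesis .
  qed
  moreover have "fs (-6) \<in> Fil 0 (-7) (-16)"
  proof -
    have "fs (-6) = of_int (-8) * 7 ^ 0 * (eps ^ 0 * tau ^ 2) + of_int (8) * 7 ^ 0 * (eps ^ 1 * tau ^ 1) + of_int (48) * 7 ^ 0 * (eps ^ 0 * tau ^ 1) + of_int (-2) * 7 ^ 2 * (eps ^ 1 * tau ^ 0) + of_int (9) * 7 ^ 2 * (eps ^ 0 * tau ^ 0)" by (simp add: init_fs)
    also have "\<dots> \<in> Fil 0 (-7) (-16)" by (intro Fil_add Fil_eps_tau) simp_all
    finally show ?thesis .
  qed
  ultimately show "fs k \<in> Fil 0 (5 + 2*k) (-4 + 2*k)" by auto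
qed (use rec in auto)

text \<open>Class 5 is that of k = -2 with value -7; \<open>U2\<close> reads \<open>fs2\<close> at
  4*i + 5, hence in this class for i = 0. At k = -3 the constant 48 attains the weight and the
  quadratic terms the exponent bound.\<close>

lemma Fil_fs2: "- 6 \<le> k \<Longrightarrow> fs2 k \<in> Fil (if k mod 7 = 5 then 1 else 0) (6 + 2*k) (-8 + 2*k)"
proof (rule Fil_recurrent[where c = "\<lambda>k. (if k mod 7 = 5 then 1 else 0)"])
  fix k :: int
  assume "- 6 \<le> k" "k \<le> 0"
  hence "k \<in> {- 6, - 5, - 4, - 3, - 2, - 1, 0}" by auto
  moreover have "fs2 (0) \<in> Fil 0 (6) (-8)"
  proof -
    have "fs2 (0) = of_int (1) * 7 ^ 0 * (eps ^ 0 * tau ^ 0)" by (simp add: init_fs2)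
    also have "\<dots> \<in> Fil 0 (6) (-8)" by (intro Fil_add Fil_eps_tau) simp_all
    finally show ?thesis .
  qed
  moreover have "fs2 (-1) \<in> Fil 0 (4) (-10)"
  proof -
    have "fs2 (-1) = of_int (-2) * 7 ^ 0 * (eps ^ 0 * tau ^ 1) + of_int (2) * 7 ^ 0 * (eps ^ 1 * tau ^ 0) + of_int (-9) * 7 ^ 0 * (eps ^ 0 * tau ^ 0)" by (simp add: init_fs2)
    also have "\<dots> \<in> Fil 0 (4) (-10)" by (intro Fil_add Fil_eps_tau) simp_all
    finally show ?thesis .
  qed
  moreover have "fs2 (-2) \<in> Fil 1 (2) (-12)"
  proof -
    have "fs2 (-2) = of_int (-1) * 7 ^ 1 * (eps ^ 0 * tau ^ 0)" by (simp add: init_fs2)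
    also have "\<dots> \<in> Fil 1 (2) (-12)" by (intro Fil_add Fil_eps_tau) simp_all
    finally show ?thesis .
  qed
  moreover have "fs2 (-3) \<in> Fil 0 (0) (-14)"
  proof -
    have "fs2 (-3) = of_int (-1) * 7 ^ 0 * (eps ^ 0 * tau ^ 2) + of_int (2) * 7 ^ 0 * (eps ^ 1 * tau ^ 1) + of_int (-1) * 7 ^ 0 * (eps ^ 2 * tau ^ 0) + of_int (3) * 7 ^ 0 * (eps ^ 0 * tau ^ 1) + of_int (2) * 7 ^ 0 * (eps ^ 1 * tau ^ 0) + of_int (48) * 7 ^ 0 * (eps ^ 0 * tau ^ 0)" by (simp add: init_fs2)
    also have "\<dots> \<in> Fil 0 (0) (-14)" by (intro Fil_add Fil_eps_tau) simp_all
    finally show ?thesis .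
  qed
  moreover have "fs2 (-4) \<in> Fil 0 (-2) (-16)"
  proof -
    have "fs2 (-4) = of_int (1) * 7 ^ 2 * (eps ^ 0 * tau ^ 0)" by (simp add: init_fs2)
    also have "\<dots> \<in> Fil 0 (-2) (-16)" by (intro Fil_add Fil_eps_tau) simp_all
    finally show ?thesis .
  qed
  moreover have "fs2 (-5) \<in> Fil 0 (-4) (-18)"
  proof -
    have "fs2 (-5) = of_int (26) * 7 ^ 0 * (eps ^ 0 * tau ^ 2) + of_int (-40) * 7 ^ 0 * (eps ^ 1 * tau ^ 1) + of_int (2) * 7 ^ 1 * (eps ^ 2 * tau ^ 0) + of_int (250) * 7 ^ 0 * (eps ^ 0 * tau ^ 1) + of_int (-32) * 7 ^ 1 * (eps ^ 1 * tau ^ 0) + of_int (79) * 7 ^ 1 * (eps ^ 0 * tau ^ 0)" by (simp add: init_fs2)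
    also have "\<dots> \<in> Fil 0 (-4) (-18)" by (intro Fil_add Fil_eps_tau) simp_all
    finally show ?thesis .
  qed
  moreover have "fs2 (-6) \<in> Fil 0 (-6) (-20)"
  proof -
    have "fs2 (-6) = of_int (64) * 7 ^ 0 * (eps ^ 0 * tau ^ 2) + of_int (-16) * 7 ^ 1 * (eps ^ 1 * tau ^ 1) + of_int (1) * 7 ^ 2 * (eps ^ 2 * tau ^ 0) + of_int (128) * 7 ^ 1 * (eps ^ 0 * tau ^ 1) + of_int (-16) * 7 ^ 2 * (eps ^ 1 * tau ^ 0) + of_int (57) * 7 ^ 2 * (eps ^ 0 * tau ^ 0)" by (simp add: init_fs2)
    also have "\<dots> \<in> Fil 0 (-6) (-20)" by (intro Fil_add Fil_eps_tau) simp_all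
    finally show ?thesis .
  qed
  ultimately show "fs2 k \<in> Fil (if k mod 7 = 5 then 1 else 0) (6 + 2*k) (-8 + 2*k)" by auto
qed (use rec in auto)

lemma U1_0: "U1 0 = 0" and U2_0: "U2 0 = 0"
  using U1_diff[of 0 0] U2_diff[of 0 0] by simp_all

lemma U1_of_nat_mult: "U1 (of_nat n * f) = of_nat n * U1 f"
proof (induction n)
  case (Suc n)
  have "U1 (of_nat n * f - (0 - f)) = U1 (of_nat n * f) - (0 - U1 f)"
    unfolding U1_diff U1_0 ..
  thus ?case using Suc by (simp add: algebra_simps)
qed (simp add: U1_0)

lemma U2_of_nat_mult: "U2 (of_nat n * f) = of_nat n * U2 f"
proof (induction n)
  case (Suc n)
  have "U2 (of_nat n * f - (0 - f)) = U2 (of_nat n * f) - (0 - U2 f)"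
    unfolding U2_diff U2_0 ..
  thus ?case using Suc by (simp add: algebra_simps)
qed (simp add: U2_0)

lemma U_7_power_mult: "U1 (7 ^ e * f) = 7 ^ e * U1 f" "U2 (7 ^ e * f) = 7 ^ e * U2 f"
  using U1_of_nat_mult[of "7 ^ e" f] U2_of_nat_mult[of "7 ^ e" f] by simp_all

lemma Fil_t_power: "t powi i \<in> Fil 0 (7*i) (7*i)"
  using Fil_gen[of 0 0 i 0 "7*i" "7*i" 1] by simp

lemma Fil_theta: "8*tau + 56 - 7*eps \<in> Fil 0 (-4) (-7)"
proof -
  have "8*tau + 56 - 7*eps = of_int 8 * 7^0 * (eps^0 * tau^1) + of_int 8 * 7^1 * (eps^0 * tau^0) + of_int (-1) * 7^1 * (eps^1 * tau^0)"
    by simp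
  also have "\<dots> \<in> Fil 0 (-4) (-7)" by (intro Fil_add Fil_eps_tau) simp_all
  finally show ?thesis .
qed

lemma Fil_theta2: "(8*tau + 56 - 7*eps)^2 \<in> Fil 0 (-8) (-14)"
  unfolding power2_eq_square by (rule Fil_mult'[OF Fil_theta Fil_theta]) auto

text \<open>The factor t^(-i) contributes weight -7*i and a sequence at 4*i contributes 8*i: the
  image grows by 1 for each power of \<open>t\<close>, the source by 7, and this contraction leaves
  the room needed below. The index 4*i lies in a class with a factor 7 for i = 1 and i = 2, and 4*i
  + 5 for i = 1.\<close>

lemma Fil_U1:
  assumes "i \<ge> 1"
  shows "U1 (t powi i) \<in> Fil (if i = 1 \<or> i = 2 then 1 else 0) (4 + i) i" (is ?A)
    and "U1 (t powi i * H) \<in> Fil (if i = 1 then 1 else 0) (14 + i) (i - 3)" (is ?B)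
    and "U1 (t powi i * H^2) \<in> Fil 0 (18 + i) (i - 3)" (is ?C)
proof -
  show ?A unfolding U1_gen
    by (rule Fil_mult'[OF Fil_t_power Fil_f1]) (use assms in auto)
  have "t powi (- i) * fr (4*i + 5) \<in> Fil (if i = 1 then 1 else 0) (18 + i) (4 + i)"
    by (rule Fil_mult'[OF Fil_t_power Fil_fr]) (use assms in auto)
  thus ?B unfolding U1_gen
    by (intro Fil_minus Fil_mult'[OF Fil_theta]) auto
  have "t powi (- i) * fr2 (4*i + 10) \<in> Fil 0 (26 + i) (11 + i)"
    by (rule Fil_mult'[OF Fil_t_power Fil_fr2]) (use assms in auto)
  thus ?C unfolding U1_gen
    by (intro Fil_mult'[OF Fil_theta2]) auto
qed

text \<open>The same bookkeeping as for \<open>U1\<close>. The case i = 0 of the first claim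
  supplies the initial factor 7.\<close>

lemma Fil_U2:
  assumes "i \<ge> 0"
  shows "U2 (t powi i) \<in> Fil (if i = 0 then 1 else 0) (16 + i) (i + 2)" (is ?A)
    and "U2 (t powi i * H) \<in> Fil 0 (17 + i) (i + 5)" (is ?B)
    and "U2 (t powi i * H^2) \<in> Fil 0 (18 + i) (i + 8)" (is ?C)
proof -
  show ?A unfolding U2_gen
    by (intro Fil_minus Fil_mult'[OF Fil_t_power Fil_fs2]) (use assms in auto)
  have "t powi (- i) * fs (4*i + 8) \<in> Fil 0 (21 + i) (12 + i)"
    by (rule Fil_mult'[OF Fil_t_power Fil_fs]) (use assms in auto)
  thus ?B unfolding U2_gen
    by (intro Fil_minus Fil_mult'[OF Fil_theta]) auto
  have "t powi (- i) * f1 (4*i + 11) \<in> Fil 0 (26 + i) (22 + i)"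
    by (rule Fil_mult'[OF Fil_t_power Fil_f1]) (use assms in auto)
  thus ?C unfolding U2_gen
    by (intro Fil_minus Fil_mult'[OF Fil_theta2]) auto
qed

text \<open>Exponents of \<open>t\<close> are integers, so 7*i >= d > 7*m - 7 already means i >=
  m.\<close>

lemma Fil_round: "f \<in> Fil c w d \<Longrightarrow> d > 7 * m - 7 \<Longrightarrow> f \<in> Fil c w (7 * m)"
proof (induction rule: Fil_induct)
  case (gen e i j)
  have "7 * m \<le> 7 * i" using gen by presburger
  thus ?case using Fil_gen[of c e i j w "7 * m" 1] gen by simp
qed (auto intro: Fil_diff)

text \<open>A term with no spare factor 7 satisfies 7*(i+j) <= 20 and i >= 1, hence is t, t^2 or t*H
  up to the power of 7, and on these \<open>Fil_U1\<close> supplies the factor. Any other term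
  already has a spare 7. The new weight is 15 - 4*c = 19 - 4*(c+1), the bound from which
  \<open>U2_step\<close> starts.\<close>

lemma U1_step:
  assumes "f \<in> Fil c (20 - 4 * int c) 7"
  shows "U1 f \<in> Fil (Suc c) (15 - 4 * int c) 0"
  using assms
proof (induction rule: Fil_induct)
  case (gen e i j)
  have i: "i \<ge> 1" using gen by simp
  obtain m where m: "e = c + m" using gen(2) le_Suc_ex by blast
  have m4: "7 * (i + int j) - 20 \<le> 4 * int m" using gen(3) by (simp add: m)
  obtain c' w' d' where U: "U1 (t powi i * H^j) \<in> Fil c' w' d'" and
    c': "Suc c \<le> e + c'" and w': "w' - 4 * int e \<le> 15 - 4 * int c" and d': "d' > - 7"
  proof -
    consider "j = 0" | "j = 1" | "j = 2" using gen by linarith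
    thus ?thesis
    proof cases
      case 1
      show ?thesis
      proof (rule that)
        show "U1 (t powi i * H^j) \<in> Fil (if i = 1 \<or> i = 2 then 1 else 0) (4 + i) (i)" using 1 Fil_U1(1)[OF i] by simp
        show "Suc c \<le> e + (if i = 1 \<or> i = 2 then 1 else 0)" using 1 m4 i unfolding m by (cases "i = 1"; cases "i = 2"; simp; presburger)
        have "4 + i - 4 * int m \<le> 15" using m4 i unfolding 1 by presburger
        thus "4 + i - 4 * int e \<le> 15 - 4 * int c" by (simp add: m)
      qed (use i in simp)
    next
      case 2
      show ?thesis
      proof (rule that)
        show "U1 (t powi i * H^j) \<in> Fil (if i = 1 then 1 else 0) (14 + i) (i - 3)" using 2 Fil_U1(2)[OF i] by simp
        show "Suc c \<le> e + (if i = 1 then 1 else 0)" using 2 m4 i unfolding m by (cases "i = 1"; cases "i = 2"; simp; presburger)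
        have "14 + i - 4 * int m \<le> 15" using m4 i unfolding 2 by presburger
        thus "14 + i - 4 * int e \<le> 15 - 4 * int c" by (simp add: m)
      qed (use i in simp)
    next
      case 3
      show ?thesis
      proof (rule that)
        show "U1 (t powi i * H^j) \<in> Fil (0) (18 + i) (i - 3)" using 3 Fil_U1(3)[OF i] by simp
        show "Suc c \<le> e + (0)" using 3 m4 i unfolding m by (cases "i = 1"; cases "i = 2"; simp; presburger)
        have "18 + i - 4 * int m \<le> 15" using m4 i unfolding 3 by presburger
        thus "18 + i - 4 * int e \<le> 15 - 4 * int c" by (simp add: m)
      qed (use i in simp)
    qed
  qed
  have "7 ^ e * U1 (t powi i * H^j) \<in> Fil (Suc c) (15 - 4 * int c) d'"
    using Fil_mono[OF Fil_7_power_mult[OF U, of e] c' w'] by simp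
  from Fil_round[OF this, of 0] show ?case using d' by (simp add: U_7_power_mult)
next
  case (diff f g)
  thus ?case by (simp add: U1_diff Fil_diff)
qed

text \<open>No factor 7 is gained here. The operator restores what \<open>U1\<close> loses, a
  positive exponent of \<open>t\<close>: the lower bounds i + 2, i + 5, i + 8 are positive and round
  up to 7.\<close>

lemma U2_step:
  assumes "f \<in> Fil c (19 - 4 * int c) 0"
  shows "U2 f \<in> Fil c (20 - 4 * int c) 7"
  using assms
proof (induction rule: Fil_induct)
  case (gen e i j)
  have i: "i \<ge> 0" using gen by simp
  obtain m where m: "e = c + m" using gen(2) le_Suc_ex by blast
  have m4: "7 * (i + int j) - 19 \<le> 4 * int m" using gen(3) by (simp add: m)
  obtain w' d' where U: "U2 (t powi i * H^j) \<in> Fil 0 w' d'" and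
    w': "w' - 4 * int e \<le> 20 - 4 * int c" and d': "d' > 0"
  proof -
    consider "j = 0" | "j = 1" | "j = 2" using gen by linarith
    thus ?thesis
    proof cases
      case 1
      show ?thesis
      proof (rule that)
        show "U2 (t powi i * H^j) \<in> Fil 0 (16 + i) (i + 2)" using 1 Fil_mono[OF Fil_U2(1)[OF i]] by simp
        have "16 + i - 4 * int m \<le> 20" using m4 i unfolding 1 by presburger
        thus "16 + i - 4 * int e \<le> 20 - 4 * int c" by (simp add: m)
      qed (use i in simp)
    next
      case 2
      show ?thesis
      proof (rule that)
        show "U2 (t powi i * H^j) \<in> Fil 0 (17 + i) (i + 5)" using 2 Fil_U2(2)[OF i] by simp
        have "17 + i - 4 * int m \<le> 20" using m4 i unfolding 2 by presburger
        thus "17 + i - 4 * int e \<le> 20 - 4 * int c" by (simp add: m)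
      qed (use i in simp)
    next
      case 3
      show ?thesis
      proof (rule that)
        show "U2 (t powi i * H^j) \<in> Fil 0 (18 + i) (i + 8)" using 3 Fil_U2(3)[OF i] by simp
        have "18 + i - 4 * int m \<le> 20" using m4 i unfolding 3 by presburger
        thus "18 + i - 4 * int e \<le> 20 - 4 * int c" by (simp add: m)
      qed (use i in simp)
    qed
  qed
  have "7 ^ e * U2 (t powi i * H^j) \<in> Fil c (20 - 4 * int c) d'"
    using Fil_mono[OF Fil_7_power_mult[OF U, of e] _ w'] gen by simp
  from Fil_round[OF this, of 1] show ?case using d' by (simp add: U_7_power_mult)
next
  case (diff f g)
  thus ?case by (simp add: U2_diff Fil_diff)
qed

definition L :: "nat \<Rightarrow> 'a" where
  "L a = ((U1 \<circ> U2) ^^ a) 1"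

text \<open>The constant 1 lies outside the pattern, but its image under \<open>U2\<close> has a
  factor 7 because fs2 5 does. Afterwards each application of \<open>U1\<close> adds exactly one to
  the recorded power.\<close>

lemma L_Fil: "U2 (L a) \<in> Fil (Suc a) (20 - 4 * int (Suc a)) 7 \<and> L (Suc a) \<in> Fil (Suc (Suc a)) (19 - 4 * int (Suc (Suc a))) 0"
proof -
  have S: "L (Suc a) = U1 (U2 (L a))" for a by (simp add: L_def)
  have step: "U2 (L a) \<in> Fil (Suc a) (20 - 4 * int (Suc a)) 7 \<Longrightarrow> L (Suc a) \<in> Fil (Suc (Suc a)) (19 - 4 * int (Suc (Suc a))) 0" for a
    unfolding S by (drule U1_step) simp
  show ?thesis
  proof (induction a)
    case 0
    have "U2 1 \<in> Fil 1 16 2" using Fil_U2(1)[of 0] by simp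
    from Fil_round[OF this, of 1] have "U2 (L 0) \<in> Fil (Suc 0) (20 - 4 * int (Suc 0)) 7"
      by (simp add: L_def)
    thus ?case using step by blast
  next
    case (Suc a)
    hence "U2 (L (Suc a)) \<in> Fil (Suc (Suc a)) (20 - 4 * int (Suc (Suc a))) 7"
      using U2_step by blast
    thus ?case using step by blast
  qed
qed

text \<open>For d >= 0 no negative power of \<open>t\<close> remains, so after division by 7^c a
  generator stays in any subring containing \<open>t\<close> and \<open>H\<close>.\<close>

lemma Fil_dvd:
  assumes "f \<in> Fil c w d" "d \<ge> 0" and I: "t \<in> I" "H \<in> I" "1 \<in> I"
    "\<And>a b. a \<in> I \<Longrightarrow> b \<in> I \<Longrightarrow> a * b \<in> I" "\<And>a b. a \<in> I \<Longrightarrow> b \<in> I \<Longrightarrow> a - b \<in> I"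
  shows "\<exists>g\<in>I. f = 7 ^ c * g"
  using assms(1)
proof (induction rule: Fil_induct)
  case (gen e i j)
  have pow: "a \<in> I \<Longrightarrow> a ^ n \<in> I" for a n using I by (induction n) auto
  have "0 \<in> I" using I(5)[OF I(3) I(3)] by simp
  hence neg: "a \<in> I \<Longrightarrow> - a \<in> I" for a using I(5)[of 0 a] by simp
  have "of_nat n \<in> I" for n
  proof (induction n)
    case (Suc n)
    thus ?case using I(5)[OF Suc neg[OF I(3)]] by (simp add: add.commute)
  qed (use \<open>0 \<in> I\<close> in simp)
  from this[of 7] have 7: "7 \<in> I" by simp
  have "7 ^ e * (t powi i * H ^ j) = 7 ^ c * (7 ^ (e - c) * (t ^ nat i * H ^ j))"
    using gen assms(2) by (simp add: power_int_def flip: power_add mult.assoc)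
  moreover have "7 ^ (e - c) * (t ^ nat i * H ^ j) \<in> I" by (intro I(4) pow 7 I(1,2))
  ultimately show ?case by blast
next
  case (diff f g)
  then obtain a b where "a \<in> I" "b \<in> I" "f = 7 ^ c * a" "g = 7 ^ c * b" by blast
  thus ?case using I(5)[of a b] by (intro bexI[of _ "a - b"]) (auto simp: right_diff_distrib)
qed

end

subsection \<open>Dissections of theta series\<close>

lemma agree_compose_X_power:
  assumes "agree n f g" "d > 0"
  shows "agree n (f oo fps_X ^ d) (g oo fps_X ^ d)"
  using assms by (auto simp: agree_def fps_nth_compose_X_power intro: order_trans[OF div_le_dividend])

lemma euler_compose_X_power:
  assumes "d > 0"
  shows "euler S oo fps_X ^ d = (euler ((*) d ` S) :: 'a::idom fps)"
proof (rule agree_all_imp_eq)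
  fix n
  let ?A = "S \<inter> {1..n}"
  have "agree n (euler S oo fps_X ^ d) ((\<Prod>m\<in>?A. 1 - fps_X ^ m) oo (fps_X ^ d :: 'a fps))"
    by (intro agree_compose_X_power agree_euler_atMost assms)
  also have "(\<Prod>m\<in>?A. 1 - fps_X ^ m) oo fps_X ^ d = (\<Prod>m\<in>?A. 1 - (fps_X ^ d :: 'a fps) ^ m)"
    using assms by (simp add: fps_compose_prod_distrib fps_compose_sub_distrib fps_compose_power[symmetric])
  also have "\<dots> = (\<Prod>m\<in>(*) d ` ?A. 1 - fps_X ^ m)"
    using assms by (subst prod.reindex) (auto simp: inj_on_def power_mult)
  finally have 1: "agree n (euler S oo fps_X ^ d) (\<Prod>m\<in>(*) d ` ?A. 1 - fps_X ^ m :: 'a fps)" .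
  have "agree n (euler ((*) d ` S)) (\<Prod>m\<in>(*) d ` ?A. 1 - fps_X ^ m :: 'a fps)"
  proof (rule agree_euler)
    show "(*) d ` S \<inter> {1..n} \<subseteq> (*) d ` ?A"
    proof
      fix m assume m: "m \<in> (*) d ` S \<inter> {1..n}"
      then obtain k where k: "m = d * k" "k \<in> S" by auto
      have "k \<le> d * k" using assms by simp
      hence "k \<in> ?A" using k m by (cases k) auto
      thus "m \<in> (*) d ` ?A" using k by blast
    qed
  qed (use assms in auto)
  thus "agree n (euler S oo fps_X ^ d) (euler ((*) d ` S) :: 'a fps)"
    using 1 agree_sym agree_trans by metis
qed

lemma euler_multiples_compose:
  "d > 0 \<Longrightarrow> (euler {m. k dvd m} oo fps_X ^ d :: 'a::idom fps) = euler {m. d * k dvd m}"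
proof -
  assume d: "d > 0"
  have "(*) d ` {m. k dvd m} = {m. d * k dvd m}"
  proof (intro equalityI subsetI)
    fix m assume "m \<in> {m. d * k dvd m}"
    then obtain l where "m = d * k * l" by (auto elim: dvdE)
    hence "m = d * (k * l)" by simp
    thus "m \<in> (*) d ` {m. k dvd m}" by (intro image_eqI[of _ _ "k * l"]) auto
  qed auto
  thus ?thesis using euler_compose_X_power[OF d, of "{m. k dvd m}"] by simp
qed

lemma euler_49: "(euler {m. 1 dvd m} oo fps_X ^ 49 :: 'a::idom fps) = euler {m. 49 dvd m}"
  using euler_multiples_compose[of 49 1, OF zero_less_numeral] by (simp only: mult_1_right)

section \<open>Pentagonal numbers: components of J_1\<close>

lemma mod_classes_3: "{m::nat. 3 dvd m} \<union> ({m. m mod 3 = 1} \<union> {m. m mod 3 = 3 - 1}) = {m. 1 dvd m}"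
  by (auto simp: dvd_eq_mod_eq_0)

lemma pentagonal:
  "fps_nth (euler {m. 1 dvd m} :: 'a::idom fps) N = (\<Sum>j | theta_exp 3 1 j = N. msign j)"
proof -
  have "euler {m. 1 dvd m} = euler {m. 3 dvd m} * (euler {m. m mod 3 = 1} * euler {m. m mod 3 = 3 - 1} :: 'a fps)"
    unfolding mod_classes_3[symmetric] by (subst euler_Un, force simp: dvd_eq_mod_eq_0, subst euler_Un) auto
  thus ?thesis using jacobi_triple_product[of 1 3 N, where 'a = 'a] by simp
qed

lemma theta_exp_pentagonal: "2 * int (theta_exp 3 1 j) = 3 * (j * (j - 1)) + 2 * j"
  and theta_exp_triangular: "2 * int (theta_exp 1 0 j) = j * (j - 1)"
  and theta_exp_square: "int (theta_exp 2 1 j) = j * j"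
  using theta_exp_double[of 1 3 j] theta_exp_double[of 0 1 j] theta_exp_double[of 1 2 j]
  by (simp_all add: algebra_simps del: One_nat_def)

lemma msign_7_diff: "msign (7 * i - 1) = - msign i" "msign (7 * i - 3) = - msign i" "msign (7 * i) = msign i"
   "msign (7 * i + int c) = (- 1) ^ c * msign i" "msign (1 - i) = - msign i" "msign (- i) = msign i"
  by (auto simp: msign_def)

lemma int_mod_7_cases:
  obtains i c where "j = 7 * i + c" "c \<in> {0, 1, 2, 3, 4, 5, 6 :: int}"
proof -
  have "j = 7 * (j div 7) + j mod 7" "j mod 7 \<in> {0..6}" by auto
  moreover have "{0..6} = {0, 1, 2, 3, 4, 5, 6 :: int}" by auto
  ultimately show ?thesis using that by metis
qed

text \<open>As 24*N + 1 = (6*j - 1)^2, class 2 is the one where 7 divides 6*j - 1, and it therefore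
  comes from a single class of j. The factor 4 in the computation is the inverse of 2 modulo
  7.\<close>

lemma pentagonal_residue:
  assumes "theta_exp 3 1 j = N"
  shows "N mod 7 \<in> {0, 1, 2, 5}" and "N mod 7 = 2 \<Longrightarrow> \<exists>i. j = 7 * i - 1"
proof -
  obtain i c where j: "j = 7 * i + c" and c: "c \<in> {0, 1, 2, 3, 4, 5, 6 :: int}" by (rule int_mod_7_cases)
  define k where "k = 21 * i * i + 6 * i * c - i"
  have "2 * int N = 7 * k + (3 * (c * (c - 1)) + 2 * c)"
    using theta_exp_pentagonal[of j, unfolded assms] unfolding j k_def by (simp add: algebra_simps)
  hence *: "int N = 7 * (4 * k - int N) + 4 * (3 * (c * (c - 1)) + 2 * c)" by simp
  have "int N mod 7 = (4 * (3 * (c * (c - 1)) + 2 * c)) mod 7" by (subst *, rule mod_mult_self4)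
  hence "int N mod 7 \<in> {0, 1, 2, 5} \<and> (int N mod 7 = 2 \<longrightarrow> c = 6)" using c by auto
  hence "int (N mod 7) \<in> {0, 1, 2, 5} \<and> (int (N mod 7) = 2 \<longrightarrow> c = 6)" by (simp add: zmod_int)
  thus "N mod 7 \<in> {0, 1, 2, 5}" "N mod 7 = 2 \<Longrightarrow> \<exists>i. j = 7 * i - 1"
    using j by (auto intro: exI[of _ "i + 1"])
qed

lemma pentagonal_class_0:
  "N mod 7 \<notin> {0, 1, 2, 5} \<Longrightarrow> fps_nth (euler {m. 1 dvd m} :: 'a::idom fps) N = 0"
  unfolding pentagonal using pentagonal_residue(1) by (intro sum.neutral) blast

lemma nth_X_compose_49:
  "fps_nth (fps_X ^ c * (f oo fps_X ^ 49)) N = (if c \<le> N \<and> 49 dvd N - c then fps_nth f ((N - c) div 49) else 0)"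
  for f :: "'a::idom fps"
  by (auto simp: fps_X_power_mult_nth fps_nth_compose_X_power)

text \<open>If all j contributing to N lie on a progression along which the exponent becomes 49
  times a theta exponent plus c, then the component is X^c times a theta series at X^49.\<close>

lemma theta_49:
  fixes \<omega> :: "int \<Rightarrow> 'a::idom"
  assumes "\<And>j. theta_exp b a j = N \<Longrightarrow> \<exists>i. j = h i"
    and "\<And>i. theta_exp b a (h i) = 49 * theta_exp b' a' i + c" and "inj h"
  shows "(\<Sum>j | theta_exp b a j = N. \<omega> j) =
    (if c \<le> N \<and> 49 dvd N - c then (\<Sum>i | theta_exp b' a' i = (N - c) div 49. \<omega> (h i)) else 0)"
proof -
  have "{j. theta_exp b a j = N} = h ` {i. 49 * theta_exp b' a' i + c = N}"
  proof (intro equalityI subsetI)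
    fix j assume "j \<in> {j. theta_exp b a j = N}"
    with assms(1) obtain i where "j = h i" "theta_exp b a (h i) = N" by blast
    thus "j \<in> h ` {i. 49 * theta_exp b' a' i + c = N}" using assms(2)[of i] by auto
  qed (use assms(2) in auto)
  hence "(\<Sum>j | theta_exp b a j = N. \<omega> j) = (\<Sum>i | 49 * theta_exp b' a' i + c = N. \<omega> (h i))"
    using assms(3) by (simp add: sum.reindex inj_on_subset[OF assms(3)])
  moreover have "{i. 49 * theta_exp b' a' i + c = N} =
      (if c \<le> N \<and> 49 dvd N - c then {i. theta_exp b' a' i = (N - c) div 49} else {})"
    by auto
  ultimately show ?thesis by simp
qed

lemma pentagonal_class_2:
  assumes "N mod 7 = 2"
  shows "fps_nth (euler {m. 1 dvd m} :: 'a::idom fps) N = fps_nth (- (fps_X ^ 2 * euler {m. 49 dvd m})) N"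
proof -
  have h: "theta_exp 3 1 (7 * i - 1) = 49 * theta_exp 3 1 i + 2" for i
    using theta_exp_pentagonal[of "7 * i - 1"] theta_exp_pentagonal[of i]
    by (simp add: algebra_simps del: One_nat_def)
  have "fps_nth (euler {m. 1 dvd m} :: 'a fps) N = (if 2 \<le> N \<and> 49 dvd N - 2 then
      (\<Sum>i | theta_exp 3 1 i = (N - 2) div 49. msign (7 * i - 1)) else 0)"
    unfolding pentagonal
    by (rule theta_49) (use pentagonal_residue(2) assms h in \<open>auto simp: inj_def\<close>)
  also have "\<dots> = fps_nth (- (fps_X ^ 2 * (euler {m. 1 dvd m} oo fps_X ^ 49))) N"
    unfolding fps_neg_nth nth_X_compose_49 pentagonal by (simp add: msign_7_diff sum_negf)
  finally show ?thesis unfolding euler_49 .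
qed

section \<open>Triangular numbers: components of the cube of J_1\<close>

lemma triangular_residue:
  assumes "theta_exp 1 0 j = N"
  shows "N mod 7 \<in> {0, 1, 3, 6}" and "N mod 7 = 6 \<Longrightarrow> \<exists>i. j = 7 * i - 3"
proof -
  obtain i c where j: "j = 7 * i + c" and c: "c \<in> {0, 1, 2, 3, 4, 5, 6 :: int}" by (rule int_mod_7_cases)
  define k where "k = 7 * i * i + 2 * i * c - i"
  have "2 * int N = 7 * k + c * (c - 1)"
    using theta_exp_triangular[of j, unfolded assms] unfolding j k_def by (simp add: algebra_simps)
  hence *: "int N = 7 * (4 * k - int N) + 4 * (c * (c - 1))" by simp
  have "int N mod 7 = (4 * (c * (c - 1))) mod 7" by (subst *, rule mod_mult_self4)
  hence "int N mod 7 \<in> {0, 1, 3, 6} \<and> (int N mod 7 = 6 \<longrightarrow> c = 4)" using c by auto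
  hence "int (N mod 7) \<in> {0, 1, 3, 6} \<and> (int (N mod 7) = 6 \<longrightarrow> c = 4)" by (simp add: zmod_int)
  thus "N mod 7 \<in> {0, 1, 3, 6}" "N mod 7 = 6 \<Longrightarrow> \<exists>i. j = 7 * i - 3"
    using j by (auto intro: exI[of _ "i + 1"])
qed

lemma cube_class_0:
  "N mod 7 \<notin> {0, 1, 3, 6} \<Longrightarrow> fps_nth (euler {m. 1 dvd m} ^ 3 :: 'a::idom fps) N = 0"
proof -
  assume "N mod 7 \<notin> {0, 1, 3, 6}"
  hence "{j. theta_exp 1 0 j = N} = {}" using triangular_residue(1) by blast
  thus ?thesis using jacobi_cube[of N, where 'a = 'a] by simp
qed

text \<open>On j = 7*i - 3 the weight j splits into 7*i and -3; the contribution of -3 cancels under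
  i -> 1 - i, and the factor 7 remains.\<close>

lemma cube_class_6:
  assumes "N mod 7 = 6"
  shows "fps_nth (euler {m. 1 dvd m} ^ 3 :: 'a::{idom,ring_char_0} fps) N = fps_nth (- 7 * (fps_X ^ 6 * euler {m. 49 dvd m} ^ 3)) N"
proof -
  have h: "theta_exp 1 0 (7 * i - 3) = 49 * theta_exp 1 0 i + 6" for i
    using theta_exp_triangular[of "7 * i - 3"] theta_exp_triangular[of i]
    by (simp add: algebra_simps del: One_nat_def)
  have E: "{m::nat. 1 dvd m} = UNIV" by auto
  have e: "euler {m. 49 dvd m} ^ 3 = (euler {m. 1 dvd m} ^ 3 oo fps_X ^ 49 :: 'a fps)"
    unfolding euler_49[symmetric] by (rule fps_compose_power) simp
  have sym: "(\<Sum>i | theta_exp 1 0 i = M. msign i) = (0 :: 'a)" for M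
  proof -
    have "theta_exp 1 0 (1 - i) = theta_exp 1 0 i" for i
      by (simp add: theta_exp_def algebra_simps)
    hence "(\<Sum>i | theta_exp 1 0 i = M. msign i) = (\<Sum>i | theta_exp 1 0 i = M. msign (1 - i) :: 'a)"
      by (intro sum.reindex_bij_witness[of _ "\<lambda>i. 1 - i" "\<lambda>i. 1 - i"]) auto
    hence "2 * (\<Sum>i | theta_exp 1 0 i = M. msign i) = (0 :: 'a)"
      by (simp add: msign_7_diff sum_negf)
    thus ?thesis by simp
  qed
  let ?M = "(N - 6) div 49"
  have w: "of_int (7 * i - 3) * msign (7 * i - 3) = - 7 * (of_int i * msign i) + 3 * msign i" for i :: int
    unfolding msign_7_diff by (simp add: algebra_simps)
  have "(\<Sum>i | theta_exp 1 0 i = ?M. of_int (7 * i - 3) * msign (7 * i - 3)) =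
      - 7 * (\<Sum>i | theta_exp 1 0 i = ?M. of_int i * msign i) + 3 * (\<Sum>i | theta_exp 1 0 i = ?M. msign i :: 'a)"
    unfolding w by (simp only: sum.distrib sum_distrib_left)
  hence S: "(\<Sum>i | theta_exp 1 0 i = ?M. of_int (7 * i - 3) * msign (7 * i - 3)) =
      - 7 * (\<Sum>i | theta_exp 1 0 i = ?M. of_int i * msign i :: 'a)"
    unfolding sym by simp
  have "fps_nth (euler {m. 1 dvd m} ^ 3 :: 'a fps) N = - (if 6 \<le> N \<and> 49 dvd N - 6 then
      (\<Sum>i | theta_exp 1 0 i = ?M. of_int (7 * i - 3) * msign (7 * i - 3)) else 0)"
    unfolding E jacobi_cube
    by (rule arg_cong[where f = uminus], rule theta_49)
       (use triangular_residue(2) assms h in \<open>auto simp: inj_def\<close>)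
  also have "\<dots> = - 7 * fps_nth (fps_X ^ 6 * (euler {m. 1 dvd m} ^ 3 oo fps_X ^ 49)) N"
    unfolding nth_X_compose_49 S E jacobi_cube by simp
  also have "\<dots> = fps_nth (- 7 * (fps_X ^ 6 * (euler {m. 1 dvd m} ^ 3 oo fps_X ^ 49))) N"
    by (simp add: numeral_fps_const)
  finally show ?thesis unfolding e .
qed

section \<open>Squares: components of J_1^2 / J_2\<close>

definition gauss_phi :: "'a::idom fps" where
  "gauss_phi = euler {m. 2 dvd m} * (euler {m. m mod 2 = 1} * euler {m. m mod 2 = 2 - 1})"

lemma gauss_phi_nth: "fps_nth gauss_phi N = (\<Sum>j | theta_exp 2 1 j = N. msign j)"
  unfolding gauss_phi_def by (rule jacobi_triple_product) auto

lemma gauss_phi_mult: "gauss_phi * euler {m. 2 dvd m} = euler {m. 1 dvd m} ^ 2"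
proof -
  have "{m::nat. 2 dvd m} \<union> {m. m mod 2 = 1} = {m. 1 dvd m}" by auto
  moreover have "euler ({m. 2 dvd m} \<union> {m. m mod 2 = 1}) = euler {m. 2 dvd m} * (euler {m. m mod 2 = 1} :: 'a fps)"
    by (rule euler_Un) auto
  ultimately have "euler {m. 1 dvd m} = euler {m. 2 dvd m} * (euler {m. m mod 2 = 1} :: 'a fps)" by simp
  moreover have "2 - 1 = (1::nat)" by simp
  ultimately show ?thesis unfolding gauss_phi_def by (simp only: power2_eq_square mult_ac)
qed

lemma square_residue:
  assumes "theta_exp 2 1 j = N"
  obtains i c where "j = 7 * i + c" "c \<in> {0, 1, 2, 3, 4, 5, 6}" "int N mod 7 = (c * c) mod 7"
proof -
  obtain i c where j: "j = 7 * i + c" and c: "c \<in> {0, 1, 2, 3, 4, 5, 6 :: int}" by (rule int_mod_7_cases)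
  have *: "int N = 7 * (7 * i * i + 2 * i * c) + c * c"
    using theta_exp_square[of j, unfolded assms] unfolding j by (simp add: algebra_simps)
  have "int N mod 7 = (c * c) mod 7" unfolding * by (rule mod_mult_self4)
  thus ?thesis using that j c by blast
qed

lemma gauss_phi_class_0:
  assumes "N mod 7 \<notin> {0, 1, 2, 4}"
  shows "fps_nth gauss_phi N = 0"
proof -
  have "{j. theta_exp 2 1 j = N} = {}"
  proof (rule equals0I)
    fix j assume "j \<in> {j. theta_exp 2 1 j = N}"
    then obtain c where "c \<in> {0, 1, 2, 3, 4, 5, 6 :: int}" "int N mod 7 = (c * c) mod 7"
      using square_residue by blast
    hence "int N mod 7 \<in> {0, 1, 2, 4}" by auto
    hence "int (N mod 7) \<in> {0, 1, 2, 4}" by (simp add: zmod_int)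
    thus False using assms by auto
  qed
  thus ?thesis by (simp add: gauss_phi_nth del: One_nat_def)
qed

lemma gauss_phi_class_7:
  assumes "N mod 7 = 0"
  shows "fps_nth gauss_phi N = fps_nth (gauss_phi oo fps_X ^ 49) N"
proof -
  have *: "\<exists>i. j = 7 * i" if j: "theta_exp 2 1 j = N" for j
  proof -
    obtain i c where ic: "j = 7 * i + c" "c \<in> {0, 1, 2, 3, 4, 5, 6}" "int N mod 7 = (c * c) mod 7"
      using square_residue[OF j] .
    have "int N mod 7 = 0" using assms by presburger
    hence "c = 0" using ic by auto
    thus ?thesis using ic by auto
  qed
  have h: "theta_exp 2 1 (7 * i) = 49 * theta_exp 2 1 i + 0" for i
    using theta_exp_square[of "7 * i"] theta_exp_square[of i] by (simp add: algebra_simps del: One_nat_def)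
  have "fps_nth gauss_phi N = (if 0 \<le> N \<and> 49 dvd N - 0 then
      (\<Sum>i | theta_exp 2 1 i = (N - 0) div 49. msign (7 * i) :: 'a) else 0)"
    unfolding gauss_phi_nth by (rule theta_49[OF * h]) (auto simp: inj_def)
  also have "\<dots> = fps_nth (fps_X ^ 0 * (gauss_phi oo fps_X ^ 49)) N"
    unfolding nth_X_compose_49 gauss_phi_nth msign_7_diff ..
  finally show ?thesis by simp
qed

text \<open>For j = 7*i + c the square is c^2 plus the theta exponent with b = 98 and a = 49 + 14*c;
  this is the corresponding triple product.\<close>

definition phi_part :: "nat \<Rightarrow> 'a::idom fps" where
  "phi_part c = euler {m. 98 dvd m} * (euler {m. m mod 98 = 49 + 14 * c} * euler {m. m mod 98 = 98 - (49 + 14 * c)})"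

text \<open>The j with square N form the two progressions of c and -c modulo 7, exchanged by j -> -
  j; hence the factor 2.\<close>

lemma gauss_phi_class:
  assumes c: "c \<in> {1, 2, 3}" and N: "N mod 7 = c * c mod 7"
  shows "fps_nth gauss_phi N = fps_nth (fps_const (2 * (- 1) ^ c) * (fps_X ^ (c * c) * phi_part c) :: 'a::idom fps) N"
proof -
  define S where "S = {j. theta_exp 2 1 j = N}"
  define A where "A = {j \<in> S. \<exists>i. j = 7 * i + int c}"
  let ?b = "49 + 14 * c"
  have cb: "0 < ?b" "?b < 98" using c by auto
  have finS: "finite S"
  proof (rule finite_subset)
    show "S \<subseteq> {- int N - 1..int N + 1}"
    proof
      fix j assume "j \<in> S"
      hence "\<bar>j\<bar> \<le> int N + 1" using theta_exp_ge[of 1 2 j] by (simp add: S_def del: One_nat_def)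
      thus "j \<in> {- int N - 1..int N + 1}" by auto
    qed
  qed simp
  have neg: "- j \<in> S" if "j \<in> S" for j
    using theta_exp_square[of j] theta_exp_square[of "- j"] that by (simp add: S_def del: One_nat_def)
  have disj: "A \<inter> uminus ` A = {}"
  proof (rule equals0I)
    fix j assume "j \<in> A \<inter> uminus ` A"
    then obtain i i' where "j = 7 * i + int c" "j = - (7 * i' + int c)" by (auto simp: A_def)
    hence "7 * (i + i') = - 2 * int c" by simp
    thus False using c by (auto; presburger)
  qed
  have "S = A \<union> uminus ` A"
  proof (intro equalityI subsetI)
    fix j assume j: "j \<in> S"
    hence "theta_exp 2 1 j = N" by (simp add: S_def)
    then obtain i d where id: "j = 7 * i + d" "d \<in> {0, 1, 2, 3, 4, 5, 6}" "int N mod 7 = (d * d) mod 7"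
      by (rule square_residue)
    have "int N mod 7 = int (N mod 7)" by (simp add: zmod_int)
    hence "d = int c \<or> d = 7 - int c" using id(2,3) c unfolding N by auto
    thus "j \<in> A \<union> uminus ` A"
    proof
      assume "d = int c"
      thus ?thesis using j id by (auto simp: A_def)
    next
      assume "d = 7 - int c"
      hence "- j = 7 * (- i - 1) + int c" using id by simp
      hence "- j \<in> A" unfolding A_def using neg[OF j] by blast
      thus ?thesis by (metis UnI2 image_eqI minus_minus)
    qed
  qed (use neg in \<open>auto simp: A_def\<close>)
  hence "(\<Sum>j\<in>S. msign j) = (\<Sum>j\<in>A. msign j) + (\<Sum>j\<in>uminus ` A. msign j :: 'a)"
    using finS disj by (metis finite_Un sum.union_disjoint)
  also have "(\<Sum>j\<in>uminus ` A. msign j) = (\<Sum>j\<in>A. msign j :: 'a)"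
    by (subst sum.reindex) (auto simp: msign_7_diff)
  also have "A = (\<lambda>i. 7 * i + int c) ` {i. theta_exp 98 ?b i + c * c = N}"
  proof -
    have "theta_exp 2 1 (7 * i + int c) = theta_exp 98 ?b i + c * c" for i
    proof -
      have "2 * int (theta_exp 98 ?b i) = 98 * i * i + 28 * int c * i"
        using theta_exp_double[OF cb(2), of i] by (simp add: algebra_simps)
      hence "int (theta_exp 2 1 (7 * i + int c)) = int (theta_exp 98 ?b i + c * c)"
        unfolding theta_exp_square by (simp add: algebra_simps)
      thus ?thesis by (simp only: of_nat_eq_iff)
    qed
    thus ?thesis by (auto simp: A_def S_def simp del: One_nat_def)
  qed
  also have "(\<Sum>j\<in>(\<lambda>i. 7 * i + int c) ` {i. theta_exp 98 ?b i + c * c = N}. msign j) =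
      (- 1) ^ c * (\<Sum>i | theta_exp 98 ?b i + c * c = N. msign i :: 'a)"
    by (subst sum.reindex) (auto simp: inj_on_def msign_7_diff sum_distrib_left)
  also have "(\<Sum>i | theta_exp 98 ?b i + c * c = N. msign i) = fps_nth (fps_X ^ (c * c) * phi_part c :: 'a fps) N"
  proof (cases "c * c \<le> N")
    case True
    hence "{i. theta_exp 98 ?b i + c * c = N} = {i. theta_exp 98 ?b i = N - c * c}" by auto
    thus ?thesis
      using jacobi_triple_product[OF cb, of "N - c * c", where 'a = 'a] True
      by (simp add: fps_X_power_mult_nth phi_part_def)
  next
    case False
    hence "{i. theta_exp 98 ?b i + c * c = N} = {}" by auto
    thus ?thesis using False by (simp add: fps_X_power_mult_nth)
  qed
  finally show ?thesis
    unfolding gauss_phi_nth S_def[symmetric] fps_mult_left_const_nth by (simp add: algebra_simps)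
qed

text \<open>The six residues modulo 98 in the three parts, together with 49, are exactly those
  congruent to 7 modulo 14. The product therefore reduces to Euler products of the form J_k.\<close>

lemma phi_parts_product:
  "phi_part 1 * phi_part 2 * phi_part 3 * euler {m. 14 dvd m} * euler {m. 49 dvd m} =
   (euler {m. 7 dvd m} * euler {m. 98 dvd m} ^ 4 :: 'a::idom fps)"
proof -
  let ?r = "\<lambda>k. {m::nat. m mod 98 = k}"
  let ?e = "\<lambda>k. euler (?r k) :: 'a fps"
  have U: "?r 63 \<union> (?r 35 \<union> (?r 77 \<union> (?r 21 \<union> (?r 91 \<union> (?r 7 \<union> ?r 49))))) = {m. m mod 14 = 7}"
  proof (rule set_eqI)
    fix m :: nat
    define d where "d = m mod 98 div 14"
    have m14: "m mod 14 = m mod 98 mod 14" by (simp add: mod_mod_cancel)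
    have "d < 7" unfolding d_def by (simp add: div_less_iff_less_mult)
    hence d: "d = 0 \<or> d = 1 \<or> d = 2 \<or> d = 3 \<or> d = 4 \<or> d = 5 \<or> d = 6" by linarith
    have e: "m mod 98 = 14 * d + m mod 14" unfolding d_def m14 by simp
    have "m mod 14 = 7 \<Longrightarrow> m mod 98 \<in> {63, 35, 77, 21, 91, 7, 49}" using d e by auto
    moreover have "m mod 98 \<in> {63, 35, 77, 21, 91, 7, 49} \<Longrightarrow> m mod 14 = 7" unfolding m14 by auto
    ultimately show "m \<in> ?r 63 \<union> (?r 35 \<union> (?r 77 \<union> (?r 21 \<union> (?r 91 \<union> (?r 7 \<union> ?r 49))))) \<longleftrightarrow>
      m \<in> {m. m mod 14 = 7}" by auto
  qed
  have 1: "euler {m. m mod 14 = 7} = ?e 63 * (?e 35 * (?e 77 * (?e 21 * (?e 91 * (?e 7 * ?e 49)))))"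
    unfolding U[symmetric] by (subst euler_Un, force)+ (rule refl)
  have 2: "euler {m. 7 dvd m} = euler {m. 14 dvd m} * (euler {m. m mod 14 = 7} :: 'a fps)"
  proof -
    have "{m. 14 dvd m} \<union> {m. m mod 14 = 7} = {m::nat. 7 dvd m}" by (rule set_eqI, simp) presburger
    moreover have "{m. 14 dvd m} \<inter> {m::nat. m mod 14 = 7} = {}" by auto
    ultimately show ?thesis using euler_Un[of "{m. 14 dvd m}" "{m. m mod 14 = 7}", where 'a = 'a] by simp
  qed
  have 3: "euler {m. 49 dvd m} = euler {m. 98 dvd m} * ?e 49"
  proof -
    have "{m. 98 dvd m} \<union> ?r 49 = {m::nat. 49 dvd m}"
    proof (rule set_eqI)
      fix m :: nat
      define d where "d = m mod 98 div 49"
      have m49: "m mod 49 = m mod 98 mod 49" by (simp add: mod_mod_cancel)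
      have "d < 2" unfolding d_def by (simp add: div_less_iff_less_mult)
      hence d: "d = 0 \<or> d = 1" by linarith
      have e: "m mod 98 = 49 * d + m mod 49" unfolding d_def m49 by simp
      have "m mod 49 = 0 \<Longrightarrow> m mod 98 = 0 \<or> m mod 98 = 49" using d e by auto
      moreover have "m mod 98 = 0 \<or> m mod 98 = 49 \<Longrightarrow> m mod 49 = 0" unfolding m49 by auto
      ultimately have "m mod 98 = 0 \<or> m mod 98 = 49 \<longleftrightarrow> m mod 49 = 0" by (rule iffI[rotated])
      thus "m \<in> {m. 98 dvd m} \<union> ?r 49 \<longleftrightarrow> m \<in> {m. 49 dvd m}"
        by (simp only: Un_iff mem_Collect_eq dvd_eq_mod_eq_0)
    qed
    moreover have "{m. 98 dvd m} \<inter> ?r 49 = {}" by auto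
    ultimately show ?thesis using euler_Un[of "{m. 98 dvd m}" "?r 49", where 'a = 'a] by simp
  qed
  have p: "phi_part 1 = euler {m. 98 dvd m} * (?e 63 * ?e 35)" "phi_part 2 = euler {m. 98 dvd m} * (?e 77 * ?e 21)"
    "phi_part 3 = euler {m. 98 dvd m} * (?e 91 * ?e 7)"
    by (simp_all add: phi_part_def)
  show ?thesis
    unfolding p 2 1 3 power4_eq_xxxx by (simp only: mult_ac)
qed

subsection \<open>Laurent series graded by exponents modulo 7\<close>

definition \<zeta> :: complex where "\<zeta> = cis (2 * pi / 7)"

lemma zeta_nonzero [simp]: "\<zeta> \<noteq> 0" by (simp add: \<zeta>_def)

lemma zeta_power_7: "\<zeta> ^ 7 = 1"
  by (simp add: \<zeta>_def Complex.DeMoivre)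

lemma zeta_power_inj: "inj_on (\<lambda>k. \<zeta> ^ k) {..<7}"
proof -
  have "(\<lambda>j. exp (2 * of_real pi * \<i> * of_nat j / of_nat 7)) = (\<lambda>k. \<zeta> ^ k)"
    by (auto simp: \<zeta>_def cis_conv_exp exp_of_nat_mult[symmetric] mult_ac)
  thus ?thesis using bij_betw_roots_unity[of 7] by (simp add: bij_betw_def)
qed

lemma zeta_powi_mod: "\<zeta> powi n = \<zeta> ^ nat (n mod 7)"
proof -
  have "\<zeta> powi n = \<zeta> powi (7 * (n div 7) + n mod 7)" by simp
  also have "\<dots> = (\<zeta> powi 7) powi (n div 7) * \<zeta> powi (n mod 7)"
    by (simp only: power_int_add[OF disjI1, OF zeta_nonzero] power_int_mult)
  also have "\<zeta> powi 7 = 1" using zeta_power_7 by simp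
  finally show ?thesis by (simp add: power_int_def)
qed

lemma zeta_powi_eq_iff: "\<zeta> powi m = \<zeta> powi n \<longleftrightarrow> m mod 7 = n mod 7"
proof
  assume "\<zeta> powi m = \<zeta> powi n"
  hence "\<zeta> ^ nat (m mod 7) = \<zeta> ^ nat (n mod 7)" by (simp add: zeta_powi_mod)
  moreover have "nat (m mod 7) < 7" "nat (n mod 7) < 7" by auto
  ultimately have "nat (m mod 7) = nat (n mod 7)"
    using zeta_power_inj by (auto simp: inj_on_def)
  thus "m mod 7 = n mod 7" by simp
qed (simp add: zeta_powi_mod)

definition rot :: "complex fls \<Rightarrow> complex fls" where
  "rot f = fls_compose_fps f (fps_const \<zeta> * fps_X)"

lemma rot_nth: "fls_nth (rot f) n = fls_nth f n * \<zeta> powi n"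
  unfolding rot_def by (rule fls_nth_fls_compose_fps_linear) simp

lemma rot_mult: "rot (f * g) = rot f * rot g"
  and rot_inverse: "rot (inverse f) = inverse (rot f)"
  unfolding rot_def by (rule fls_compose_fps_mult fls_compose_fps_inverse; simp)+

definition graded :: "int \<Rightarrow> complex fls \<Rightarrow> bool" where
  "graded i f \<longleftrightarrow> (\<forall>n. fls_nth f n \<noteq> 0 \<longrightarrow> n mod 7 = i mod 7)"

text \<open>Homogeneous series are the eigenvectors of X -> \<zeta>*X. Since \<open>rot\<close>
  respects products and inverses, so does the grading.\<close>

lemma graded_iff_rot: "graded i f \<longleftrightarrow> rot f = fls_const (\<zeta> powi i) * f"
proof -
  have "rot f = fls_const (\<zeta> powi i) * f \<longleftrightarrow> (\<forall>n. fls_nth f n * \<zeta> powi n = fls_nth f n * \<zeta> powi i)"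
    by (simp add: fls_eq_iff rot_nth mult.commute)
  thus ?thesis by (auto simp: graded_def zeta_powi_eq_iff)
qed

lemma graded_mult:
  assumes "graded i f" "graded j g"
  shows "graded (i + j) (f * g)"
proof -
  have "fls_const (\<zeta> powi (i + j)) = fls_const (\<zeta> powi i) * fls_const (\<zeta> powi j)"
    by (simp add: power_int_add)
  thus ?thesis using assms unfolding graded_iff_rot rot_mult by (simp only: mult_ac)
qed

lemma graded_inverse: "graded i f \<Longrightarrow> graded (- i) (inverse f)"
  by (simp add: graded_iff_rot rot_inverse power_int_minus fls_inverse_const)

lemma graded_divide: "graded i f \<Longrightarrow> graded j g \<Longrightarrow> graded (i - j) (f / g)"
  using graded_mult[OF _ graded_inverse, of i f j g] by (simp add: divide_inverse)

lemma graded_cong: "graded i f \<Longrightarrow> i mod 7 = j mod 7 \<Longrightarrow> graded j f"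
  by (simp add: graded_def)

lemma graded_add: "graded i f \<Longrightarrow> graded i g \<Longrightarrow> graded i (f + g)"
  and graded_diff: "graded i f \<Longrightarrow> graded i g \<Longrightarrow> graded i (f - g)"
  and graded_minus: "graded i f \<Longrightarrow> graded i (- f)"
  by (auto simp: graded_def) (metis add.right_neutral, metis diff_0_right)

lemma graded_1: "graded 0 1" by (simp add: graded_def)

lemma graded_power: "graded i f \<Longrightarrow> graded (int n * i) (f ^ n)"
proof (induction n)
  case (Suc n)
  thus ?case using graded_mult[of i f "int n * i" "f ^ n"] by (simp add: algebra_simps)
qed (simp add: graded_1)

lemma graded_of_int: "graded 0 (of_int n)"
  by (simp add: graded_def fls_of_int_nth)

lemma graded_numeral: "graded 0 (numeral n)"
  using graded_of_int[of "numeral n"] by simp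

lemma graded_X_power: "graded (int n) (fls_X ^ n)"
  by (auto simp: graded_def fls_X_power_nth)

lemma graded_nth_0: "graded i f \<Longrightarrow> n mod 7 \<noteq> i mod 7 \<Longrightarrow> fls_nth f n = 0"
  by (auto simp: graded_def)

definition seg :: "int \<Rightarrow> complex fls \<Rightarrow> complex fls" where
  "seg i f = Abs_fls (\<lambda>n. if n mod 7 = i mod 7 then fls_nth f n else 0)"

lemma seg_nth [simp]: "fls_nth (seg i f) n = (if n mod 7 = i mod 7 then fls_nth f n else 0)"
proof -
  obtain N where "\<forall>n<N. fls_nth f n = 0" by (elim fls_nth_vanishes_belowE)
  thus ?thesis unfolding seg_def by (intro nth_Abs_fls_lower_bound[of N]) auto
qed

lemma graded_seg: "graded i (seg i f)"
  by (auto simp: graded_def)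

lemma seg_graded: "graded i f \<Longrightarrow> seg j f = (if i mod 7 = j mod 7 then f else 0)"
  by (auto simp: fls_eq_iff graded_def)

lemma seg_eqI:
  assumes "graded i g" "\<And>n. n mod 7 = i mod 7 \<Longrightarrow> fls_nth f n = fls_nth g n"
  shows "seg i f = g"
  by (rule fls_eqI) (use assms graded_nth_0 in auto)

lemma seg_add: "seg i (f + g) = seg i f + seg i g"
  by (auto simp: fls_eq_iff)

section \<open>The operator U and the dilations X -> X^d\<close>

definition U7 :: "complex fls \<Rightarrow> complex fls" where
  "U7 f = Abs_fls (\<lambda>n. fls_nth f (7 * n))"

lemma U7_nth [simp]: "fls_nth (U7 f) n = fls_nth f (7 * n)"
proof -
  obtain N where N: "\<forall>n<N. fls_nth f n = 0" by (elim fls_nth_vanishes_belowE)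
  have "fls_nth f (7 * n) = 0" if "n < - \<bar>N\<bar>" for n
  proof -
    have "7 * n < N" using that by linarith
    thus ?thesis using N by blast
  qed
  thus ?thesis unfolding U7_def by (intro nth_Abs_fls_lower_bound[of "- \<bar>N\<bar>"]) auto
qed

lemma U7_diff: "U7 (f - g) = U7 f - U7 g"
  and U7_add: "U7 (f + g) = U7 f + U7 g"
  by (auto simp: fls_eq_iff)

definition dil :: "nat \<Rightarrow> complex fls \<Rightarrow> complex fls" where
  "dil d f = fls_compose_power f d"

lemma dil_nth: "d > 0 \<Longrightarrow> fls_nth (dil d f) n = (if int d dvd n then fls_nth f (n div int d) else 0)"
  by (simp add: dil_def fls_nth_compose_power)

lemma dil_mult: "dil d (f * g) = dil d f * dil d g"
  and dil_add: "dil d (f + g) = dil d f + dil d g"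
  and dil_diff: "dil d (f - g) = dil d f - dil d g"
  and dil_minus: "dil d (- f) = - dil d f"
  and dil_0: "dil d 0 = 0"
  by (simp_all add: dil_def)

lemma dil_1: "d > 0 \<Longrightarrow> dil d 1 = 1" by (simp add: dil_def)

lemma dil_power: "d > 0 \<Longrightarrow> dil d (f ^ n) = dil d f ^ n" by (simp add: dil_def)

lemma dil_inj: "d > 0 \<Longrightarrow> dil d f = dil d g \<longleftrightarrow> f = g"
proof -
  assume d: "d > 0"
  have "fls_nth f n = fls_nth (dil d f) (int d * n)" for f n using d by (simp add: dil_nth)
  thus ?thesis by (metis fls_eqI)
qed

lemma dil_inverse: "d > 0 \<Longrightarrow> dil d (inverse f) = inverse (dil d f)"
proof (cases "f = 0")
  case False
  assume d: "d > 0"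
  have "dil d f * dil d (inverse f) = 1" using False d by (simp add: dil_mult[symmetric] dil_1)
  thus ?thesis by (metis inverse_unique)
qed (simp add: dil_0)

lemma dil_divide: "d > 0 \<Longrightarrow> dil d (f / g) = dil d f / dil d g"
  by (simp add: divide_inverse dil_mult dil_inverse)

lemma dil_of_int: "d > 0 \<Longrightarrow> dil d (of_int n) = of_int n"
  by (simp add: dil_def fls_of_int)

lemma dil_numeral: "d > 0 \<Longrightarrow> dil d (numeral n) = numeral n"
  using dil_of_int[of d "numeral n"] by simp

lemma dil_powi: "d > 0 \<Longrightarrow> dil d (f powi n) = dil d f powi n"
  by (simp add: power_int_def dil_power dil_inverse)

lemma dil_X_power: "d > 0 \<Longrightarrow> dil d (fls_X ^ n) = fls_X ^ (d * n)"
  by (simp add: dil_power power_mult) (simp add: dil_def fls_X_power_conv_shift_1)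

lemma dil_dil: "d > 0 \<Longrightarrow> e > 0 \<Longrightarrow> dil d (dil e f) = dil (d * e) f"
  by (rule fls_eqI) (auto simp: dil_nth zdiv_zmult2_eq dvd_mult_imp_div elim!: dvdE)

lemma graded_dil: "d > 0 \<Longrightarrow> graded i f \<Longrightarrow> graded (int d * i) (dil d f)"
  by (auto simp: graded_def dil_nth elim!: dvdE split: if_splits) (metis mod_mult_right_eq)

lemma graded_dil_7: "graded 0 (dil 7 f)"
  by (auto simp: graded_def dil_nth dvd_eq_mod_eq_0 split: if_splits)

lemma U7_dil_7: "U7 (dil 7 f) = f"
  by (rule fls_eqI) (simp add: dil_nth)

lemma dil_7_U7: "dil 7 (U7 f) = seg 0 f"
  by (rule fls_eqI) (auto simp: dil_nth dvd_eq_mod_eq_0[symmetric])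

text \<open>The projection formula: after multiplication by a series in X^7 only the class-0 part of
  f contributes to exponents divisible by 7.\<close>

lemma U7_dil_mult: "U7 (dil 7 g * f) = g * U7 f"
proof -
  have "f = seg 0 f + (f - seg 0 f)" by simp
  hence "dil 7 g * f = dil 7 g * seg 0 f + dil 7 g * (f - seg 0 f)" by (metis distrib_left)
  moreover have "dil 7 g * seg 0 f = dil 7 (g * U7 f)" by (simp add: dil_mult dil_7_U7)
  moreover have "U7 (dil 7 g * (f - seg 0 f)) = 0"
  proof (rule fls_eqI)
    fix n
    have "fls_nth (dil 7 g) i * fls_nth (f - seg 0 f) (7 * n - i) = 0" for i
    proof (cases "7 dvd i")
      case True
      hence "(7 * n - i) mod 7 = 0" by presburger
      thus ?thesis by simp
    qed (simp add: dil_nth)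
    thus "fls_nth (U7 (dil 7 g * (f - seg 0 f))) n = fls_nth 0 n"
      by (simp only: U7_nth fls_times_nth(2) sum.neutral_const fls_zero_nth)
  qed
  ultimately show ?thesis by (simp add: U7_add U7_dil_7)
qed

subsection \<open>The 7-dissections as points of the curve\<close>

abbreviation X :: "complex fls" where "X \<equiv> fls_X"

definition E :: "nat \<Rightarrow> complex fls" where
  "E k = fps_to_fls (euler {m. k dvd m})"

lemma E_nth: "fls_nth (E k) n = (if n < 0 then 0 else fps_nth (euler {m. k dvd m}) (nat n))"
  by (simp add: E_def)

lemma E_nth_0: "fls_nth (E k) 0 = 1" by (simp add: E_nth)

lemma E_nonzero [simp]: "E k \<noteq> 0"
  using E_nth_0[of k] by auto

lemma E_subdegree [simp]: "fls_subdegree (E k) = 0"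
  by (rule fls_subdegree_eqI) (simp_all add: E_nth)

lemma dil_E: "d > 0 \<Longrightarrow> dil d (E k) = E (d * k)"
  by (simp add: dil_def E_def fls_compose_power_fps_to_fls euler_multiples_compose)

lemma graded_E: "7 dvd k \<Longrightarrow> graded 0 (E k)"
  using dil_E[of 7] graded_dil_7 by (metis dvdE zero_less_numeral)

lemma seg_fps_eqI:
  assumes "graded (int c) (fps_to_fls g)" "c < 7" "\<And>N. N mod 7 = c \<Longrightarrow> fps_nth f N = fps_nth g N"
  shows "seg (int c) (fps_to_fls f) = fps_to_fls g"
proof (rule seg_eqI[OF assms(1)])
  fix n :: int assume n: "n mod 7 = int c mod 7"
  show "fls_nth (fps_to_fls f) n = fls_nth (fps_to_fls g) n"
  proof (cases "n < 0")
    case False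
    hence "int (nat n mod 7) = n mod 7" by (simp add: zmod_int)
    hence "nat n mod 7 = c" using n assms(2) by simp
    thus ?thesis using assms(3) False by simp
  qed simp
qed

lemma fps_to_fls_seg_sum:
  assumes "\<And>N. N mod 7 \<notin> {a, b, c, d} \<Longrightarrow> fps_nth f N = 0"
    and "distinct [a, b, c, d]" "a < 7" "b < 7" "c < 7" "d < 7"
  shows "fps_to_fls f = seg (int a) (fps_to_fls f) + seg (int b) (fps_to_fls f) + seg (int c) (fps_to_fls f) + seg (int d) (fps_to_fls f)"
proof (rule fls_eqI)
  fix n :: int
  show "fls_nth (fps_to_fls f) n = fls_nth (seg (int a) (fps_to_fls f) + seg (int b) (fps_to_fls f) + seg (int c) (fps_to_fls f) + seg (int d) (fps_to_fls f)) n"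
  proof (cases "n < 0")
    case False
    define N where "N = nat n"
    have n: "n = int N" using False by (simp add: N_def)
    have "n mod 7 = int k mod 7 \<longleftrightarrow> N mod 7 = k" if "k < 7" for k
      unfolding n using that by (metis mod_less of_nat_eq_iff zmod_int of_nat_numeral)
    thus ?thesis using assms(1)[of N] assms(2-) by (auto simp: n)
  qed simp
qed

definition u :: "int \<Rightarrow> complex fls" where "u i = seg i (E 1)"

lemma graded_u: "graded i (u i)" by (simp add: u_def graded_seg)

lemma E1_split: "E 1 = u 0 + u 1 + u 2 + u 5"
  using fps_to_fls_seg_sum[of 0 1 2 5 "euler {m. 1 dvd m}", OF pentagonal_class_0] by (simp add: u_def E_def)

lemma fps_to_fls_X_power: "fps_to_fls (fps_X ^ n) = X ^ n"
  by (simp add: fps_to_fls_power)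

lemma u_2: "u 2 = - (X ^ 2 * E 49)"
proof -
  have g: "fps_to_fls (- (fps_X ^ 2 * euler {m. 49 dvd m})) = - (X ^ 2 * E 49)"
    by (simp add: fls_times_fps_to_fls fps_to_fls_X_power E_def)
  have "graded 2 (- (X ^ 2 * E 49))"
    using graded_minus[OF graded_mult[OF graded_X_power[of 2] graded_E[of 49]]] by simp
  hence "graded (int 2) (fps_to_fls (- (fps_X ^ 2 * euler {m. 49 dvd m})))" unfolding g by simp
  hence "seg (int 2) (fps_to_fls (euler {m. 1 dvd m})) = fps_to_fls (- (fps_X ^ 2 * euler {m. 49 dvd m}))"
    by (rule seg_fps_eqI) (simp, rule pentagonal_class_2)
  thus ?thesis unfolding g by (simp add: u_def E_def)
qed

lemma E1_cube_fps: "E 1 ^ 3 = fps_to_fls (euler {m. 1 dvd m} ^ 3)"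
  by (simp only: E_def fps_to_fls_power)

lemma E1_cube_0:
  assumes "c \<in> {2, 4, 5}"
  shows "seg (int c) (E 1 ^ 3) = 0"
proof -
  have "seg (int c) (E 1 ^ 3) = fps_to_fls 0"
    unfolding E1_cube_fps
  proof (rule seg_fps_eqI)
    fix N assume "N mod 7 = c"
    hence "N mod 7 \<notin> {0, 1, 3, 6}" using assms by auto
    thus "fps_nth (euler {m. 1 dvd m} ^ 3) N = fps_nth (0 :: complex fps) N"
      unfolding fps_zero_nth by (rule cube_class_0)
  qed (use assms in \<open>auto simp: graded_def\<close>)
  thus ?thesis by simp
qed

lemma E1_cube_6: "seg 6 (E 1 ^ 3) = - 7 * (X ^ 6 * E 49 ^ 3)"
proof -
  have g: "fps_to_fls (- 7 * (fps_X ^ 6 * euler {m. 49 dvd m} ^ 3)) = - 7 * (X ^ 6 * E 49 ^ 3)"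
    by (simp add: fls_times_fps_to_fls fps_to_fls_power E_def)
  have "graded 6 (- 7 * (X ^ 6 * E 49 ^ 3))"
    using graded_mult[OF graded_minus[OF graded_numeral] graded_mult[OF graded_X_power[of 6] graded_power[OF graded_E[of 49], of 3]]]
    by simp
  hence "graded (int 6) (fps_to_fls (- 7 * (fps_X ^ 6 * euler {m. 49 dvd m} ^ 3)))" unfolding g by simp
  hence "seg (int 6) (fps_to_fls (euler {m. 1 dvd m} ^ 3)) = fps_to_fls (- 7 * (fps_X ^ 6 * euler {m. 49 dvd m} ^ 3))"
    by (rule seg_fps_eqI) (simp, rule cube_class_6)
  thus ?thesis unfolding g E1_cube_fps of_nat_numeral .
qed

lemma seg_sum7:
  assumes "graded 0 y0" "graded 1 y1" "graded 2 y2" "graded 3 y3" "graded 4 y4" "graded 5 y5" "graded 6 y6"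
  defines "f \<equiv> y0 + y1 + y2 + y3 + y4 + y5 + y6"
  shows "seg 0 f = y0" "seg 1 f = y1" "seg 2 f = y2" "seg 3 f = y3" "seg 4 f = y4" "seg 5 f = y5" "seg 6 f = y6"
  unfolding f_def by (simp_all add: seg_add assms(1-7)[THEN seg_graded])

text \<open>The cube of J_1 is expanded in components and sorted by class. No triangular number lies
  in the classes 2, 4, 5, which gives three relations; class 6 gives u_2^3 + 6*u_0*u_1*u_5 =
  7*u_2^3, by the factor -7 of Jacobi's identity and the monomial form of u_2.\<close>

lemma klein_u:
  "u 0 * u 1 * u 5 = u 2 ^ 3"
  "u 0 ^ 2 * u 2 + u 0 * u 1 ^ 2 + u 2 ^ 2 * u 5 = 0"
  "u 2 ^ 2 * u 0 + u 1 ^ 2 * u 2 + u 5 ^ 2 * u 1 = 0"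
  "u 0 ^ 2 * u 5 + u 1 * u 2 ^ 2 + u 5 ^ 2 * u 2 = 0"
proof -
  define a b c d where "a = u 0" and "b = u 1" and "c = u 2" and "d = u 5"
  have gr: "graded 0 a" "graded 1 b" "graded 2 c" "graded 5 d"
    by (simp_all add: a_def b_def c_def d_def graded_u)
  have cube: "E 1 ^ 3 = (a^3 + 3*b^2*d + 6*a*c*d) + (d^3 + 3*a^2*b + 6*b*c*d) + 3*(a^2*c + a*b^2 + c^2*d)
     + (b^3 + 3*a*d^2 + 6*a*b*c) + 3*(c^2*a + b^2*c + d^2*b) + 3*(a^2*d + b*c^2 + d^2*c) + (c^3 + 6*(a*b*d))"
    unfolding E1_split a_def b_def c_def d_def by algebra
  have g: "graded 0 (a^3 + 3*b^2*d + 6*a*c*d)" "graded 1 (d^3 + 3*a^2*b + 6*b*c*d)" "graded 2 (a^2*c + a*b^2 + c^2*d)"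
    "graded 3 (b^3 + 3*a*d^2 + 6*a*b*c)" "graded 4 (c^2*a + b^2*c + d^2*b)" "graded 5 (a^2*d + b*c^2 + d^2*c)"
    "graded 6 (c^3 + 6*(a*b*d))"
    by (intro graded_add; rule graded_cong, (rule gr graded_mult graded_power graded_numeral)+, simp)+
  have g3: "graded i x \<Longrightarrow> graded i (3 * x)" for i x using graded_mult[OF graded_numeral] by fastforce
  note segs = seg_sum7[OF g(1) g(2) g3[OF g(3)] g(4) g3[OF g(5)] g3[OF g(6)] g(7), folded cube]
  have "seg 2 (E 1 ^ 3) = 3*(a^2*c + a*b^2 + c^2*d)" by (rule segs)
  thus "u 0 ^ 2 * u 2 + u 0 * u 1 ^ 2 + u 2 ^ 2 * u 5 = 0"
    using E1_cube_0[of 2] unfolding a_def b_def c_def d_def by (simp del: distrib_left_numeral)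
  have "seg 4 (E 1 ^ 3) = 3*(c^2*a + b^2*c + d^2*b)" by (rule segs)
  thus "u 2 ^ 2 * u 0 + u 1 ^ 2 * u 2 + u 5 ^ 2 * u 1 = 0"
    using E1_cube_0[of 4] unfolding a_def b_def c_def d_def by (simp del: distrib_left_numeral)
  have "seg 5 (E 1 ^ 3) = 3*(a^2*d + b*c^2 + d^2*c)" by (rule segs)
  thus "u 0 ^ 2 * u 5 + u 1 * u 2 ^ 2 + u 5 ^ 2 * u 2 = 0"
    using E1_cube_0[of 5] unfolding a_def b_def c_def d_def by (simp del: distrib_left_numeral)
  have "seg 6 (E 1 ^ 3) = c^3 + 6*(a*b*d)" by (rule segs)
  hence "c^3 + 6*(a*b*d) = 7 * c^3"
    unfolding E1_cube_6 by (simp add: c_def u_2 power_mult_distrib flip: power_mult)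
  thus "u 0 * u 1 * u 5 = u 2 ^ 3" unfolding a_def b_def c_def d_def by simp
qed

section \<open>Components of J_1^2 / J_2 as Laurent series\<close>

definition Ph :: "complex fls" where "Ph = fps_to_fls gauss_phi"

definition ph :: "int \<Rightarrow> complex fls" where "ph i = seg i Ph"

lemma graded_ph: "graded i (ph i)" by (simp add: ph_def graded_seg)

lemma Ph_mult: "Ph * E 2 = E 1 ^ 2"
  unfolding Ph_def E_def fls_times_fps_to_fls[symmetric] fps_to_fls_power[symmetric] gauss_phi_mult ..

lemma Ph_split: "Ph = ph 0 + ph 1 + ph 2 + ph 4"
  using fps_to_fls_seg_sum[of 0 1 2 4 gauss_phi, OF gauss_phi_class_0] by (simp add: ph_def Ph_def)

lemma ph_0: "ph 0 = dil 49 Ph"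
proof -
  have g: "dil 49 Ph = fps_to_fls (gauss_phi oo fps_X ^ 49)"
    by (simp add: dil_def Ph_def fls_compose_power_fps_to_fls)
  have "graded 0 (dil 49 Ph)" using dil_dil[of 7 7 Ph] graded_dil_7[of "dil 7 Ph"] by simp
  hence "seg (int 0) (fps_to_fls gauss_phi) = fps_to_fls (gauss_phi oo fps_X ^ 49)"
    by (intro seg_fps_eqI gauss_phi_class_7) (simp_all add: g)
  thus ?thesis unfolding g by (simp add: ph_def Ph_def)
qed

definition pp :: "nat \<Rightarrow> complex fls" where "pp c = fps_to_fls (phi_part c)"

lemma graded_euler: "(\<And>m. m \<in> S \<Longrightarrow> 7 dvd m) \<Longrightarrow> graded 0 (fps_to_fls (euler S))"
proof -
  assume "\<And>m. m \<in> S \<Longrightarrow> 7 dvd m"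
  hence "S = (*) 7 ` {m. 7 * m \<in> S}" by (auto elim!: dvdE)
  hence "(euler S :: complex fps) = euler ((*) 7 ` {m. 7 * m \<in> S})" by (rule arg_cong)
  also have "\<dots> = euler {m. 7 * m \<in> S} oo fps_X ^ 7"
    by (rule euler_compose_X_power[symmetric]) simp
  finally have "fps_to_fls (euler S) = dil 7 (fps_to_fls (euler {m. 7 * m \<in> S}))"
    by (simp add: dil_def fls_compose_power_fps_to_fls)
  thus ?thesis using graded_dil_7 by simp
qed

lemma pp_nth_0: "fls_nth (pp c) 0 = 1"
  by (simp add: pp_def phi_part_def)

lemma pp_nonzero [simp]: "pp c \<noteq> 0"
  using pp_nth_0[of c] by auto

lemma pp_subdegree [simp]: "fls_subdegree (pp c) = 0"
  by (rule fls_subdegree_eqI) (simp_all add: pp_nth_0, simp add: pp_def)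

lemma graded_pp:
  assumes "c \<in> {1, 2, 3}"
  shows "graded 0 (pp c)"
proof -
  have d: "7 dvd m" if "m mod 98 = k" "7 dvd k" for m k :: nat
    using that dvd_mod_iff[of 7 98 m] by auto
  have "graded (0 + (0 + 0)) (pp c)"
    unfolding pp_def phi_part_def fls_times_fps_to_fls
    by (intro graded_mult graded_euler; use assms in \<open>auto intro: dvd_trans[of 7 98] d\<close>)
  thus ?thesis by simp
qed

lemma ph_class:
  assumes "c \<in> {1, 2, 3}"
  shows "ph (int (c * c)) = of_int (2 * (- 1) ^ c) * (X ^ (c * c) * pp c)"
proof -
  let ?g = "fps_const (2 * (- 1) ^ c) * (fps_X ^ (c * c) * phi_part c) :: complex fps"
  have g: "fps_to_fls ?g = of_int (2 * (- 1) ^ c) * (X ^ (c * c) * pp c)"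
    by (simp add: fls_times_fps_to_fls fps_to_fls_power pp_def fls_of_int)
  have "graded (0 + (int (c * c) + 0)) (of_int (2 * (- 1) ^ c) * (X ^ (c * c) * pp c))"
    by (intro graded_mult graded_of_int graded_X_power graded_pp assms)
  hence gr: "graded (int (c * c mod 7)) (fps_to_fls ?g)"
    unfolding g by (elim graded_cong) (simp add: zmod_int)
  have "seg (int (c * c mod 7)) (fps_to_fls gauss_phi) = fps_to_fls ?g"
    by (rule seg_fps_eqI[OF gr]) (use assms gauss_phi_class in auto)
  moreover have "seg (int (c * c mod 7)) f = seg (int (c * c)) f" for f
    by (simp add: fls_eq_iff zmod_int)
  ultimately show ?thesis unfolding g by (simp add: ph_def Ph_def)
qed

lemma ph_124: "ph 1 = - 2 * (X * pp 1)" "ph 4 = 2 * (X ^ 4 * pp 2)" "ph 2 = - 2 * (X ^ 9 * pp 3)"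
proof -
  have "ph 9 = ph 2" by (simp add: ph_def fls_eq_iff)
  thus "ph 1 = - 2 * (X * pp 1)" "ph 4 = 2 * (X ^ 4 * pp 2)" "ph 2 = - 2 * (X ^ 9 * pp 3)"
    using ph_class[of 1] ph_class[of 2] ph_class[of 3] by simp_all
qed

lemma ph_product: "ph 1 * ph 2 * ph 4 * (E 14 * E 49) = 8 * X ^ 14 * (E 7 * E 98 ^ 4)"
proof -
  have "pp 1 * pp 2 * pp 3 * E 14 * E 49 = E 7 * E 98 ^ 4"
    unfolding pp_def E_def fls_times_fps_to_fls[symmetric] fps_to_fls_power[symmetric] phi_parts_product ..
  thus ?thesis unfolding ph_124 by algebra
qed

lemma u_2_nonzero [simp]: "u 2 \<noteq> 0" by (simp add: u_2)

lemma u_nonzero: "u 0 \<noteq> 0" "u 1 \<noteq> 0" "u 5 \<noteq> 0"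
proof -
  have "u 0 * u 1 * u 5 \<noteq> 0" unfolding klein_u(1) by simp
  thus "u 0 \<noteq> 0" "u 1 \<noteq> 0" "u 5 \<noteq> 0" by auto
qed

definition "kU = u 0 / u 2"
definition "kV = u 1 / u 2"
definition "kW = u 5 / u 2"

lemma u_eq: "u 0 = kU * u 2" "u 1 = kV * u 2" "u 5 = kW * u 2"
  by (simp_all add: kU_def kV_def kW_def)

lemma k_nonzero [simp]: "kU \<noteq> 0" "kV \<noteq> 0" "kW \<noteq> 0"
  using u_nonzero by (simp_all add: kU_def kV_def kW_def)

interpretation K: klein kU kV kW
proof
  have c: "u 2 ^ 3 \<noteq> 0" by simp
  have "u 2 ^ 3 * (kU * kV * kW) = u 2 ^ 3 * 1" using klein_u(1) unfolding u_eq by algebra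
  thus "kU * kV * kW = 1" using c mult_left_cancel by blast
  have "u 2 ^ 3 * (kU^2 + kU * kV^2 + kW) = 0" using klein_u(2) unfolding u_eq by algebra
  thus "kU^2 + kU * kV^2 + kW = 0" using c by simp
  have "u 2 ^ 3 * (kV^2 + kV * kW^2 + kU) = 0" using klein_u(3) unfolding u_eq by algebra
  thus "kV^2 + kV * kW^2 + kU = 0" using c by simp
  have "u 2 ^ 3 * (kW^2 + kW * kU^2 + kV) = 0" using klein_u(4) unfolding u_eq by algebra
  thus "kW^2 + kW * kU^2 + kV = 0" using c by simp
qed

lemma graded_k: "graded (- 2) kU" "graded (- 1) kV" "graded 3 kW"
  using graded_divide[OF graded_u graded_u, of 0 2] graded_divide[OF graded_u graded_u, of 1 2]
    graded_divide[OF graded_u graded_u, of 5 2] by (simp_all add: kU_def kV_def kW_def)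

lemma graded_z: "graded 0 K.zU" "graded 0 K.zV" "graded 0 K.zW"
  unfolding K.zU_def K.zV_def K.zW_def
  by (rule graded_cong, (rule graded_k graded_mult graded_power)+, simp)+

lemma graded_b: "graded 2 K.bU" "graded 1 K.bV" "graded 4 K.bW"
  unfolding K.bU_def K.bV_def K.bW_def
  by (rule graded_cong, (rule graded_k graded_mult)+, simp)+

lemma b_nonzero: "K.bU \<noteq> 0" "K.bV \<noteq> 0" "K.bW \<noteq> 0"
  by (simp_all add: K.bU_def K.bV_def K.bW_def)

lemma graded_mult_0: "graded 0 f \<Longrightarrow> graded i g \<Longrightarrow> graded i (f * g)"
  using graded_mult[of 0 f i g] by simp

lemma seg_comb:
  assumes "graded 0 A0" "graded 0 AU" "graded 0 AV" "graded 0 AW" "graded 0 BU" "graded 0 BV" "graded 0 BW"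
  defines "f \<equiv> K.comb A0 AU AV AW BU BV BW"
  shows "seg 0 f = A0" "seg 1 f = AV * K.bV" "seg 2 f = AU * K.bU" "seg 3 f = BW * kW" "seg 4 f = AW * K.bW"
    "seg 5 f = BU * kU" "seg 6 f = BV * kV"
proof -
  have k: "graded 5 kU" "graded 6 kV" using graded_k(1,2) by (auto elim!: graded_cong)
  have "f = A0 + AV * K.bV + AU * K.bU + BW * kW + AW * K.bW + BU * kU + BV * kV"
    by (simp add: f_def K.comb_def)
  moreover note seg_sum7[OF assms(1) graded_mult_0[OF assms(3) graded_b(2)] graded_mult_0[OF assms(2) graded_b(1)]
     graded_mult_0[OF assms(7) graded_k(3)] graded_mult_0[OF assms(4) graded_b(3)]
     graded_mult_0[OF assms(5) k(1)] graded_mult_0[OF assms(6) k(2)]]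
  ultimately show "seg 0 f = A0" "seg 1 f = AV * K.bV" "seg 2 f = AU * K.bU" "seg 3 f = BW * kW" "seg 4 f = AW * K.bW"
    "seg 5 f = BU * kU" "seg 6 f = BV * kV" by simp_all
qed

text \<open>The seven terms lie in seven different classes. This turns one identity of series into
  seven equations for coefficients.\<close>

lemma comb_unique:
  assumes "K.comb A0 AU AV AW BU BV BW = K.comb A0' AU' AV' AW' BU' BV' BW'"
    and "graded 0 A0" "graded 0 AU" "graded 0 AV" "graded 0 AW" "graded 0 BU" "graded 0 BV" "graded 0 BW"
    and "graded 0 A0'" "graded 0 AU'" "graded 0 AV'" "graded 0 AW'" "graded 0 BU'" "graded 0 BV'" "graded 0 BW'"
  shows "A0 = A0'" "AU = AU'" "AV = AV'" "AW = AW'" "BU = BU'" "BV = BV'" "BW = BW'"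
  using seg_comb[OF assms(2-8)] seg_comb[OF assms(9-15)] unfolding assms(1) using b_nonzero by auto

lemma ph_0_nonzero [simp]: "ph 0 \<noteq> 0"
proof -
  have "Ph \<noteq> 0" using Ph_mult by auto
  thus ?thesis unfolding ph_0 using dil_inj[of 49 Ph 0] by (simp add: dil_0)
qed

text \<open>The factors are matched so that everything has class 0. Doubling sends the classes of
  kV, kW, kU to those of kU, kV, kW, which explains the cyclic shift in the g.\<close>

definition "eU = ph 2 / ph 0 * kU"
definition "eV = ph 1 / ph 0 * kV"
definition "eW = ph 4 / ph 0 * kW"
definition "gU = dil 2 kV / kU"
definition "gV = dil 2 kW / kV"
definition "gW = dil 2 kU / kW"

lemma graded_e: "graded 0 eU" "graded 0 eV" "graded 0 eW"
  unfolding eU_def eV_def eW_def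
  by (rule graded_cong, (rule graded_k graded_mult graded_divide graded_ph)+, simp)+

lemma graded_g: "graded 0 gU" "graded 0 gV" "graded 0 gW"
  unfolding gU_def gV_def gW_def
  by (rule graded_cong, rule graded_divide[OF graded_dil graded_k(1)] graded_divide[OF graded_dil graded_k(2)]
       graded_divide[OF graded_dil graded_k(3)], simp, rule graded_k, simp)+

lemma r_comb: "Ph / ph 0 = K.comb 1 eU eV eW 0 0 0"
proof -
  have b: "kU * K.bU = 1" "kV * K.bV = 1" "kW * K.bW = 1" using K.basis_mult by (simp_all add: mult.commute)
  have "Ph / ph 0 = 1 + ph 2 / ph 0 + ph 1 / ph 0 + ph 4 / ph 0"
    unfolding Ph_split[of] by (simp add: add_divide_distrib)
  thus ?thesis unfolding K.comb_def eU_def eV_def eW_def mult.assoc b by simp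
qed

lemma s_eq: "E 1 / u 2 = K.s"
  unfolding E1_split K.s_def by (simp add: add_divide_distrib kU_def kV_def kW_def)

lemma sg_comb: "E 2 / dil 2 (u 2) = K.comb 1 0 0 0 gU gV gW"
proof -
  have "E 2 / dil 2 (u 2) = dil 2 (E 1 / u 2)" by (simp add: dil_divide dil_E)
  also have "\<dots> = 1 + dil 2 kU + dil 2 kV + dil 2 kW"
    unfolding s_eq K.s_def by (simp add: dil_add dil_1)
  finally show ?thesis by (simp add: K.comb_def gU_def gV_def gW_def)
qed

lemma dil_2_u_2: "dil 2 (u 2) = - (X ^ 4 * E 98)"
  by (simp add: u_2 dil_minus dil_mult dil_X_power dil_E)

lemma ph_0_eq: "ph 0 = E 49 ^ 2 / E 98"
proof -
  have "dil 49 (Ph * E 2) = dil 49 (E 1 ^ 2)" by (simp only: Ph_mult)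
  hence "ph 0 * E 98 = E 49 ^ 2" unfolding ph_0 by (simp add: dil_mult dil_power dil_E)
  thus ?thesis by (simp add: field_simps)
qed

lemma Ph_eq: "Ph = E 1 ^ 2 / E 2"
  using Ph_mult by (simp add: field_simps)

lemma r_sg: "(Ph / ph 0) * (E 2 / dil 2 (u 2)) = - (K.s ^ 2)"
  unfolding s_eq[symmetric] ph_0_eq Ph_eq dil_2_u_2 unfolding u_2
  by (simp add: field_simps power2_eq_square power4_eq_xxxx)

lemma dil_nonzero: "d > 0 \<Longrightarrow> f \<noteq> 0 \<Longrightarrow> dil d f \<noteq> 0"
  using dil_inj[of d f 0] by (simp add: dil_0)

lemma fls_nth_0_mult: "fls_subdegree f > 0 \<Longrightarrow> fls_subdegree g \<ge> 0 \<Longrightarrow> fls_nth (f * g) 0 = 0" for f g :: "complex fls"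
  by (rule fls_times_nth_eq0) simp

text \<open>A component of class c has order at least c, and by the product relation the three
  orders add up to 6 = 0 + 1 + 5.\<close>

lemma u_subdegree: "fls_subdegree (u 0) = 0" "fls_subdegree (u 1) = 1" "fls_subdegree (u 5) = 5"
proof -
  have ge: "fls_subdegree (u (int c)) \<ge> int c" if "u (int c) \<noteq> 0" "c < 7" for c
  proof (rule fls_subdegree_geI[OF that(1)])
    fix k assume k: "k < int c"
    have "k \<ge> 0 \<Longrightarrow> k mod 7 = k" using k that(2) by (intro mod_pos_pos_trivial) auto
    moreover have "int c mod 7 = int c" using that(2) by simp
    ultimately show "fls_nth (u (int c)) k = 0" using k by (cases "k < 0") (auto simp: u_def E_nth)
  qed
  have "fls_subdegree (u 0 * u 1 * u 5) = fls_subdegree (u 2 ^ 3)" by (simp only: klein_u(1))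
  hence "fls_subdegree (u 0) + fls_subdegree (u 1) + fls_subdegree (u 5) = 6"
    using u_nonzero by (simp add: u_2 power3_eq_cube power2_eq_square)
  thus "fls_subdegree (u 0) = 0" "fls_subdegree (u 1) = 1" "fls_subdegree (u 5) = 5"
    using ge[of 0] ge[of 1] ge[of 5] u_nonzero by simp_all
qed

lemma ph_subdegree: "fls_subdegree (ph 1) = 1" "fls_subdegree (ph 4) = 4" "fls_subdegree (ph 2) = 9" "fls_subdegree (ph 0) = 0"
proof -
  show "fls_subdegree (ph 1) = 1" "fls_subdegree (ph 4) = 4" "fls_subdegree (ph 2) = 9"
    by (simp_all add: ph_124)
  have "fls_subdegree (ph 0 * E 98) = fls_subdegree (E 49 ^ 2)" by (simp add: ph_0_eq)
  thus "fls_subdegree (ph 0) = 0" by (simp add: power2_eq_square)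
qed

lemma ph_nonzero: "ph 1 \<noteq> 0" "ph 4 \<noteq> 0" "ph 2 \<noteq> 0"
  by (simp_all add: ph_124)

lemma e_nonzero: "eU \<noteq> 0" "eV \<noteq> 0" "eW \<noteq> 0"
  using ph_nonzero by (simp_all add: eU_def eV_def eW_def)

text \<open>At X = 0 eU and eW vanish and eV does not; this is how the nonvanishing conditions of
  \<open>klein_curve\<close> are verified.\<close>

lemma e_subdegree: "fls_subdegree eU = 7" "fls_subdegree eV = 0" "fls_subdegree eW = 7"
proof -
  have u2: "fls_subdegree (u 2) = 2" by (simp add: u_2 power2_eq_square)
  have "eU * (ph 0 * u 2) = ph 2 * u 0" "eV * (ph 0 * u 2) = ph 1 * u 1" "eW * (ph 0 * u 2) = ph 4 * u 5"
    by (simp_all add: eU_def eV_def eW_def kU_def kV_def kW_def)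
  from this[THEN arg_cong[where f = fls_subdegree]]
  show "fls_subdegree eU = 7" "fls_subdegree eV = 0" "fls_subdegree eW = 7"
    using e_nonzero u_nonzero ph_nonzero by (simp_all add: u_subdegree ph_subdegree u2)
qed

lemma graded_0_closed:
  "graded 0 0" "graded 0 1" "graded 0 (numeral n)"
  "graded 0 f \<Longrightarrow> graded 0 g \<Longrightarrow> graded 0 (f + g)"
  "graded 0 f \<Longrightarrow> graded 0 g \<Longrightarrow> graded 0 (f - g)"
  "graded 0 f \<Longrightarrow> graded 0 g \<Longrightarrow> graded 0 (f * g)"
  "graded 0 f \<Longrightarrow> graded 0 (- f)"
  using graded_mult[of 0 f 0 g]
  by (simp_all add: graded_1 graded_numeral graded_add graded_diff graded_minus) (simp add: graded_def)

interpretation D: dissection kU kV kW eU eV eW gU gV gW "{f. graded 0 f}" "seg 0"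
proof -
  note cl = graded_0_closed graded_e graded_g graded_z
  have n: "- (K.s ^ 2) = K.comb (- 1) (- 2) (- 2) (- 2) (- 2 - K.zV) (- 2 - K.zW) (- 2 - K.zU)"
    unfolding K.s2_comb K.comb_def by algebra
  have "K.comb 1 eU eV eW 0 0 0 * K.comb 1 0 0 0 gU gV gW =
      K.comb (- 1) (- 2) (- 2) (- 2) (- 2 - K.zV) (- 2 - K.zW) (- 2 - K.zU)"
    using r_sg unfolding r_comb sg_comb n .
  note eqs = comb_unique[OF this[unfolded K.comb_mult], simplified cl simp_thms True_implies_equals]
  have e0: "fls_nth eU 0 = 0" "fls_nth eW 0 = 0" "fls_nth eV 0 \<noteq> 0"
    using e_subdegree e_nonzero nth_fls_subdegree_nonzero[of eV] by (simp_all add: fls_eq0_below_subdegree)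
  show "dissection kU kV kW eU eV eW gU gV gW {f. graded 0 f} (seg 0)"
  proof unfold_locales
    show "eU + K.zU * eW * gU = - 2" "eV + K.zV * eU * gV = - 2" "eW + K.zW * eV * gW = - 2"
      "gU + (- 1 - K.zV) * eU * gW = - 2 - K.zV" "gV + (- 1 - K.zW) * eV * gU = - 2 - K.zW"
      "gW + (- 1 - K.zU) * eW * gV = - 2 - K.zU"
      using eqs by (simp_all add: mult.assoc)
    have "gU * gV * gW = dil 2 (kU * kV * kW) / (kU * kV * kW)"
      by (simp add: gU_def gV_def gW_def dil_mult field_simps)
    thus "gU * gV * gW = 1" by (simp add: K.UVW dil_1)
    show "eU \<noteq> 0" "eV \<noteq> 0" "eW \<noteq> 0" by (rule e_nonzero)+
    have nz: "fls_nth f 0 \<noteq> 0 \<Longrightarrow> f \<noteq> 0" for f :: "complex fls" by auto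
    show "2 + eU \<noteq> 0" "2 + eW \<noteq> 0" by (rule nz, simp add: e0)+
    show "eV \<noteq> eU" "eV \<noteq> eW" using e0 by auto
    have "fls_nth (eW * (1 + eU)) 0 = 0" "fls_nth (eW^2 * eU) 0 = 0"
    proof -
      have "eW * (1 + eU) = eW + eW * eU" by algebra
      moreover have "fls_nth (eW * eU) 0 = 0" by (rule fls_nth_0_mult) (simp_all add: e_subdegree)
      ultimately show "fls_nth (eW * (1 + eU)) 0 = 0" using e0 by simp
      have "fls_nth (eW * (eW * eU)) 0 = 0"
        by (rule fls_nth_0_mult) (use e_nonzero in \<open>simp_all add: e_subdegree\<close>)
      thus "fls_nth (eW^2 * eU) 0 = 0" by (simp add: power2_eq_square mult.assoc)
    qed
    hence "fls_nth (of_int 8 + of_int 4 * eU + of_int 4 * (eW * (1 + eU)) + eW^2 * eU) 0 = 8"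
      by (simp add: e0 fls_of_int)
    hence "of_int 8 + of_int 4 * eU + of_int 4 * (eW * (1 + eU)) + eW^2 * eU \<noteq> 0" by (metis fls_zero_nth zero_neq_numeral)
    moreover have "of_int 8 + of_int 4 * eU + of_int 4 * (eW * (1 + eU)) + eW^2 * eU =
       4*(2+eU) + 4*eW*(1+eU) + eW^2*eU" by (simp add: algebra_simps)
    ultimately show "4*(2+eU) + 4*eW*(1+eU) + eW^2*eU \<noteq> 0" by metis
  qed (use cl seg_comb(1) in auto)
qed

subsection \<open>The norm of the Euler product\<close>

definition rotn :: "nat \<Rightarrow> complex fls \<Rightarrow> complex fls" where
  "rotn k f = fls_compose_fps f (fps_const (\<zeta> ^ k) * fps_X)"

lemma rotn_nth: "fls_nth (rotn k f) n = fls_nth f n * \<zeta> powi (int k * n)"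
proof -
  have "\<zeta> powi (int k * n) = (\<zeta> ^ k) powi n" by (simp add: power_int_mult)
  thus ?thesis unfolding rotn_def by (subst fls_nth_fls_compose_fps_linear) simp_all
qed

lemma rotn_mult: "rotn k (f * g) = rotn k f * rotn k g"
  and rotn_add: "rotn k (f + g) = rotn k f + rotn k g"
  and rotn_diff: "rotn k (f - g) = rotn k f - rotn k g"
  and rotn_power: "rotn k (f ^ n) = rotn k f ^ n"
  and rotn_0: "rotn k 0 = 0"
  unfolding rotn_def
  by (simp_all add: fls_compose_fps_mult fls_compose_fps_add fls_compose_fps_diff fls_compose_fps_power)

lemma rotn_graded: "graded i f \<Longrightarrow> rotn k f = fls_const (\<zeta> powi (int k * i)) * f"
proof (rule fls_eqI)
  fix n assume g: "graded i f"
  have "(int k * n) mod 7 = (int k * i) mod 7" if "n mod 7 = i mod 7"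
    using that by (metis mod_mult_right_eq)
  hence "fls_nth f n \<noteq> 0 \<Longrightarrow> \<zeta> powi (int k * n) = \<zeta> powi (int k * i)"
    using g by (auto simp: zeta_powi_eq_iff graded_def)
  thus "fls_nth (rotn k f) n = fls_nth (fls_const (\<zeta> powi (int k * i)) * f) n"
    by (cases "fls_nth f n = 0") (simp_all add: rotn_nth)
qed

lemma rotn_graded_0: "graded 0 f \<Longrightarrow> rotn k f = f"
  using rotn_graded[of 0 f k] by simp

lemma graded_tau: "graded 0 K.tau"
  unfolding K.tau_def by (intro graded_0_closed graded_z)

lemma rotn_s_equation:
  "rotn k K.s ^ 7 - 7 * rotn k K.s ^ 6 + 21 * rotn k K.s ^ 5 - 49 * rotn k K.s ^ 4 + (7 * K.tau + 147) * rotn k K.s ^ 3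
    - (35 * K.tau + 343) * rotn k K.s ^ 2 + (49 * K.tau + 343) * rotn k K.s + K.tau ^ 2 = 0"
  using K.s_equation[THEN arg_cong[where f = "rotn k"]]
  by (simp add: rotn_add rotn_diff rotn_mult rotn_power rotn_0 rotn_graded_0 graded_0_closed graded_tau)

lemma s_subdegree: "fls_subdegree K.s = - 2" and s_nonzero: "K.s \<noteq> 0"
proof -
  have "K.s * u 2 = E 1" by (simp add: s_eq[symmetric])
  moreover show "K.s \<noteq> 0" by (simp add: s_eq[symmetric])
  ultimately have "fls_subdegree K.s + fls_subdegree (u 2) = 0"
    using fls_subdegree_mult[of K.s "u 2"] by simp
  thus "fls_subdegree K.s = - 2" by (simp add: u_2 power2_eq_square)
qed

lemma rotn_s_inj: "inj_on (\<lambda>k. rotn k K.s) {..<7}"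
proof (rule inj_onI)
  fix k l assume kl: "k \<in> {..<7}" "l \<in> {..<7}" and "rotn k K.s = rotn l K.s"
  hence "fls_nth (rotn k K.s) (- 2) = fls_nth (rotn l K.s) (- 2)" by simp
  moreover have "fls_nth K.s (- 2) \<noteq> 0" using nth_fls_subdegree_nonzero[OF s_nonzero] by (simp add: s_subdegree)
  ultimately have "(int k * - 2) mod 7 = (int l * - 2) mod 7"
    by (simp add: rotn_nth zeta_powi_eq_iff)
  \<comment> \<open>The leading coefficient at X^(-2) is multiplied by \<zeta>^(-2*k), and 3 is the
    inverse of -2 modulo 7.\<close>
  hence "(3 * (int k * - 2)) mod 7 = (3 * (int l * - 2)) mod 7" by (metis mod_mult_right_eq)
  moreover have "3 * (int m * - 2) = int m + 7 * (- int m)" for m by simp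
  ultimately have "int k mod 7 = int l mod 7" by (metis mod_mult_self2)
  thus "k = l" using kl by simp
qed

text \<open>The rotations of s are seven distinct roots of \<open>s_equation\<close>, whose
  coefficients are invariant under rotation. They exhaust the roots, and the degree is odd, so their
  product is minus the constant term.\<close>

lemma prod_rotn_s: "(\<Prod>k<7. rotn k K.s) = - (K.tau ^ 2)"
proof -
  define p where "p = [:K.tau ^ 2, 49 * K.tau + 343, - (35 * K.tau + 343), 7 * K.tau + 147, - 49, 21, - 7, 1:]"
  define q where "q = (\<Prod>k<7. [:- rotn k K.s, 1:])"
  have root: "poly p (rotn k K.s) = 0" for k
    using rotn_s_equation[of k] unfolding p_def by (simp add: algebra_simps power_numeral_reduce)
  have dq: "degree q = 7" unfolding q_def by (subst degree_prod_eq_sum_degree) auto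
  have "p = q"
  proof (rule poly_eqI_degree_lead_coeff[where n = 7 and A = "(\<lambda>k. rotn k K.s) ` {..<7}"])
    show "poly p z = poly q z" if "z \<in> (\<lambda>k. rotn k K.s) ` {..<7}" for z
      using that root by (auto simp: q_def poly_prod intro!: prod_zero[symmetric])
    show "card ((\<lambda>k. rotn k K.s) ` {..<7}) \<ge> 7" using rotn_s_inj by (simp add: card_image)
    show "degree p \<le> 7" "degree q \<le> 7" by (simp_all add: p_def dq)
    have "lead_coeff q = 1" unfolding q_def by (simp add: lead_coeff_prod)
    thus "coeff p 7 = coeff q 7" unfolding dq by (simp add: p_def eval_nat_numeral)
  qed
  hence "poly p 0 = poly q 0" by simp
  hence "K.tau ^ 2 = (\<Prod>k<7. - rotn k K.s)" by (simp add: p_def q_def poly_prod)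
  also have "\<dots> = (- 1) ^ 7 * (\<Prod>k<7. rotn k K.s)"
    using prod_uminus[of "\<lambda>k. rotn k K.s" "{..<7}"] by simp
  finally show ?thesis by simp
qed

lemma prod_one_minus_zeta: "(\<Prod>k<7. 1 - fps_const (\<zeta> ^ k) * Y) = 1 - Y ^ 7" for Y :: "complex fps"
proof -
  define p :: "complex fps poly" where "p = [:1, 0, 0, 0, 0, 0, 0, - 1:]"
  define q :: "complex fps poly" where "q = (\<Prod>k<7. [:1, - fps_const (\<zeta> ^ k):])"
  have nz: "fps_const (\<zeta> ^ k) \<noteq> 0" for k by simp
  have dq: "degree q = 7" unfolding q_def by (subst degree_prod_eq_sum_degree) (auto simp: nz)
  have "p = q"
  proof (rule poly_eqI_degree_lead_coeff[where n = 7 and A = "(\<lambda>j. fps_const (\<zeta> ^ j)) ` {..<7}"])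
    show "poly p z = poly q z" if z: "z \<in> (\<lambda>j. fps_const (\<zeta> ^ j)) ` {..<7}" for z
    proof -
      obtain j where j: "z = fps_const (\<zeta> ^ j)" "j < 7" using z by auto
      define k where "k = (7 - j) mod 7"
      have "\<zeta> ^ j * \<zeta> ^ k = 1"
      proof (cases "j = 0")
        case False
        hence "k = 7 - j" by (simp add: k_def)
        hence "j + k = 7" using j by simp
        thus ?thesis using zeta_power_7 by (metis power_add)
      qed (simp add: k_def)
      hence "1 - z * fps_const (\<zeta> ^ k) = 0" by (simp add: j)
      moreover have "k \<in> {..<7}" by (simp add: k_def)
      moreover have "poly [:1, - fps_const (\<zeta> ^ k):] z = 1 - z * fps_const (\<zeta> ^ k)"
        by (simp del: fps_const_neg)
      ultimately have "poly [:1, - fps_const (\<zeta> ^ k):] z = 0" "k \<in> {..<7}" by simp_all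
      hence "poly q z = 0" unfolding q_def poly_prod by (intro prod_zero bexI[of _ k]) simp_all
      moreover have "z ^ 7 = 1"
        unfolding j fps_const_power power_mult[symmetric] mult.commute[of j] by (simp add: power_mult zeta_power_7)
      hence "poly p z = 0" by (simp add: p_def eval_nat_numeral)
      ultimately show ?thesis by simp
    qed
    have "inj_on (\<lambda>j. fps_const (\<zeta> ^ j)) {..<7}" using zeta_power_inj by (auto simp: inj_on_def)
    thus "card ((\<lambda>j. fps_const (\<zeta> ^ j)) ` {..<7}) \<ge> 7" by (simp add: card_image)
    show "degree p \<le> 7" "degree q \<le> 7" by (simp_all add: p_def dq)
    have "(\<Prod>k<7. - fps_const (\<zeta> ^ k)) = - fps_const ((\<zeta> ^ 7) ^ 3)"
      by (simp add: eval_nat_numeral lessThan_Suc mult_ac)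
    hence "lead_coeff q = - 1" unfolding q_def by (simp add: lead_coeff_prod zeta_power_7)
    thus "coeff p 7 = coeff q 7" unfolding dq by (simp add: p_def eval_nat_numeral)
  qed
  moreover have "poly p Y = 1 - Y ^ 7" by (simp add: p_def eval_nat_numeral)
  moreover have "poly q Y = (\<Prod>k<7. 1 - fps_const (\<zeta> ^ k) * Y)"
    unfolding q_def poly_prod by (rule prod.cong) (simp_all add: mult.commute del: fps_const_neg)
  ultimately show ?thesis by simp
qed

text \<open>Multiplication by m permutes the residues modulo 7 unless 7 divides m, in which case all
  seven factors coincide.\<close>

lemma prod_one_minus_zeta_power:
  "(\<Prod>k<7. 1 - fps_const (\<zeta> ^ (k * m)) * Y) = (if 7 dvd m then (1 - Y) ^ 7 else 1 - Y ^ 7)" for Y :: "complex fps" and m :: nat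
proof (cases "7 dvd m")
  case True
  then obtain l where "m = 7 * l" by (auto elim: dvdE)
  hence "\<zeta> ^ (k * m) = 1" for k
    using power_mult[of \<zeta> 7 "k * l"] by (simp add: zeta_power_7 mult_ac)
  thus ?thesis using True by simp
next
  case False
  have z: "\<zeta> ^ j = \<zeta> ^ (j mod 7)" for j
    using power_add[of \<zeta> "7 * (j div 7)" "j mod 7"] by (simp add: power_mult zeta_power_7)
  have cop: "coprime m 7" using False prime_imp_coprime[of 7 m] by (simp add: coprime_commute)
  have inj: "inj_on (\<lambda>k. (k * m) mod 7) {..<7}"
  proof (rule inj_onI)
    fix k l assume kl: "k \<in> {..<7}" "l \<in> {..<7}" and e: "(k * m) mod 7 = (l * m) mod 7"
    from e have "[k = l] (mod 7)" using cong_mult_rcancel_nat[OF cop, of k l] unfolding cong_def by simp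
    thus "k = l" using kl by (simp add: cong_def)
  qed
  have "(\<lambda>k. (k * m) mod 7) ` {..<7} = {..<7}"
    by (rule card_subset_eq) (auto simp: card_image[OF inj])
  hence "(\<Prod>k<7. 1 - fps_const (\<zeta> ^ k) * Y) = (\<Prod>k\<in>(\<lambda>k. (k * m) mod 7) ` {..<7}. 1 - fps_const (\<zeta> ^ k) * Y)"
    by simp
  also have "\<dots> = (\<Prod>k<7. 1 - fps_const (\<zeta> ^ (k * m)) * Y)"
    by (subst prod.reindex[OF inj]) (simp add: z[symmetric])
  finally show ?thesis using False prod_one_minus_zeta[of Y] by simp
qed

definition fps_rot :: "nat \<Rightarrow> complex fps \<Rightarrow> complex fps" where
  "fps_rot k f = f oo (fps_const (\<zeta> ^ k) * fps_X)"

lemma agree_fps_rot: "agree n f g \<Longrightarrow> agree n (fps_rot k f) (fps_rot k g)"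
  by (auto simp: agree_def fps_rot_def fps_compose_linear)

lemma fps_rot_factor: "fps_rot k (1 - fps_X ^ m) = 1 - fps_const (\<zeta> ^ (k * m)) * fps_X ^ m"
  by (simp add: fps_rot_def fps_compose_sub_distrib fps_compose_power[symmetric] power_mult_distrib fps_const_power power_mult)

lemma rotn_fps_to_fls: "rotn k (fps_to_fls f) = fps_to_fls (fps_rot k f)"
  by (simp add: rotn_def fps_rot_def)

text \<open>An index m prime to 7 contributes 1 - X^(7*m), a multiple of 7 contributes the seventh
  power of 1 - X^m. The factors 1 - X^(7*m) still missing are those with 7 dividing m, and they form
  the Euler product at X^49.\<close>

lemma norm_euler:
  "(\<Prod>k<7. fps_rot k (euler {m. 1 dvd m})) * euler {m. 49 dvd m} = euler {m. 7 dvd m} ^ 8"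
proof (rule agree_all_imp_eq)
  fix n :: nat
  let ?A = "{1..n}" and ?B = "{m. 7 dvd m} \<inter> {1..n}"
  let ?F = "\<lambda>m. 1 - fps_X ^ m :: complex fps"
  have 1: "agree n (\<Prod>k<7. fps_rot k (euler {m. 1 dvd m})) (\<Prod>k<7. fps_rot k (\<Prod>m\<in>?A. ?F m))"
  proof (intro agree_prod agree_fps_rot)
    have "{m::nat. 1 dvd m} \<inter> {1..n} = {1..n}" by auto
    thus "agree n (euler {m. 1 dvd m}) (\<Prod>m\<in>?A. ?F m)" using agree_euler_atMost[of n "{m. 1 dvd m}", where 'a = complex] by simp
  qed
  have 2: "agree n (euler {m. 49 dvd m}) (\<Prod>m\<in>?B. ?F (7 * m))"
  proof -
    have inj: "inj_on ((*) 7) ?B" by (auto simp: inj_on_def)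
    have "agree n (euler {m. 49 dvd m}) (\<Prod>m\<in>(*) 7 ` ?B. ?F m)"
    proof (rule agree_euler)
      show "{m. 49 dvd m} \<inter> {1..n} \<subseteq> (*) 7 ` ?B"
      proof
        fix m assume m: "m \<in> {m. 49 dvd m} \<inter> {1..n}"
        then obtain l where l: "m = 49 * l" by (auto elim: dvdE)
        hence "m = 7 * (7 * l)" "7 * l \<in> ?B" using m by auto
        thus "m \<in> (*) 7 ` ?B" by blast
      qed
      show "(*) 7 ` ?B \<subseteq> {m. 49 dvd m}" by (auto elim!: dvdE)
    qed auto
    thus ?thesis unfolding prod.reindex[OF inj] o_def .
  qed
  have 3: "agree n (euler {m. 7 dvd m}) (\<Prod>m\<in>?A. ?F (7 * m))"
  proof -
    have inj: "inj_on ((*) 7) ?A" by (auto simp: inj_on_def)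
    have "agree n (euler {m. 7 dvd m}) (\<Prod>m\<in>(*) 7 ` ?A. ?F m)"
    proof (rule agree_euler)
      show "{m. 7 dvd m} \<inter> {1..n} \<subseteq> (*) 7 ` ?A"
      proof
        fix m assume m: "m \<in> {m. 7 dvd m} \<inter> {1..n}"
        then obtain l where l: "m = 7 * l" by (auto elim: dvdE)
        hence "l \<in> ?A" using m by auto
        thus "m \<in> (*) 7 ` ?A" using l by blast
      qed
    qed auto
    thus ?thesis unfolding prod.reindex[OF inj] o_def .
  qed
  have 4: "agree n (euler {m. 7 dvd m}) (\<Prod>m\<in>?B. ?F m)" by (rule agree_euler_atMost)
  have "(\<Prod>k<7. fps_rot k (\<Prod>m\<in>?A. ?F m)) = (\<Prod>k<7. \<Prod>m\<in>?A. 1 - fps_const (\<zeta> ^ (k * m)) * fps_X ^ m)"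
    by (rule prod.cong) (simp_all add: fps_rot_def fps_compose_prod_distrib fps_rot_factor[unfolded fps_rot_def])
  also have "\<dots> = (\<Prod>m\<in>?A. \<Prod>k<7. 1 - fps_const (\<zeta> ^ (k * m)) * fps_X ^ m)" by (rule prod.swap)
  also have "\<dots> = (\<Prod>m\<in>?A. if 7 dvd m then ?F m ^ 7 else ?F (7 * m))"
  proof (rule prod.cong)
    have "?F (7 * m) = 1 - (fps_X ^ m) ^ 7" for m by (simp add: mult.commute[of 7] power_mult)
    thus "(\<Prod>k<7. 1 - fps_const (\<zeta> ^ (k * m)) * fps_X ^ m) = (if 7 dvd m then ?F m ^ 7 else ?F (7 * m))" for m
      by (simp only: prod_one_minus_zeta_power)
  qed simp
  also have "\<dots> = (\<Prod>m\<in>?B. ?F m ^ 7) * (\<Prod>m\<in>?A - ?B. ?F (7 * m))"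
    by (subst prod.If_cases) (auto intro!: arg_cong2[where f = "(*)"] prod.cong)
  finally have "(\<Prod>k<7. fps_rot k (\<Prod>m\<in>?A. ?F m)) * (\<Prod>m\<in>?B. ?F (7 * m)) =
     (\<Prod>m\<in>?B. ?F m) ^ 7 * ((\<Prod>m\<in>?A - ?B. ?F (7 * m)) * (\<Prod>m\<in>?B. ?F (7 * m)))"
    by (simp add: prod_power_distrib mult_ac)
  also have "(\<Prod>m\<in>?A - ?B. ?F (7 * m)) * (\<Prod>m\<in>?B. ?F (7 * m)) = (\<Prod>m\<in>?A. ?F (7 * m))"
    by (rule prod.subset_diff[symmetric]) auto
  finally have 5: "(\<Prod>k<7. fps_rot k (\<Prod>m\<in>?A. ?F m)) * (\<Prod>m\<in>?B. ?F (7 * m)) =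
     (\<Prod>m\<in>?B. ?F m) ^ 7 * (\<Prod>m\<in>?A. ?F (7 * m))" .
  have pw: "agree n (f ^ k) (g ^ k)" if "agree n f g" for f g :: "complex fps" and k
    using that by (induction k) (auto intro: agree_mult)
  have "agree n ((\<Prod>k<7. fps_rot k (euler {m. 1 dvd m})) * euler {m. 49 dvd m})
     ((\<Prod>m\<in>?B. ?F m) ^ 7 * (\<Prod>m\<in>?A. ?F (7 * m)))"
    using agree_mult[OF 1 2] unfolding 5 .
  moreover have "agree n (euler {m. 7 dvd m} ^ 7 * euler {m. 7 dvd m}) ((\<Prod>m\<in>?B. ?F m) ^ 7 * (\<Prod>m\<in>?A. ?F (7 * m)))"
    by (intro agree_mult pw 3 4)
  moreover have "euler {m. 7 dvd m} ^ 8 = euler {m. 7 dvd m} ^ 7 * (euler {m. 7 dvd m} :: complex fps)"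
    by (simp add: eval_nat_numeral mult_ac)
  ultimately show "agree n ((\<Prod>k<7. fps_rot k (euler {m. 1 dvd m})) * euler {m. 49 dvd m}) (euler {m. 7 dvd m} ^ 8)"
    using agree_trans[OF _ agree_sym] by simp
qed

lemma norm_E: "(\<Prod>k<7. rotn k (E 1)) * E 49 = E 7 ^ 8"
proof -
  have "fps_to_fls (\<Prod>k\<in>A. f k) = (\<Prod>k\<in>A. fps_to_fls (f k))" for f :: "nat \<Rightarrow> complex fps" and A
    by (induction A rule: infinite_finite_induct) (simp_all add: fls_times_fps_to_fls)
  hence "(\<Prod>k<7. rotn k (E 1)) * E 49 = fps_to_fls ((\<Prod>k<7. fps_rot k (euler {m. 1 dvd m})) * euler {m. 49 dvd m})"
    by (simp only: fls_times_fps_to_fls E_def rotn_fps_to_fls)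
  also have "\<dots> = E 7 ^ 8" unfolding norm_euler E_def fps_to_fls_power ..
  finally show ?thesis .
qed

lemma zeta_power_42: "\<zeta> ^ 42 = 1"
  using power_mult[of \<zeta> 7 6] by (simp add: zeta_power_7)

text \<open>The norm of J_1 is divided by that of u_2, a homogeneous series whose rotations
  contribute only the root of unity \<zeta>^42 = 1. The norm of s yields tau^2 and leaves the sign
  open.\<close>

lemma tau_square: "K.tau ^ 2 = (E 7 ^ 4 / (X ^ 7 * E 49 ^ 4)) ^ 2"
proof -
  have "(\<Prod>k<7. rotn k (u 2)) = (\<Prod>k<7. fls_const (\<zeta> powi (int k * 2)) * u 2)"
    by (simp add: rotn_graded[OF graded_u])
  also have "\<dots> = fls_const (\<Prod>k<7. \<zeta> powi (int k * 2)) * u 2 ^ 7"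
    by (simp add: eval_nat_numeral lessThan_Suc mult_ac)
  also have "(\<Prod>k<7::nat. \<zeta> powi (int k * 2)) = \<zeta> powi 42"
    by (simp add: eval_nat_numeral lessThan_Suc flip: power_int_add)
  finally have n: "(\<Prod>k<7. rotn k (u 2)) = u 2 ^ 7" by (simp add: zeta_power_42)
  have "E 1 = K.s * u 2" by (simp add: s_eq[symmetric])
  hence "(\<Prod>k<7. rotn k (E 1)) = - (K.tau ^ 2) * u 2 ^ 7"
    by (simp add: rotn_mult prod.distrib prod_rotn_s n)
  hence "K.tau ^ 2 * (X ^ 14 * E 49 ^ 8) = E 7 ^ 8"
    using norm_E unfolding u_2 by (simp add: eval_nat_numeral mult_ac)
  moreover have "(E 7 ^ 4 / (X ^ 7 * E 49 ^ 4)) ^ 2 * (X ^ 14 * E 49 ^ 8) = E 7 ^ 8"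
    by (simp add: eval_nat_numeral)
  moreover have "X ^ 14 * E 49 ^ 8 \<noteq> 0" by simp
  ultimately show ?thesis using mult_right_cancel by metis
qed

text \<open>This settles the sign. Among the z only zU has a pole of order 7, and its leading
  coefficient is (-1)^3 * 1.\<close>

lemma tau_nth: "fls_nth K.tau (- 7) = 1"
proof -
  have s2: "fls_subdegree (u 2) = 2" by (simp add: u_2 power2_eq_square)
  have k: "fls_subdegree kU = - 2" "fls_subdegree kV = - 1" "fls_subdegree kW = 3"
    using u_nonzero by (simp_all add: kU_def kV_def kW_def fls_divide_subdegree u_subdegree s2)
  have z: "fls_subdegree K.zU = - 7" "fls_subdegree K.zV = 0" "fls_subdegree K.zW = 7"
    by (simp_all add: K.zU_def K.zV_def K.zW_def k power3_eq_cube)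
  have c0: "fls_nth (u 0) 0 = 1" by (simp add: u_def E_nth)
  have c1: "fls_nth (u 1) 1 = - 1" by (simp add: u_def E_nth euler_def)
  have c2: "fls_nth (u 2) 2 = - 1"
    using fls_times_base[of "X ^ 2" "E 49"] by (simp add: u_2 E_nth_0 fls_subdegree_pow)
  have kU: "fls_nth kU (- 2) = - 1"
    using fls_times_base[of kU "u 2"] by (simp add: k s2 c2 c0 u_eq(1)[symmetric] minus_equation_iff[of _ 1])
  have kV: "fls_nth kV (- 1) = 1"
    using fls_times_base[of kV "u 2"] by (simp add: k s2 c2 c1 u_eq(2)[symmetric])
  have "fls_nth (kU * kU) (- 4) = 1" using fls_times_base[of kU kU] by (simp add: k kU)
  hence "fls_nth (kU * kU * kU) (- 6) = - 1" using fls_times_base[of "kU * kU" kU] by (simp add: k kU)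
  hence "fls_nth (kU * kU * kU * kV) (- 7) = - 1" using fls_times_base[of "kU * kU * kU" kV] by (simp add: k kV)
  hence zU: "fls_nth K.zU (- 7) = - 1" by (simp add: K.zU_def power3_eq_cube)
  have 8: "fls_nth (of_int 8 :: complex fls) (- 7) = 0" unfolding fls_of_int by simp
  have "fls_nth K.zV (- 7) = 0" "fls_nth K.zW (- 7) = 0" using z by (simp_all add: fls_eq0_below_subdegree)
  moreover have "K.tau = - of_int 8 - K.zU - K.zV - K.zW" by (simp add: K.tau_def)
  ultimately show ?thesis using zU 8 by simp
qed

lemma tau_eq: "K.tau = E 7 ^ 4 / (X ^ 7 * E 49 ^ 4)"
proof -
  let ?T = "E 7 ^ 4 / (X ^ 7 * E 49 ^ 4)"
  have sub: "fls_subdegree ?T = - 7"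
    by (simp add: fls_divide_subdegree eval_nat_numeral)
  have p: "fls_nth (f ^ n) 0 = 1" if "fls_nth f 0 = 1" "fls_subdegree f = 0" for f :: "complex fls" and n
  proof (induction n)
    case (Suc n)
    have "f \<noteq> 0" using that by auto
    hence "fls_subdegree (f ^ n) = 0" by (simp add: fls_subdegree_pow that)
    thus ?case using Suc that fls_times_base[of f "f ^ n"] by simp
  qed simp
  have "?T * (X ^ 7 * E 49 ^ 4) = E 7 ^ 4" by simp
  moreover have "fls_subdegree (X ^ 7 * E 49 ^ 4) = 7" by (simp add: eval_nat_numeral)
  moreover have "fls_nth (X ^ 7 * E 49 ^ 4) 7 = 1"
    using fls_times_base[of "X ^ 7" "E 49 ^ 4"] by (simp add: p E_nth_0 fls_subdegree_pow)
  ultimately have "fls_nth ?T (- 7) = 1"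
    using fls_times_base[of ?T "X ^ 7 * E 49 ^ 4"] by (simp add: sub p E_nth_0)
  hence "K.tau \<noteq> - ?T" using tau_nth by (metis fls_uminus_nth one_neq_neg_one)
  thus ?thesis using tau_square power2_eq_iff by blast
qed

definition t :: "complex fls" where "t = X * E 7 ^ 4 / E 1 ^ 4"

text \<open>H/t at X^7 is \<open>D.eps\<close>, the product of the three e. The 8 is the product of
  the factors -2, 2, -2 in \<open>ph_124\<close>.\<close>

definition H :: "complex fls" where "H = 8 * X ^ 3 * E 14 ^ 7 / (E 1 ^ 3 * E 2 * E 7 ^ 3)"

lemma t_nonzero: "t \<noteq> 0" by (simp add: t_def)

lemma tau_t: "K.tau = inverse (dil 7 t)"
  using dil_X_power[of 7 1]
  by (simp add: tau_eq t_def dil_divide dil_mult dil_power dil_E divide_simps mult_ac)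

lemma eps_eq: "D.eps = 8 * X ^ 14 * E 7 * E 98 ^ 7 / (E 14 * E 49 ^ 7)"
proof -
  have "ph 1 * ph 2 * ph 4 = 8 * X ^ 14 * (E 7 * E 98 ^ 4) / (E 14 * E 49)"
    using ph_product by (simp add: field_simps)
  moreover have "D.eps = (ph 1 * ph 2 * ph 4) * (kU * kV * kW) / ph 0 ^ 3"
    unfolding D.eps_def unfolding eU_def eV_def eW_def by (simp add: field_simps power3_eq_cube)
  moreover have "8 * x * (e7 * e98 ^ 4) / (e14 * e49) * 1 / (e49 ^ 2 / e98) ^ 3 = 8 * x * e7 * e98 ^ 7 / (e14 * e49 ^ 7)"
    if "e14 \<noteq> 0" "e49 \<noteq> 0" "e98 \<noteq> 0" for x e7 e14 e49 e98 :: "complex fls"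
    using that by (simp add: divide_simps) (simp add: eval_nat_numeral mult_ac)
  ultimately show ?thesis unfolding K.UVW ph_0_eq by simp
qed

lemma eps_t: "D.eps = dil 7 (H / t)"
  using dil_X_power[of 7 1] unfolding eps_eq
  by (simp add: H_def t_def dil_divide dil_mult dil_power dil_numeral dil_E dil_X_power divide_simps)
    (simp add: eval_nat_numeral mult_ac)

lemma dil_2_tau: "dil 2 K.tau = E 14 ^ 4 / (X ^ 14 * E 98 ^ 4)"
  using dil_X_power[of 2 1] unfolding tau_eq
  by (simp add: dil_divide dil_mult dil_power dil_E flip: power_mult)

text \<open>The right-hand side is the eta quotient that appears when H*s^5 is divided by r. In the
  form on the left it is the image under X -> X^7 of a polynomial in 1/t and H/t, so it passes
  through \<open>U\<close> and stays inside the filtration.\<close>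

lemma Theta_eq: "8 * K.tau + 56 - 7 * D.eps = D.eps * dil 2 K.tau ^ 2 / K.tau"
proof -
  have g: "dil 2 kU = gW * kW" "dil 2 kV = gU * kU" "dil 2 kW = gV * kV"
    by (simp_all add: gU_def gV_def gW_def)
  have "dil 2 K.tau = - 8 - dil 2 kU ^ 3 * dil 2 kV - dil 2 kV ^ 3 * dil 2 kW - dil 2 kW ^ 3 * dil 2 kU"
    by (simp add: K.tau_def K.zU_def K.zV_def K.zW_def dil_diff dil_minus dil_mult dil_power dil_numeral)
  also have "\<dots> = - 8 - gW^3*gU*K.zW - gU^3*gV*K.zU - gV^3*gW*K.zV"
    unfolding g K.zU_def K.zV_def K.zW_def by algebra
  finally have "D.eps * dil 2 K.tau ^ 2 = 8 * K.tau ^ 2 + 56 * K.tau - 7 * D.eps * K.tau" by (rule D.P_tau2)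
  moreover have "K.tau \<noteq> 0" by (simp add: tau_eq)
  ultimately show ?thesis by (simp add: field_simps power2_eq_square)
qed

lemma r_eq: "D.r = Ph / ph 0" by (simp add: D.r_def r_comb)

lemma sg_eq: "D.sg = E 2 / dil 2 (u 2)" by (simp add: D.sg_def sg_comb)

definition \<phi> :: "complex fls" where "\<phi> = X ^ 2 * E 49 ^ 5 * E 2 ^ 2 / (E 98 ^ 2 * E 1 ^ 5)"

abbreviation "\<Theta> \<equiv> 8 * K.tau + 56 - 7 * D.eps"

lemma t_s: "t * K.s ^ 4 = K.tau"
proof -
  have "x * e7 ^ 4 / e1 ^ 4 * (e1 / - (x ^ 2 * e49)) ^ 4 = e7 ^ 4 / (x ^ 7 * e49 ^ 4)"
    if "x \<noteq> 0" "e1 \<noteq> 0" "e49 \<noteq> 0" for x e1 e7 e49 :: "complex fls"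
    using that by (simp add: divide_simps) (simp add: eval_nat_numeral mult_ac)
  thus ?thesis unfolding s_eq[symmetric] tau_eq u_2 t_def by simp
qed

lemma H_s: "H * K.s ^ 5 = - (\<Theta> * D.r)"
proof -
  have "8 * x ^ 3 * e14 ^ 7 / (e1 ^ 3 * e2 * e7 ^ 3) * (e1 / - (x ^ 2 * e49)) ^ 5 =
     - (8 * x ^ 14 * e7 * e98 ^ 7 / (e14 * e49 ^ 7) * (e14 ^ 4 / (x ^ 14 * e98 ^ 4)) ^ 2 / (e7 ^ 4 / (x ^ 7 * e49 ^ 4))
       * (e1 ^ 2 / e2 / (e49 ^ 2 / e98)))"
    if "x \<noteq> 0" "e1 \<noteq> 0" "e2 \<noteq> 0" "e7 \<noteq> 0" "e14 \<noteq> 0" "e49 \<noteq> 0" "e98 \<noteq> 0" for x e1 e2 e7 e14 e49 e98 :: "complex fls"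
    using that by (simp add: divide_simps) (simp add: eval_nat_numeral mult_ac)
  thus ?thesis unfolding Theta_eq dil_2_tau unfolding s_eq[symmetric] eps_eq tau_eq r_eq Ph_eq ph_0_eq u_2 H_def by simp
qed

lemma phi_s: "\<phi> * K.s ^ 5 = - (D.sg ^ 2)"
proof -
  have "x ^ 2 * e49 ^ 5 * e2 ^ 2 / (e98 ^ 2 * e1 ^ 5) * (e1 / - (x ^ 2 * e49)) ^ 5 = - ((e2 / - (x ^ 4 * e98)) ^ 2)"
    if "x \<noteq> 0" "e1 \<noteq> 0" "e49 \<noteq> 0" "e98 \<noteq> 0" for x e1 e2 e49 e98 :: "complex fls"
    using that by (simp add: divide_simps)
  thus ?thesis unfolding s_eq[symmetric] sg_eq dil_2_u_2 unfolding u_2 \<phi>_def by simp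
qed

lemma r_sg_s: "D.r * D.sg = - (K.s ^ 2)"
  unfolding r_eq sg_eq r_sg ..

text \<open>The product of \<open>H_s\<close> and \<open>phi_s\<close> contains r*sg^2; trading one
  r*sg for - s^2 lowers the power of s from 10 to 8. For \<open>phi_H2\<close> the same exchange
  lowers 13 to 11.\<close>

lemma phi_H: "\<phi> * H * K.s ^ 8 = - (\<Theta> * D.sg)"
proof -
  have "K.s ^ 2 * (\<phi> * H * K.s ^ 8) = K.s ^ 2 * (- (\<Theta> * D.sg))"
    using H_s phi_s r_sg_s by algebra
  thus ?thesis by (metis mult_left_cancel power_not_zero s_nonzero)
qed

lemma phi_H2: "\<phi> * H ^ 2 * K.s ^ 11 = - (\<Theta> ^ 2)"
proof -
  have "K.s ^ 2 * (\<phi> * H ^ 2 * K.s ^ 11) = K.s ^ 2 * (- (\<Theta> ^ 2))"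
    using H_s phi_H r_sg_s by algebra
  thus ?thesis by (metis mult_left_cancel power_not_zero s_nonzero)
qed

subsection \<open>The Atkin operator on the filtration\<close>

interpretation F: filtration t H
proof
  show "t \<noteq> 0" by (rule t_nonzero)
  have T: "dil 7 t \<noteq> 0" using dil_inj[of 7 t 0] t_nonzero by (simp add: dil_0)
  define a b where "a = D.eps" and "b = K.tau"
  have "b * dil 7 t = 1" "a * dil 7 t = dil 7 H"
    using T by (simp_all add: a_def b_def tau_t eps_t dil_divide)
  moreover have "a*b^2 - (2*a^2 - 9*a)*b + (a - 1)^2*(a - 8) = 0"
    using D.cubic by (simp add: a_def b_def)
  ultimately have "dil 7 H ^ 3 = 2 * dil 7 H ^ 2 - dil 7 H - 9 * dil 7 t * dil 7 H + 10 * dil 7 t * dil 7 H ^ 2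
     - 17 * dil 7 t ^ 2 * dil 7 H + 8 * dil 7 t ^ 3" by algebra
  hence "dil 7 (H^3) = dil 7 (2*H^2 - H - 9*t*H + 10*t*H^2 - 17*t^2*H + 8*t^3)"
    by (simp add: dil_add dil_diff dil_mult dil_power dil_numeral)
  thus "H^3 = 2*H^2 - H - 9*t*H + 10*t*H^2 - 17*t^2*H + 8*t^3" by (simp add: dil_inj)
qed

lemma dil_eps_tau: "dil 7 F.eps = D.eps" "dil 7 F.tau = K.tau"
  by (simp_all add: F.eps_def F.tau_def eps_t tau_t dil_inverse)

text \<open>The sign of the exponent makes k = -6, ..., 0 the range of polynomial powers of s; the
  recurrence then continues upwards, to the indices that powers of \<open>t\<close> require.\<close>

definition window :: "complex fls \<Rightarrow> int \<Rightarrow> complex fls" where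
  "window g k = U7 (g * K.s powi (- k))"

lemma recurrent_window: "F.recurrent (window g)"
  unfolding F.recurrent_def
proof
  fix k :: int
  define y T where "y = K.s powi (- (k + 7))" and "T = dil 7 t"
  have sp: "K.s powi (- (k + j)) = y * K.s ^ nat (7 - j)" if "j \<le> 7" for j
  proof -
    have "- (k + j) = - (k + 7) + int (nat (7 - j))" using that by simp
    thus ?thesis unfolding y_def using s_nonzero by (metis power_int_add power_int_of_nat)
  qed
  have "T \<noteq> 0" using dil_inj[of 7 t 0] t_nonzero by (simp add: dil_0 T_def)
  hence "K.tau * T = 1" by (simp add: tau_t T_def)
  hence "T^2 * K.s^7 - 7*T^2 * K.s^6 + 21*T^2 * K.s^5 - 49*T^2 * K.s^4 + (7*T + 147*T^2) * K.s^3
     - (35*T + 343*T^2) * K.s^2 + (49*T + 343*T^2) * K.s + 1 = 0" using K.s_equation by algebra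
  hence "g * y = - (T^2) * (g * (y * K.s^7)) + 7*T^2 * (g * (y * K.s^6)) - 21*T^2 * (g * (y * K.s^5)) + 49*T^2 * (g * (y * K.s^4))
     - (7*T + 147*T^2) * (g * (y * K.s^3)) + (35*T + 343*T^2) * (g * (y * K.s^2)) - (49*T + 343*T^2) * (g * (y * K.s))"
    by algebra
  also have "\<dots> = dil 7 (- (t^2)) * (g * K.s powi (- k)) + dil 7 (7*t^2) * (g * K.s powi (- (k + 1)))
     - dil 7 (21*t^2) * (g * K.s powi (- (k + 2))) + dil 7 (49*t^2) * (g * K.s powi (- (k + 3)))
     - dil 7 (7*t + 147*t^2) * (g * K.s powi (- (k + 4))) + dil 7 (35*t + 343*t^2) * (g * K.s powi (- (k + 5)))
     - dil 7 (49*t + 343*t^2) * (g * K.s powi (- (k + 6)))"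
    using sp[of 0] sp[of 1] sp[of 2] sp[of 3] sp[of 4] sp[of 5] sp[of 6]
    by (simp add: T_def dil_add dil_mult dil_minus dil_power dil_numeral)
  finally show "window g (k + 7) = - (t^2) * window g k + 7*t^2 * window g (k + 1) - 21*t^2 * window g (k + 2)
     + 49*t^2 * window g (k + 3) - (7*t + 147*t^2) * window g (k + 4) + (35*t + 343*t^2) * window g (k + 5)
     - (49*t + 343*t^2) * window g (k + 6)"
    unfolding window_def y_def by (simp only: U7_add U7_diff U7_dil_mult)
qed

lemma windowI:
  assumes "k \<le> 0" "seg 0 (g * K.s ^ nat (- k)) = dil 7 w"
  shows "window g k = w"
proof -
  have "K.s powi (- k) = K.s ^ nat (- k)" using assms(1) by (simp add: power_int_def)
  hence "dil 7 (window g k) = dil 7 w" using assms(2) by (simp add: window_def dil_7_U7)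
  thus ?thesis by (simp add: dil_inj)
qed

lemma t_powi: "t powi i = dil 7 (t powi (- i)) * K.s powi (- (4 * i))"
proof -
  have "t = K.tau * K.s powi (- 4)" using t_s s_nonzero by (simp add: power_int_minus field_simps)
  hence "t powi i = K.tau powi i * K.s powi (- (4 * i))"
    by (metis power_int_mult_distrib power_int_mult mult_minus_left)
  moreover have "K.tau powi i = dil 7 (t powi (- i))"
    by (simp add: tau_t power_int_inverse power_int_minus dil_powi dil_inverse)
  ultimately show ?thesis by (simp only:)
qed

text \<open>By \<open>t_s\<close>, t^i is a series in X^7 times s^(-4*i). Whatever lies in X^7
  leaves \<open>U\<close> by the projection formula, and the remainder is a window at 4*i +
  m.\<close>

lemma U7_window:
  assumes "G * K.s ^ m = dil 7 c * g"
  shows "U7 (G * t powi i) = c * (t powi (- i) * window g (4 * i + int m))"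
proof -
  have "K.s powi (- (4 * i)) = K.s powi (- (4 * i + int m)) * K.s ^ m"
    using s_nonzero power_int_add[of K.s "- (4 * i + int m)" "int m"] by simp
  hence "G * t powi i = (G * K.s ^ m) * dil 7 (t powi (- i)) * K.s powi (- (4 * i + int m))"
    unfolding t_powi[of i] by (simp only: mult_ac)
  also have "\<dots> = dil 7 c * (dil 7 (t powi (- i)) * (g * K.s powi (- (4 * i + int m))))"
    unfolding assms by (simp only: mult_ac)
  finally show ?thesis by (simp only: U7_dil_mult window_def)
qed

lemma dil_Theta: "dil 7 (8 * F.tau + 56 - 7 * F.eps) = \<Theta>"
  by (simp add: dil_add dil_diff dil_mult dil_numeral dil_eps_tau)

lemmas dil_window = dil_add dil_diff dil_mult dil_minus dil_power dil_numeral dil_1 dil_eps_tau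

interpretation S: seven_adic t H "window 1" "window D.r" "window (D.r ^ 2)" "window D.sg" "window (D.sg ^ 2)"
  U7 "\<lambda>f. U7 (\<phi> * f)"
proof
  show "F.recurrent (window 1)" "F.recurrent (window D.r)" "F.recurrent (window (D.r ^ 2))"
    "F.recurrent (window D.sg)" "F.recurrent (window (D.sg ^ 2))" by (rule recurrent_window)+
  show "window 1 0 = 1"
    "window 1 (-1) = 1"
    "window 1 (-2) = 1"
    "window 1 (-3) = 7"
    "window 1 (-4) = -4*F.tau-7"
    "window 1 (-5) = -10*F.tau-49"
    "window 1 (-6) = 49"
    by (rule windowI; simp add: dil_window D.P_s)+
  show "window D.r 0 = 1"
    "window D.r (-1) = -1"
    "window D.r (-2) = F.eps - 1"
    "window D.r (-3) = 7"
    "window D.r (-4) = - F.eps*F.tau + F.eps^2 - 6*F.tau - 9*F.eps - 41"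
    "window D.r (-5) = -49"
    "window D.r (-6) = 8*F.eps*F.tau - 14*F.eps^2 + 48*F.tau + 28*F.eps + 329"
    by (rule windowI; simp add: dil_window D.P_r)+
  show "window (D.r ^ 2) 0 = 1"
    "window (D.r ^ 2) (-1) = -7"
    "window (D.r ^ 2) (-2) = -7"
    "window (D.r ^ 2) (-3) = - 4*F.eps*F.tau + 4*F.eps^2 - 36*F.eps - 17"
    "window (D.r ^ 2) (-4) = - 20*F.eps*F.tau + 21*F.eps^2 - 8*F.tau - 140*F.eps - 175"
    "window (D.r ^ 2) (-5) = - 44*F.eps*F.tau + 42*F.eps^2 + 30*F.tau - 280*F.eps - 105"
    "window (D.r ^ 2) (-6) = - 2*F.eps*F.tau^2 + 2*F.eps^2*F.tau - 130*F.eps*F.tau + 98*F.eps^2 + 128*F.tau - 882*F.eps + 441"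
    by (rule windowI; simp add: dil_window D.P_r2)+
  show "window D.sg 0 = 1"
    "window D.sg (-1) = 1"
    "window D.sg (-2) = 2*F.tau - 2*F.eps + 9"
    "window D.sg (-3) = 8*F.tau - 7*F.eps + 49"
    "window D.sg (-4) = 8*F.tau - 14*F.eps + 63"
    "window D.sg (-5) = F.tau^2 - F.eps*F.tau + 29*F.tau - 49*F.eps + 98"
    "window D.sg (-6) = - 8*F.tau^2 + 8*F.eps*F.tau + 48*F.tau - 98*F.eps + 441"
    by (rule windowI; simp add: dil_window D.P_sg)+
  show "window (D.sg ^ 2) 0 = 1"
    "window (D.sg ^ 2) (-1) = - 2*F.tau + 2*F.eps - 9"
    "window (D.sg ^ 2) (-2) = -7"
    "window (D.sg ^ 2) (-3) = - (F.tau^2) + 2*F.eps*F.tau - F.eps^2 + 3*F.tau + 2*F.eps + 48"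
    "window (D.sg ^ 2) (-4) = 49"
    "window (D.sg ^ 2) (-5) = 26*F.tau^2 - 40*F.eps*F.tau + 14*F.eps^2 + 250*F.tau - 224*F.eps + 553"
    "window (D.sg ^ 2) (-6) = 64*F.tau^2 - 112*F.eps*F.tau + 49*F.eps^2 + 896*F.tau - 784*F.eps + 2793"
    by (rule windowI; simp add: dil_window D.P_sg2)+
  show "U7 (f - g) = U7 f - U7 g" "U7 (\<phi> * (f - g)) = U7 (\<phi> * f) - U7 (\<phi> * g)" for f g
    by (simp_all add: U7_diff right_diff_distrib)
  fix i
  show "U7 (t powi i) = t powi (- i) * window 1 (4 * i)"
    using U7_window[of 1 0 1 1 i] by (simp add: dil_1)
  define \<theta> \<eta> where "\<theta> = 8 * F.tau + 56 - 7 * F.eps" and "\<eta> = \<Theta>"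
  have d: "dil 7 \<theta> = \<eta>" unfolding \<theta>_def \<eta>_def by (rule dil_Theta)
  note eqs = H_s[folded \<eta>_def] phi_H[folded \<eta>_def] phi_H2[folded \<eta>_def]
  show "U7 (t powi i * H) = - ((8 * F.tau + 56 - 7 * F.eps) * (t powi (- i) * window D.r (4 * i + 5)))"
    unfolding \<theta>_def[symmetric]
    using U7_window[of H 5 "- \<theta>" D.r i] by (simp add: eqs dil_minus d mult.commute[of _ H])
  have "H ^ 2 * K.s ^ 10 = (H * K.s ^ 5) ^ 2" by algebra
  hence "H ^ 2 * K.s ^ 10 = dil 7 (\<theta> ^ 2) * D.r ^ 2" by (simp add: eqs dil_power d power_mult_distrib)
  thus "U7 (t powi i * H ^ 2) = (8 * F.tau + 56 - 7 * F.eps) ^ 2 * (t powi (- i) * window (D.r ^ 2) (4 * i + 10))"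
    unfolding \<theta>_def[symmetric]
    using U7_window[of "H ^ 2" 10 "\<theta> ^ 2" "D.r ^ 2" i] by (simp add: mult.commute[of _ "H ^ 2"])
  show "U7 (\<phi> * t powi i) = - (t powi (- i) * window (D.sg ^ 2) (4 * i + 5))"
    using U7_window[of \<phi> 5 "- 1" "D.sg ^ 2" i] by (simp add: phi_s dil_minus dil_1)
  have swap: "\<phi> * (t powi i * h) = \<phi> * h * t powi i" for h by (simp only: mult_ac)
  show "U7 (\<phi> * (t powi i * H)) = - ((8 * F.tau + 56 - 7 * F.eps) * (t powi (- i) * window D.sg (4 * i + 8)))"
    unfolding \<theta>_def[symmetric] swap
    using U7_window[of "\<phi> * H" 8 "- \<theta>" D.sg i] by (simp add: eqs dil_minus d)
  show "U7 (\<phi> * (t powi i * H ^ 2)) = - ((8 * F.tau + 56 - 7 * F.eps) ^ 2 * (t powi (- i) * window 1 (4 * i + 11)))"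
    unfolding \<theta>_def[symmetric] swap
    using U7_window[of "\<phi> * H ^ 2" 11 "- (\<theta> ^ 2)" 1 i]
    by (simp add: eqs dil_minus dil_power d)
qed

subsection \<open>Integrality and the congruences\<close>

definition cpx :: "int fps \<Rightarrow> complex fps" where "cpx f = Abs_fps (\<lambda>n. of_int (fps_nth f n))"

lemma cpx_nth [simp]: "fps_nth (cpx f) n = of_int (fps_nth f n)"
  by (simp add: cpx_def)

lemma cpx_mult: "cpx (f * g) = cpx f * cpx g"
  by (simp add: fps_eq_iff fps_mult_nth)

lemma cpx_diff: "cpx (f - g) = cpx f - cpx g"
  by (simp add: fps_eq_iff)

lemma cpx_1: "cpx 1 = 1"
  by (simp add: fps_eq_iff)

lemma cpx_numeral: "cpx (numeral k) = numeral k"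
  by (simp add: fps_eq_iff numeral_fps_const)

lemma cpx_power: "cpx (f ^ n) = cpx f ^ n"
  by (induction n) (simp_all add: cpx_1 cpx_mult)

lemma cpx_X: "cpx fps_X = fps_X"
  by (simp add: fps_eq_iff fps_X_def)

lemma cpx_prod: "cpx (\<Prod>x\<in>A. f x) = (\<Prod>x\<in>A. cpx (f x))"
  by (induction A rule: infinite_finite_induct) (simp_all add: cpx_1 cpx_mult)

lemma cpx_euler: "cpx (euler S) = euler S"
proof -
  have "cpx (\<Prod>m\<in>A. 1 - fps_X ^ m) = (\<Prod>m\<in>A. 1 - fps_X ^ m)" for A
    by (simp add: cpx_prod cpx_diff cpx_1 cpx_power cpx_X)
  from this[THEN arg_cong[where f = "\<lambda>f. fps_nth f n" for n]] show ?thesis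
    by (intro fps_ext) (simp add: euler_def)
qed

lemma J_eq_euler:
  assumes "k > 0"
  shows "J k = euler {m. k dvd m}"
proof (rule agree_all_imp_eq)
  fix n :: nat
  let ?f = "\<lambda>i. k * Suc i"
  have "(\<lambda>N. \<Prod>i\<le>N. 1 - fps_X ^ ?f i :: int fps) \<longlonglongrightarrow> J k"
    by (rule has_prod_imp_tendsto[OF J_has_prod[OF assms]])
  hence "\<forall>\<^sub>F N in sequentially. fps_nth (\<Prod>i\<le>N. 1 - fps_X ^ ?f i) j = fps_nth (J k) j" for j
    by (simp add: tendsto_fps_iff)
  hence "\<forall>\<^sub>F N in sequentially. \<forall>j\<in>{..n}. fps_nth (\<Prod>i\<le>N. 1 - fps_X ^ ?f i) j = fps_nth (J k) j"
    by (intro eventually_ball_finite) auto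
  hence "\<forall>\<^sub>F N in sequentially. n \<le> N \<and> (\<forall>j\<in>{..n}. fps_nth (\<Prod>i\<le>N. 1 - fps_X ^ ?f i) j = fps_nth (J k) j)"
    by (intro eventually_conj eventually_ge_at_top)
  then obtain N where N: "n \<le> N" "\<forall>j\<in>{..n}. fps_nth (\<Prod>i\<le>N. 1 - fps_X ^ ?f i) j = fps_nth (J k) j"
    unfolding eventually_sequentially by blast
  have inj: "inj_on ?f {..N}" using assms by (auto simp: inj_on_def)
  have "agree n (euler {m. k dvd m}) (\<Prod>m\<in>?f ` {..N}. 1 - fps_X ^ m :: int fps)"
  proof (rule agree_euler)
    show "{m. k dvd m} \<inter> {1..n} \<subseteq> ?f ` {..N}"
    proof
      fix m assume m: "m \<in> {m. k dvd m} \<inter> {1..n}"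
      then obtain l where l: "m = k * l" by (auto elim: dvdE)
      then obtain i where i: "l = Suc i" using m by (cases l) auto
      have "l \<le> m" using l assms by simp
      hence "i \<in> {..N}" using i m N(1) by simp
      thus "m \<in> ?f ` {..N}" using l i by blast
    qed
  qed (use assms in auto)
  moreover have "(\<Prod>m\<in>?f ` {..N}. 1 - fps_X ^ m) = (\<Prod>i\<le>N. 1 - fps_X ^ ?f i :: int fps)"
    unfolding prod.reindex[OF inj] o_def ..
  ultimately show "agree n (J k) (euler {m. k dvd m})" using N(2) by (simp add: agree_def)
qed

definition int_series :: "complex fls set" where
  "int_series = range (\<lambda>f. fps_to_fls (cpx f))"

lemma int_series_mult: "a \<in> int_series \<Longrightarrow> b \<in> int_series \<Longrightarrow> a * b \<in> int_series"
  by (auto simp: int_series_def image_iff simp flip: fls_times_fps_to_fls cpx_mult)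

lemma int_series_diff: "a \<in> int_series \<Longrightarrow> b \<in> int_series \<Longrightarrow> a - b \<in> int_series"
  by (auto simp: int_series_def image_iff simp flip: fps_to_fls_minus cpx_diff)

lemma int_series_1: "1 \<in> int_series"
  unfolding int_series_def by (rule image_eqI[of _ _ 1]) (simp_all add: cpx_1)

lemma int_series_numeral: "numeral k \<in> int_series"
  unfolding int_series_def by (rule image_eqI[of _ _ "numeral k"]) (simp_all add: cpx_numeral)

lemma int_series_X: "X \<in> int_series"
  unfolding int_series_def by (rule image_eqI[of _ _ fps_X]) (simp_all add: cpx_X)

lemma int_series_power: "a \<in> int_series \<Longrightarrow> a ^ n \<in> int_series"
  by (induction n) (auto intro: int_series_1 int_series_mult)

lemma int_series_E: "E k \<in> int_series"
  unfolding int_series_def E_def by (rule image_eqI[of _ _ "euler {m. k dvd m}"]) (simp_all add: cpx_euler)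

lemma int_series_inverse_E: "inverse (E k) \<in> int_series"
proof -
  define g where "g = fps_right_inverse (euler {m. k dvd m} :: int fps) 1"
  have "euler {m. k dvd m} * g = 1" unfolding g_def by (rule fps_right_inverse) simp
  hence "cpx (euler {m. k dvd m}) * cpx g = 1" by (simp add: cpx_1 flip: cpx_mult)
  hence "E k * fps_to_fls (cpx g) = 1" by (simp add: E_def cpx_euler flip: fls_times_fps_to_fls)
  hence "inverse (E k) = fps_to_fls (cpx g)" by (rule inverse_unique)
  thus ?thesis by (simp add: int_series_def)
qed

lemmas int_series_intros = int_series_mult int_series_power int_series_E int_series_inverse_E int_series_X int_series_numeral

lemma int_series_t: "t \<in> int_series"
proof -
  have *: "t = X * E 7 ^ 4 * inverse (E 1) ^ 4" by (simp add: t_def divide_inverse power_inverse)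
  show ?thesis unfolding * by (intro int_series_intros)
qed

lemma int_series_H: "H \<in> int_series"
proof -
  have *: "H = 8 * X ^ 3 * E 14 ^ 7 * (inverse (E 1) ^ 3 * inverse (E 2) * inverse (E 7) ^ 3)"
    by (simp add: H_def divide_inverse power_inverse)
  show ?thesis unfolding * by (intro int_series_intros)
qed

definition A :: "complex fls" where "A = E 2 ^ 2 / E 1 ^ 5"

lemma A_eq: "A = fps_to_fls (cpx (Abs_fps PDN1))"
proof -
  have J: "cpx (J k) = euler {m. k dvd m}" if "k > 0" for k using that by (simp add: J_eq_euler cpx_euler)
  have "cpx (Abs_fps PDN1) * euler {m. 1 dvd m} ^ 5 = euler {m. 2 dvd m} ^ 2"
    using PDN1_gf[THEN arg_cong[where f = cpx]] by (simp only: cpx_mult cpx_power J zero_less_one zero_less_numeral)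
  hence "fps_to_fls (cpx (Abs_fps PDN1)) * E 1 ^ 5 = E 2 ^ 2"
    by (simp only: E_def flip: fls_times_fps_to_fls fps_to_fls_power)
  thus ?thesis by (simp add: A_def field_simps)
qed

lemma A_nth: "fls_nth A (int n) = of_int (PDN1 n)"
  by (simp add: A_eq)

lemma int_series_A: "A \<in> int_series" "dil 7 A \<in> int_series"
proof -
  have *: "A = E 2 ^ 2 * inverse (E 1) ^ 5" by (simp add: A_def divide_inverse power_inverse)
  show "A \<in> int_series" unfolding * by (intro int_series_intros)
  have "dil 7 A = E 14 ^ 2 / E 7 ^ 5" by (simp add: A_def dil_divide dil_power dil_E)
  hence **: "dil 7 A = E 14 ^ 2 * inverse (E 7) ^ 5" by (simp add: divide_inverse power_inverse)
  show "dil 7 A \<in> int_series" unfolding ** by (intro int_series_intros)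
qed

definition Q :: "nat \<Rightarrow> complex fls" where "Q a = ((\<lambda>f. U7 (U7 (X ^ 2 * f))) ^^ a) A"

lemma A_nonzero: "A \<noteq> 0" by (simp add: A_def)

lemma phi_A: "\<phi> = X ^ 2 * A / dil 49 A"
  unfolding A_def \<phi>_def by (simp add: dil_divide dil_power dil_E field_simps)

text \<open>X^2*A*f equals A(X^49) times \<phi>*f, and A(X^49) leaves \<open>U\<close> as A(X^7). A
  further application of \<open>U\<close> turns A(X^7) into A, so two steps return to multiples of
  \<open>A\<close>.\<close>

lemma U7_phi:
  assumes "A * f = g"
  shows "dil 7 A * U7 (\<phi> * f) = U7 (X ^ 2 * g)"
proof -
  have "dil 49 A \<noteq> 0" by (rule dil_nonzero) (simp_all add: A_nonzero)
  hence "X ^ 2 * g = dil 49 A * (\<phi> * f)" by (simp add: phi_A assms[symmetric])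
  also have "dil 49 A = dil 7 (dil 7 A)" by (simp add: dil_dil)
  finally show ?thesis by (simp only: U7_dil_mult)
qed

lemma L_Q: "A * S.L a = Q a"
proof (induction a)
  case 0
  thus ?case by (simp add: S.L_def Q_def)
next
  case (Suc a)
  have "A * U7 (U7 (\<phi> * S.L a)) = U7 (dil 7 A * U7 (\<phi> * S.L a))" by (simp only: U7_dil_mult)
  thus ?case using U7_phi[OF Suc] by (simp add: S.L_def Q_def)
qed

lemma shift_offset: "24 * ((49 ^ a - 1) div 24 :: int) = 49 ^ a - 1"
proof -
  have "(24::int) dvd 49 ^ a - 1"
  proof (induction a)
    case (Suc a)
    have "(49::int) ^ Suc a - 1 = 49 * (49 ^ a - 1) + 24 * 2" by simp
    thus ?case using Suc by (metis dvd_add dvd_mult dvd_triv_left)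
  qed simp
  thus ?thesis by simp
qed

lemma X2_nth: "fls_nth (X ^ 2 * f) n = fls_nth f (n - 2)"
  by (simp add: fls_X_power_times_conv_shift)

text \<open>The offsets c_a = (49^a - 1)/24 satisfy c_(a+1) = 2*49^a + c_a; the first summand is the
  shift by X^2 seen through a earlier rounds.\<close>

lemma Q_nth: "fls_nth (Q a) m = fls_nth A (49 ^ a * m - (49 ^ a - 1) div 24)"
proof (induction a arbitrary: m)
  case (Suc a)
  have "(49 ^ Suc a - 1) div 24 = 2 * 49 ^ a + (49 ^ a - 1) div (24::int)"
    using shift_offset[of a] shift_offset[of "Suc a"] by simp
  hence "49 ^ a * (7 * (7 * m) - 2) - (49 ^ a - 1) div 24 = 49 ^ Suc a * m - (49 ^ Suc a - 1) div 24"
    by (simp add: algebra_simps)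
  moreover have "fls_nth (Q (Suc a)) m = fls_nth (Q a) (7 * (7 * m) - 2)" by (simp add: Q_def X2_nth)
  ultimately show ?case using Suc by simp
qed (simp add: Q_def)

lemma dvd_PDN1:
  assumes "f \<in> F.Fil c w d" "d \<ge> 0" "b \<in> int_series" "fls_nth (b * f) m = fls_nth A (int n)"
  shows "[PDN1 n = 0] (mod 7 ^ c)"
proof -
  obtain g where g: "g \<in> int_series" "f = 7 ^ c * g"
    using S.Fil_dvd[OF assms(1,2) int_series_t int_series_H int_series_1 int_series_mult int_series_diff] by blast
  obtain h where h: "b * g = fps_to_fls (cpx h)"
    using int_series_mult[OF assms(3) g(1)] by (auto simp: int_series_def)
  have "b * f = 7 ^ c * fps_to_fls (cpx h)" unfolding g(2) h[symmetric] by (simp only: mult_ac)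
  also have "\<dots> = fps_to_fls (cpx (7 ^ c * h))"
    by (simp add: cpx_mult cpx_power cpx_numeral fls_times_fps_to_fls fps_to_fls_power)
  also have "7 ^ c * h = fps_const (7 ^ c) * h" by (simp add: numeral_fps_const fps_const_power)
  finally have "fls_nth A (int n) = (if m < 0 then 0 else of_int (7 ^ c * fps_nth h (nat m)))"
    unfolding assms(4)[symmetric] by simp
  hence "of_int (PDN1 n) = (of_int (if m < 0 then 0 else 7 ^ c * fps_nth h (nat m)) :: complex)"
    by (simp add: A_nth)
  hence "PDN1 n = (if m < 0 then 0 else 7 ^ c * fps_nth h (nat m))" by (simp only: of_int_eq_iff)
  thus ?thesis by (simp add: cong_0_iff)
qed

theorem theorem1p2:
  fixes n \<alpha> :: nat
  assumes "\<alpha> \<ge> 1"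
  shows "[PDN1 (7 ^ (2 * \<alpha> - 1) * n + (17 * 7 ^ (2 * \<alpha> - 1) + 1) div 24) = 0] (mod 7 ^ \<alpha>)
    \<and> [PDN1 (7 ^ (2 * \<alpha>) * n + (23 * 7 ^ (2 * \<alpha>) + 1) div 24) = 0] (mod 7 ^ (\<alpha> + 1))"
proof
  obtain a where a: "\<alpha> = Suc a" using assms by (cases \<alpha>) auto
  have p: "(7::nat) ^ (2 * \<alpha> - 1) = 7 * 49 ^ a" "(7::nat) ^ (2 * \<alpha>) = 49 * 49 ^ a"
    by (simp_all add: a power_mult)
  define N where "N = 7 ^ (2 * \<alpha> - 1) * n + (17 * 7 ^ (2 * \<alpha> - 1) + 1) div 24"
  have "24 * N = 24 * (7 * 49 ^ a * n) + (17 * (7 * 49 ^ a) + 1)"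
    using offset_odd_exact[OF assms] unfolding N_def p by (simp add: algebra_simps)
  hence "24 * int N = 24 * (7 * 49 ^ a * int n) + (17 * (7 * 49 ^ a) + 1)"
    by (metis (mono_tags) of_nat_add of_nat_mult of_nat_power of_nat_numeral of_nat_1)
  \<comment> \<open>The sequence starts at \<open>Suc n\<close> because 7*m - 2 is negative for m =
    0. Both sides times 24 equal 7*49^a*(24*n + 17) + 1, since 168 - 48 - 1 = 7*17.\<close>
  hence "int N = 49 ^ a * (7 * int (Suc n) - 2) - (49 ^ a - 1) div 24"
    using shift_offset[of a] by (simp add: algebra_simps)
  hence "fls_nth (dil 7 A * U7 (\<phi> * S.L a)) (int (Suc n)) = fls_nth A (int N)"
    unfolding U7_phi[OF L_Q] U7_nth X2_nth Q_nth by simp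
  hence "[PDN1 N = 0] (mod 7 ^ \<alpha>)"
    unfolding a by (rule dvd_PDN1[OF conjunct1[OF S.L_Fil] _ int_series_A(2), rotated]) simp
  thus "[PDN1 (7 ^ (2 * \<alpha> - 1) * n + (17 * 7 ^ (2 * \<alpha> - 1) + 1) div 24) = 0] (mod 7 ^ \<alpha>)"
    unfolding N_def .
  define M where "M = 7 ^ (2 * \<alpha>) * n + (23 * 7 ^ (2 * \<alpha>) + 1) div 24"
  have "24 * M = 24 * (49 * 49 ^ a * n) + (23 * (49 * 49 ^ a) + 1)"
    using offset_even_exact[of \<alpha>] unfolding M_def p by (simp add: algebra_simps)
  hence "24 * int M = 24 * (49 * 49 ^ a * int n) + (23 * (49 * 49 ^ a) + 1)"
    by (metis (mono_tags) of_nat_add of_nat_mult of_nat_power of_nat_numeral of_nat_1)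
  \<comment> \<open>Here 24*(n + 1) - 1 = 24*n + 23 accounts for the constant 23.\<close>
  hence "int M = 49 ^ Suc a * int (Suc n) - (49 ^ Suc a - 1) div 24"
    using shift_offset[of "Suc a"] by (simp add: algebra_simps)
  hence "fls_nth (A * S.L (Suc a)) (int (Suc n)) = fls_nth A (int M)"
    unfolding L_Q Q_nth by simp
  hence "[PDN1 M = 0] (mod 7 ^ Suc (Suc a))"
    by (rule dvd_PDN1[OF conjunct2[OF S.L_Fil] _ int_series_A(1), rotated]) simp
  moreover have "\<alpha> + 1 = Suc (Suc a)" by (simp add: a)
  ultimately show "[PDN1 (7 ^ (2 * \<alpha>) * n + (23 * 7 ^ (2 * \<alpha>) + 1) div 24) = 0] (mod 7 ^ (\<alpha> + 1))"
    unfolding M_def by simp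
qed

end
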